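(* $\mathrm{cobs}(\mathbb C_{<3/2})=\mathbb A\cup\{\mathcal D,\mathcal C,\mathcal M\}$, where $\mathbb A=\{\mathcal G^A : A\in\mathcal A\}$ and $\mathcal A,\mathcal G^A,\mathcal D,\mathcal C,\mathcal M$ are as defined in the context.
   Context: Graphs are finite, without loops or multiple edges, and considered up to isomorphism. All graph classes considered are minor-closed and proper (a class is proper if it does not contain all graphs). For a graph class $\mathcal G$ let $\mathrm{ex}(\mathcal G,n)=\max\{|E(G)| : G\in\mathcal G,\ |V(G)|=n\}$. The limiting density of an infinite class is $\delta(\mathcal G)=\lim_{n\to\infty}\mathrm{ex}(\mathcal G,n)/n$; if $\mathcal G$ is finite then $\delta(\mathcal G)=-\infty$. $\mathbb C_{<3/2}$ is the set of all minor-closed graph classes $\mathcal G$ with $\delta(\mathcal G)<3/2$. For a set $\mathbb C$ of minor-closed classes, $\mathrm{cobs}(\mathbb C)$ is the set of all $\subseteq$-minimal minor-closed graph classes that do not belong to $\mathbb C$. For a graph $H$, $k\cdot H$ is the disjoint union of $k$ copies of $H$ and $\mathcal G^H$ is the class of all minors of the graphs $k\cdot H$, $k\ge1$. The $k$-daisy $\mathscr D_k$ is obtained from $k\cdot K_2$ by adding a new vertex adjacent to all vertices ($k$ triangles sharing one common vertex). The $k$-chain $\mathscr C_k$ is the connected graph with exactly $k$ blocks, all triangles, arranged in a path: it has vertices $p_0,\dots,p_k,q_1,\dots,q_k$ and triangles $p_{i-1}p_iq_i$, $1\le i\le k$. The $k$-diamond $\mathscr M_k$ consists of two adjacent vertices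 and $k$ further pairwise non-adjacent vertices, each adjacent to both of them. $\mathcal D,\mathcal C,\mathcal M$ are the classes of all minors of the graphs $\mathscr D_k$, $\mathscr C_k$, $\mathscr M_k$ ($k\ge 1$), respectively. A 2-tree is defined recursively: $K_3$ is a 2-tree, and every graph on more than 3 vertices having a vertex $v$ whose neighborhood induces a $K_2$ and such that $G-v$ is a 2-tree is a 2-tree. A block of a graph is a maximal 2-connected subgraph or a bridge. $\mathcal A=\mathcal A_4\cup\mathcal A_6\cup\mathcal A_8\cup\mathcal A_{10}$, where $\mathcal A_4=\{K_4\}$; $\mathcal A_6$ is the set of all 2-trees on 6 vertices; $\mathcal A_8$ is the set of all connected graphs with exactly two blocks, one isomorphic to a 5-vertex 2-tree and the other to the unique 4-vertex 2-tree; $\mathcal A_{10}$ is the set of all connected graphs with exactly three blocks, each isomorphic to the unique 4-vertex 2-tree. *)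

theory Defs
  imports Complex_Main "HOL-Library.Extended_Real"
begin

section \<open>Finite simple graphs\<close>

record 'a graph =
  verts :: "'a set"
  edges :: "'a set set"

definition is_graph :: "'a graph \<Rightarrow> bool" where
  "is_graph G \<longleftrightarrow> finite (verts G) \<and> (\<forall>e\<in>edges G. e \<subseteq> verts G \<and> card e = 2)"

definition isomorphic :: "'a graph \<Rightarrow> 'b graph \<Rightarrow> bool" (infix "\<cong>\<^sub>g" 50) where
  "G \<cong>\<^sub>g H \<longleftrightarrow> (\<exists>f. bij_betw f (verts G) (verts H) \<and> edges H = (\<lambda>e. f ` e) ` edges G)"

definition subgraph :: "'a graph \<Rightarrow> 'a graph \<Rightarrow> bool" where
  "subgraph H G \<longleftrightarrow> is_graph H \<and> verts H \<subseteq> verts G \<and> edges H \<subseteq> edges G"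

definition induced :: "'a graph \<Rightarrow> 'a set \<Rightarrow> 'a graph" where
  "induced G U = \<lparr>verts = verts G \<inter> U, edges = {e \<in> edges G. e \<subseteq> U}\<rparr>"

definition delete_vertex :: "'a graph \<Rightarrow> 'a \<Rightarrow> 'a graph" where
  "delete_vertex G v = induced G (verts G - {v})"

definition delete_edge :: "'a graph \<Rightarrow> 'a set \<Rightarrow> 'a graph" where
  "delete_edge G e = \<lparr>verts = verts G, edges = edges G - {e}\<rparr>"

definition neighborhood :: "'a graph \<Rightarrow> 'a \<Rightarrow> 'a set" where
  "neighborhood G v = {u \<in> verts G. {u, v} \<in> edges G}"

definition reachable :: "'a graph \<Rightarrow> ('a \<times> 'a) set" where
  "reachable G = {(u, v). {u, v} \<in> edges G}\<^sup>* \<inter> verts G \<times> verts G"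

definition components :: "'a graph \<Rightarrow> 'a set set" where
  "components G = verts G // reachable G"

definition connected_graph :: "'a graph \<Rightarrow> bool" where
  "connected_graph G \<longleftrightarrow> verts G \<noteq> {} \<and> reachable G = verts G \<times> verts G"

definition two_connected :: "'a graph \<Rightarrow> bool" where
  "two_connected G \<longleftrightarrow>
     card (verts G) \<ge> 3 \<and> connected_graph G \<and> (\<forall>v\<in>verts G. connected_graph (delete_vertex G v))"

definition bridge :: "'a graph \<Rightarrow> 'a set \<Rightarrow> bool" where
  "bridge G e \<longleftrightarrow> e \<in> edges G \<and> card (components (delete_edge G e)) > card (components G)"

text \<open>A bridge, as a block, is the subgraph consisting of that edge and its two ends.\<close>

definition blocks :: "'a graph \<Rightarrow> 'a graph set" where
  "blocks G =
     {B. subgraph B G \<and> two_connected B \<and>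
         (\<forall>B'. subgraph B' G \<and> two_connected B' \<and> subgraph B B' \<longrightarrow> B' = B)}
     \<union> {\<lparr>verts = e, edges = {e}\<rparr> | e. bridge G e}"

text \<open>
  \<open>H\<close> is a minor of \<open>G\<close> if it has a model in \<open>G\<close>: pairwise disjoint nonempty connected branch
  sets, one for each vertex of \<open>H\<close>, such that adjacent vertices of \<open>H\<close> have branch sets joined
  by an edge of \<open>G\<close>. The two vertex types may differ, so the relation is invariant under
  isomorphism on both sides. The graph without vertices is a minor of every graph.
\<close>

definition minor :: "'a graph \<Rightarrow> 'b graph \<Rightarrow> bool" where
  "minor H G \<longleftrightarrow> (\<exists>\<mu> :: 'a \<Rightarrow> 'b set.
     (\<forall>u\<in>verts H. \<mu> u \<subseteq> verts G \<and> connected_graph (induced G (\<mu> u))) \<and>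
     (\<forall>u\<in>verts H. \<forall>v\<in>verts H. u \<noteq> v \<longrightarrow> \<mu> u \<inter> \<mu> v = {}) \<and>
     (\<forall>u v. {u, v} \<in> edges H \<longrightarrow> (\<exists>x\<in>\<mu> u. \<exists>y\<in>\<mu> v. {x, y} \<in> edges G)))"

section \<open>Graph classes and limiting density\<close>

text \<open>
  Every finite graph has an isomorphic copy on a subset of \<open>nat\<close>. A class of graphs up to
  isomorphism is represented by the set of all copies on natural numbers of its members;
  closure under minors includes closure under isomorphism.
\<close>

definition minor_closed :: "nat graph set \<Rightarrow> bool" where
  "minor_closed \<G> \<longleftrightarrow>
     (\<forall>G\<in>\<G>. is_graph G) \<and> (\<forall>G\<in>\<G>. \<forall>H. is_graph H \<and> minor H G \<longrightarrow> H \<in> \<G>)"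

definition proper_class :: "nat graph set \<Rightarrow> bool" where
  "proper_class \<G> \<longleftrightarrow> \<G> \<noteq> {G. is_graph G}"

definition graph_class :: "nat graph set \<Rightarrow> bool" where
  "graph_class \<G> \<longleftrightarrow> minor_closed \<G> \<and> proper_class \<G>"

text \<open>Finiteness of a class is counted up to isomorphism.\<close>

definition finite_class :: "nat graph set \<Rightarrow> bool" where
  "finite_class \<G> \<longleftrightarrow> finite (\<G> // {(G, H). is_graph G \<and> is_graph H \<and> G \<cong>\<^sub>g H})"

definition ex :: "nat graph set \<Rightarrow> nat \<Rightarrow> nat" where
  "ex \<G> n = Max {card (edges G) | G. G \<in> \<G> \<and> card (verts G) = n}"

definition limiting_density :: "nat graph set \<Rightarrow> ereal" where
  "limiting_density \<G> =
     (if finite_class \<G> then - \<infinity> else lim (\<lambda>n. ereal (real (ex \<G> n) / real n)))"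

definition density_below :: "real \<Rightarrow> nat graph set set" where
  "density_below c = {\<G>. graph_class \<G> \<and> limiting_density \<G> < ereal c}"

definition cobs :: "nat graph set set \<Rightarrow> nat graph set set" where
  "cobs \<CC> = {\<G>. graph_class \<G> \<and> \<G> \<notin> \<CC> \<and>
     (\<forall>\<H>. graph_class \<H> \<and> \<H> \<notin> \<CC> \<and> \<H> \<subseteq> \<G> \<longrightarrow> \<H> = \<G>)}"

definition minors_of_family :: "(nat \<Rightarrow> 'a graph) \<Rightarrow> nat graph set" where
  "minors_of_family F = {G. is_graph G \<and> (\<exists>k\<ge>1. minor G (F k))}"

section \<open>The particular graphs and classes\<close>

definition complete_graph :: "nat \<Rightarrow> nat graph" where
  "complete_graph n = \<lparr>verts = {..<n}, edges = {e. e \<subseteq> {..<n} \<and> card e = 2}\<rparr>"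

definition copies :: "nat \<Rightarrow> 'a graph \<Rightarrow> (nat \<times> 'a) graph" where
  "copies k H = \<lparr>verts = {..<k} \<times> verts H, edges = {{i} \<times> e | i e. i < k \<and> e \<in> edges H}\<rparr>"

definition class_of_copies :: "'a graph \<Rightarrow> nat graph set" where
  "class_of_copies H = minors_of_family (\<lambda>k. copies k H)"

definition add_apex :: "'a graph \<Rightarrow> 'a option graph" where
  "add_apex G = \<lparr>verts = insert None (Some ` verts G),
     edges = (\<lambda>e. Some ` e) ` edges G \<union> {{None, Some v} | v. v \<in> verts G}\<rparr>"

definition daisy :: "nat \<Rightarrow> (nat \<times> nat) option graph" where
  "daisy k = add_apex (copies k (complete_graph 2))"

text \<open>\<open>Inl i\<close> is the vertex $p_i$ and \<open>Inr i\<close> is the vertex $q_i$.\<close>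

definition chain :: "nat \<Rightarrow> (nat + nat) graph" where
  "chain k = \<lparr>verts = Inl ` {0..k} \<union> Inr ` {1..k},
     edges = (\<Union>i\<in>{1..k}. {{Inl (i - 1), Inl i}, {Inl (i - 1), Inr i}, {Inl i, Inr i}})\<rparr>"

text \<open>The two adjacent vertices are \<open>Inl False\<close> and \<open>Inl True\<close>.\<close>

definition diamond :: "nat \<Rightarrow> (bool + nat) graph" where
  "diamond k = \<lparr>verts = range Inl \<union> Inr ` {..<k},
     edges = insert {Inl False, Inl True} {{Inl b, Inr i} | b i. i < k}\<rparr>"

definition daisy_class :: "nat graph set" where
  "daisy_class = minors_of_family daisy"

definition chain_class :: "nat graph set" where
  "chain_class = minors_of_family chain"

definition diamond_class :: "nat graph set" where
  "diamond_class = minors_of_family diamond"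

inductive two_tree :: "'a graph \<Rightarrow> bool" where
  triangle: "is_graph G \<Longrightarrow> G \<cong>\<^sub>g complete_graph 3 \<Longrightarrow> two_tree G"
| extend: "is_graph G \<Longrightarrow> card (verts G) > 3 \<Longrightarrow> v \<in> verts G \<Longrightarrow>
    induced G (neighborhood G v) \<cong>\<^sub>g complete_graph 2 \<Longrightarrow>
    two_tree (delete_vertex G v) \<Longrightarrow> two_tree G"

definition \<A>\<^sub>4 :: "nat graph set" where
  "\<A>\<^sub>4 = {G. is_graph G \<and> G \<cong>\<^sub>g complete_graph 4}"

definition \<A>\<^sub>6 :: "nat graph set" where
  "\<A>\<^sub>6 = {G. two_tree G \<and> card (verts G) = 6}"

text \<open>
  Being a 2-tree is invariant under isomorphism, so a block isomorphic to a 2-tree on \<open>n\<close>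
  vertices is itself a 2-tree on \<open>n\<close> vertices.
\<close>

definition \<A>\<^sub>8 :: "nat graph set" where
  "\<A>\<^sub>8 = {G. is_graph G \<and> connected_graph G \<and>
     (\<exists>B\<^sub>1 B\<^sub>2. B\<^sub>1 \<noteq> B\<^sub>2 \<and> blocks G = {B\<^sub>1, B\<^sub>2} \<and>
        two_tree B\<^sub>1 \<and> card (verts B\<^sub>1) = 5 \<and> two_tree B\<^sub>2 \<and> card (verts B\<^sub>2) = 4)}"

definition \<A>\<^sub>1\<^sub>0 :: "nat graph set" where
  "\<A>\<^sub>1\<^sub>0 = {G. is_graph G \<and> connected_graph G \<and> card (blocks G) = 3 \<and>
     (\<forall>B\<in>blocks G. two_tree B \<and> card (verts B) = 4)}"

definition \<A> :: "nat graph set" where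
  "\<A> = \<A>\<^sub>4 \<union> \<A>\<^sub>6 \<union> \<A>\<^sub>8 \<union> \<A>\<^sub>1\<^sub>0"

definition \<AA> :: "nat graph set set" where
  "\<AA> = {class_of_copies A | A. A \<in> \<A>}"

end

theory Submission
  imports Defs
begin

text \<open>
  Let the excess of a graph with \<open>n\<close> vertices and \<open>e\<close> edges be \<open>2e - 3n + 3\<close>; call the graph dense if
  \<open>2e \<ge> 3n\<close>, that is, if its excess is at least 3. The theorem rests on two facts about connected
  graphs, and both are proved by contracting edges until no contraction is harmless.

  The first one is \<open>large_excess_forces_minor\<close>: for all \<open>k\<close>, \<open>l\<close>, \<open>m\<close> a connected graph whose
  number of edges exceeds its number of vertices by a large constant has \<open>daisy k\<close>, \<open>chain l\<close> or
  \<open>diamond m\<close> as a minor. Contracting an edge that lies in no triangle preserves \<open>e - n\<close>. Once every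
  edge lies in a triangle, a vertex of large degree has a large matching or a large star in its
  neighbourhood, which is a daisy or a diamond, and a long shortest path carries disjoint triangles,
  which form a chain.

  The second one is \<open>minimal_dense_in_\<A>\<close>: a minor-minimal dense connected graph belongs to \<open>\<A>\<close>.
  Minimality forces every edge into a triangle and every triangle to share an edge with another one.
  Unless the graph is the complete graph on four vertices, a largest 2-tree in it is attached to the
  rest at single vertices only. So the graph is glued from 2-trees at cut vertices, and counting
  edges leaves the shapes of \<open>\<A>\<close>.

  Let a minor-closed class contain no obstruction. By the first fact every connected member has
  \<open>e \<le> n + c\<close>. By the second fact every dense component of a member has a minor in \<open>\<A>\<close>, and since
  many disjoint copies of such a minor are excluded, the number of dense components is bounded. A
  component that is not dense has \<open>e \<le> (3n - 1)/2\<close> and \<open>e \<le> n + c\<close>, which keeps its density below 3/2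
  by a constant. This bounds the upper limit (\<open>density_bounded_away\<close>). The limit exists
  (\<open>limiting_density_converges\<close>), because a density above that of trees is caused by many small
  components, and unions of such components are dense at every order.

  Conversely the members of \<open>\<A>\<close> are tight: their excess is 3, and every connected minor of excess at
  least 3 has as many vertices (\<open>tight_\<A>\<close>). This follows from the additivity of the excess under
  gluing at a vertex and from the bound \<open>2n - 3\<close> for the edges of minors of 2-trees. The connected minors
  of daisies and chains have excess at most 0. These bounds give the densities of the obstructions
  and most of the non-inclusions between them (\<open>obstructions_antichain\<close>). A class of density at least
  3/2 contains an obstruction and no obstruction contains another one, so the obstructions are
  exactly the minimal classes.
\<close>

section \<open>Connectivity by cuts\<close>

lemma edge_in_graphD:
  assumes "is_graph G" "{x, y} \<in> edges G"
  shows "x \<in> verts G" "y \<in> verts G" "x \<noteq> y"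
  using assms by (auto simp: is_graph_def)

lemma edge_in_graphE:
  assumes "is_graph G" "e \<in> edges G"
  obtains x y where "e = {x, y}" "x \<noteq> y" "x \<in> verts G" "y \<in> verts G"
  using assms unfolding is_graph_def card_2_iff by (metis insert_subset)

lemma finite_edges: "is_graph G \<Longrightarrow> finite (edges G)"
  unfolding is_graph_def by (meson PowI finite_Pow_iff finite_subset subsetI)

lemma finite_verts: "is_graph G \<Longrightarrow> finite (verts G)"
  by (simp add: is_graph_def)

lemma is_graph_induced: "is_graph G \<Longrightarrow> is_graph (induced G U)"
  by (auto simp: is_graph_def induced_def)

lemma verts_induced: "U \<subseteq> verts G \<Longrightarrow> verts (induced G U) = U"
  by (auto simp: induced_def)

lemma edges_induced: "edges (induced G U) = {e \<in> edges G. e \<subseteq> U}"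
  by (simp add: induced_def)

lemma induced_verts: "is_graph G \<Longrightarrow> induced G (verts G) = G"
  by (cases G) (auto simp: induced_def is_graph_def)

definition separated :: "'a graph \<Rightarrow> 'a set \<Rightarrow> bool" where
  "separated G S \<longleftrightarrow> S \<subseteq> verts G \<and> S \<noteq> {} \<and> S \<noteq> verts G \<and>
     (\<forall>x\<in>S. \<forall>y\<in>verts G - S. {x, y} \<notin> edges G)"

text \<open>
  This characterisation turns arguments about walks into the choice of one edge that crosses a cut.
\<close>

lemma connected_iff_no_separation:
  assumes "is_graph G"
  shows "connected_graph G \<longleftrightarrow> verts G \<noteq> {} \<and> (\<forall>S. \<not> separated G S)"
proof
  assume con: "connected_graph G"
  have "\<not> separated G S" for S
  proof
    assume S: "separated G S"
    then obtain a b where ab: "a \<in> S" "b \<in> verts G - S" unfolding separated_def by blast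
    then have "(a, b) \<in> {(u, v). {u, v} \<in> edges G}\<^sup>*"
      using con S unfolding connected_graph_def reachable_def separated_def by blast
    then have "b \<in> S"
    proof (induction rule: rtrancl_induct)
      case base
      then show ?case using ab by simp
    next
      case (step y z)
      then show ?case using S edge_in_graphD[OF assms, of y z] unfolding separated_def by blast
    qed
    then show False using ab by blast
  qed
  then show "verts G \<noteq> {} \<and> (\<forall>S. \<not> separated G S)"
    using con unfolding connected_graph_def by blast
next
  assume h: "verts G \<noteq> {} \<and> (\<forall>S. \<not> separated G S)"
  have "(u, w) \<in> {(u, v). {u, v} \<in> edges G}\<^sup>*" if u: "u \<in> verts G" and w: "w \<in> verts G" for u w
  proof -
    let ?S = "{y \<in> verts G. (u, y) \<in> {(u, v). {u, v} \<in> edges G}\<^sup>*}"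
    have "{x, y} \<notin> edges G" if "x \<in> ?S" "y \<in> verts G - ?S" for x y
      using that by (auto intro: rtrancl_into_rtrancl)
    then have "?S = verts G" using h u unfolding separated_def by blast
    then show ?thesis using w by blast
  qed
  then show "connected_graph G"
    using h unfolding connected_graph_def reachable_def by auto
qed

lemma connectedI:
  assumes "is_graph G" "verts G \<noteq> {}"
    and "\<And>S. S \<subseteq> verts G \<Longrightarrow> S \<noteq> {} \<Longrightarrow> S \<noteq> verts G \<Longrightarrow> \<exists>x\<in>S. \<exists>y\<in>verts G - S. {x, y} \<in> edges G"
  shows "connected_graph G"
  using assms unfolding connected_iff_no_separation[OF assms(1)] separated_def by blast

lemma connected_crossing:
  assumes "is_graph G" "connected_graph G" "S \<subseteq> verts G" "S \<noteq> {}" "S \<noteq> verts G"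
  obtains x y where "x \<in> S" "y \<in> verts G - S" "{x, y} \<in> edges G"
  using assms unfolding connected_iff_no_separation[OF assms(1)] separated_def by blast

lemma connected_nonempty: "connected_graph G \<Longrightarrow> verts G \<noteq> {}"
  by (simp add: connected_graph_def)

abbreviation connected_set :: "'a graph \<Rightarrow> 'a set \<Rightarrow> bool" where
  "connected_set G U \<equiv> connected_graph (induced G U)"

lemma connected_setI:
  assumes "is_graph G" "U \<subseteq> verts G" "U \<noteq> {}"
    and "\<And>S. S \<subseteq> U \<Longrightarrow> S \<noteq> {} \<Longrightarrow> S \<noteq> U \<Longrightarrow> \<exists>x\<in>S. \<exists>y\<in>U - S. {x, y} \<in> edges G"
  shows "connected_set G U"
proof (rule connectedI)
  show "is_graph (induced G U)" using assms(1) by (rule is_graph_induced)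
  show "verts (induced G U) \<noteq> {}" using assms by (simp add: verts_induced)
  fix S assume S: "S \<subseteq> verts (induced G U)" "S \<noteq> {}" "S \<noteq> verts (induced G U)"
  then have SU: "S \<subseteq> U" "S \<noteq> U" using assms(2) by (auto simp: verts_induced)
  then obtain x y where "x \<in> S" "y \<in> U - S" "{x, y} \<in> edges G" using assms(4) S by blast
  then show "\<exists>x\<in>S. \<exists>y\<in>verts (induced G U) - S. {x, y} \<in> edges (induced G U)"
    using SU assms(2) by (auto simp: verts_induced edges_induced)
qed

lemma connected_set_crossing:
  assumes "is_graph G" "connected_set G U" "U \<subseteq> verts G" "S \<subseteq> U" "S \<noteq> {}" "S \<noteq> U"
  obtains x y where "x \<in> S" "y \<in> U - S" "{x, y} \<in> edges G"
proof -
  obtain x y where "x \<in> S" "y \<in> verts (induced G U) - S" "{x, y} \<in> edges (induced G U)"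
    using connected_crossing[OF is_graph_induced[OF assms(1)] assms(2), of S] assms(3-6)
    by (metis verts_induced)
  then show ?thesis using that assms(3) by (simp add: verts_induced edges_induced)
qed

lemma connected_set_nonempty: "connected_set G U \<Longrightarrow> U \<noteq> {}"
  using connected_nonempty[of "induced G U"] by (auto simp: induced_def)

lemma connected_set_verts: "is_graph G \<Longrightarrow> connected_set G (verts G) \<longleftrightarrow> connected_graph G"
  by (simp add: induced_verts)

lemma connected_set_singleton: "is_graph G \<Longrightarrow> x \<in> verts G \<Longrightarrow> connected_set G {x}"
  by (rule connected_setI) auto

lemma connected_set_union:
  assumes G: "is_graph G" and A: "connected_set G A" "A \<subseteq> verts G" and B: "connected_set G B" "B \<subseteq> verts G"
    and link: "A \<inter> B \<noteq> {} \<or> (\<exists>x\<in>A. \<exists>y\<in>B. {x, y} \<in> edges G)"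
  shows "connected_set G (A \<union> B)"
proof (rule connected_setI[OF G])
  show "A \<union> B \<subseteq> verts G" using A B by blast
  show "A \<union> B \<noteq> {}" using connected_set_nonempty[OF A(1)] by blast
  fix S assume S: "S \<subseteq> A \<union> B" "S \<noteq> {}" "S \<noteq> A \<union> B"
  show "\<exists>x\<in>S. \<exists>y\<in>A \<union> B - S. {x, y} \<in> edges G"
  proof (cases "(S \<inter> A \<noteq> {} \<and> S \<inter> A \<noteq> A) \<or> (S \<inter> B \<noteq> {} \<and> S \<inter> B \<noteq> B)")
    case True
    then show ?thesis
      using connected_set_crossing[OF G A, of "S \<inter> A"] connected_set_crossing[OF G B, of "S \<inter> B"]
      by (metis DiffD1 DiffD2 DiffI IntD1 IntI UnCI inf_le2)
  next
    case False
    then have "(S = A \<and> S \<inter> B = {}) \<or> (S = B \<and> S \<inter> A = {})" using S by blast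
    then show ?thesis
    proof
      assume "S = A \<and> S \<inter> B = {}"
      then show ?thesis using link S by blast
    next
      assume S': "S = B \<and> S \<inter> A = {}"
      then have "A \<inter> B = {}" by blast
      then obtain x y where "x \<in> A" "y \<in> B" "{y, x} \<in> edges G"
        using link by (metis insert_commute)
      then show ?thesis using S' by blast
    qed
  qed
qed

lemma connected_set_edge:
  assumes "is_graph G" "{x, y} \<in> edges G"
  shows "connected_set G {x, y}"
  using connected_set_union[OF assms(1), of "{x}" "{y}"] connected_set_singleton[OF assms(1)]
    edge_in_graphD[OF assms] assms(2) by (simp add: insert_commute)

lemma connected_supergraph:
  assumes "connected_graph H" "is_graph H" "is_graph G" "verts H = verts G" "edges H \<subseteq> edges G"
  shows "connected_graph G"
proof (rule connectedI[OF assms(3)])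
  show "verts G \<noteq> {}" using assms(4) connected_nonempty[OF assms(1)] by simp
  fix S assume "S \<subseteq> verts G" "S \<noteq> {}" "S \<noteq> verts G"
  then obtain x y where "x \<in> S" "y \<in> verts H - S" "{x, y} \<in> edges H"
    using connected_crossing[OF assms(2,1), of S] assms(4) by metis
  then show "\<exists>x\<in>S. \<exists>y\<in>verts G - S. {x, y} \<in> edges G" using assms(4,5) by auto
qed

lemma connected_set_Union:
  assumes G: "is_graph G" and I: "I \<noteq> {}"
    and A: "\<And>i. i \<in> I \<Longrightarrow> connected_set G (A i) \<and> A i \<subseteq> verts G"
    and link: "\<And>J. J \<subseteq> I \<Longrightarrow> J \<noteq> {} \<Longrightarrow> J \<noteq> I \<Longrightarrow> \<exists>i\<in>J. \<exists>j\<in>I - J. \<exists>x\<in>A i. \<exists>y\<in>A j. {x, y} \<in> edges G"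
    and disj: "\<And>i j. i \<in> I \<Longrightarrow> j \<in> I \<Longrightarrow> i \<noteq> j \<Longrightarrow> A i \<inter> A j = {}"
  shows "connected_set G (\<Union>i\<in>I. A i)"
proof (rule connected_setI[OF G])
  show "(\<Union>i\<in>I. A i) \<subseteq> verts G" using A by blast
  show "(\<Union>i\<in>I. A i) \<noteq> {}" using I A connected_set_nonempty by fastforce
  fix S assume S: "S \<subseteq> (\<Union>i\<in>I. A i)" "S \<noteq> {}" "S \<noteq> (\<Union>i\<in>I. A i)"
  show "\<exists>x\<in>S. \<exists>y\<in>(\<Union>i\<in>I. A i) - S. {x, y} \<in> edges G"
  proof (cases "\<exists>i\<in>I. S \<inter> A i \<noteq> {} \<and> S \<inter> A i \<noteq> A i")
    case True
    then obtain i where i: "i \<in> I" "S \<inter> A i \<noteq> {}" "S \<inter> A i \<noteq> A i" by blast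
    obtain x y where "x \<in> S \<inter> A i" "y \<in> A i - S \<inter> A i" "{x, y} \<in> edges G"
      using connected_set_crossing[OF G, of "A i" "S \<inter> A i"] A[OF i(1)] i by blast
    then show ?thesis using i(1) by blast
  next
    case False
    let ?J = "{i \<in> I. A i \<subseteq> S}"
    have "?J \<noteq> {}" "?J \<noteq> I" using False S by blast+
    then obtain i j x y where ij: "i \<in> ?J" "j \<in> I - ?J" "x \<in> A i" "y \<in> A j" "{x, y} \<in> edges G"
      using link[of ?J] by blast
    then have "y \<notin> S" using False by blast
    then show ?thesis using ij by blast
  qed
qed

section \<open>Minors\<close>

definition model :: "'a graph \<Rightarrow> 'b graph \<Rightarrow> ('a \<Rightarrow> 'b set) \<Rightarrow> bool" where
  "model H G \<mu> \<longleftrightarrow>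
     (\<forall>u\<in>verts H. \<mu> u \<subseteq> verts G \<and> connected_set G (\<mu> u)) \<and>
     (\<forall>u\<in>verts H. \<forall>v\<in>verts H. u \<noteq> v \<longrightarrow> \<mu> u \<inter> \<mu> v = {}) \<and>
     (\<forall>u v. {u, v} \<in> edges H \<longrightarrow> (\<exists>x\<in>\<mu> u. \<exists>y\<in>\<mu> v. {x, y} \<in> edges G))"

lemma minor_iff_model: "minor H G \<longleftrightarrow> (\<exists>\<mu>. model H G \<mu>)"
  by (simp add: minor_def model_def)

lemma modelD:
  assumes "model H G \<mu>"
  shows "u \<in> verts H \<Longrightarrow> \<mu> u \<subseteq> verts G" "u \<in> verts H \<Longrightarrow> connected_set G (\<mu> u)"
    "u \<in> verts H \<Longrightarrow> \<mu> u \<noteq> {}"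
    "u \<in> verts H \<Longrightarrow> v \<in> verts H \<Longrightarrow> u \<noteq> v \<Longrightarrow> \<mu> u \<inter> \<mu> v = {}"
    "{u, v} \<in> edges H \<Longrightarrow> \<exists>x\<in>\<mu> u. \<exists>y\<in>\<mu> v. {x, y} \<in> edges G"
  using assms connected_set_nonempty unfolding model_def by blast+

lemma modelI:
  assumes "\<And>u. u \<in> verts H \<Longrightarrow> \<mu> u \<subseteq> verts G" "\<And>u. u \<in> verts H \<Longrightarrow> connected_set G (\<mu> u)"
    "\<And>u v. u \<in> verts H \<Longrightarrow> v \<in> verts H \<Longrightarrow> u \<noteq> v \<Longrightarrow> \<mu> u \<inter> \<mu> v = {}"
    "\<And>u v. {u, v} \<in> edges H \<Longrightarrow> \<exists>x\<in>\<mu> u. \<exists>y\<in>\<mu> v. {x, y} \<in> edges G"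
  shows "model H G \<mu>"
  using assms unfolding model_def by blast

lemma embedding_minor:
  assumes "is_graph G" "f ` verts H \<subseteq> verts G" "inj_on f (verts H)"
    "\<And>u v. {u, v} \<in> edges H \<Longrightarrow> {f u, f v} \<in> edges G"
  shows "minor H G"
  unfolding minor_iff_model
proof (intro exI modelI)
  fix u assume u: "u \<in> verts H"
  show "{f u} \<subseteq> verts G" "connected_set G {f u}"
    using assms u by (auto intro: connected_set_singleton)
qed (use assms in \<open>auto simp: inj_on_def\<close>)

lemma subgraph_minor: "is_graph G \<Longrightarrow> subgraph H G \<Longrightarrow> minor H G"
  by (rule embedding_minor[where f = id]) (auto simp: subgraph_def)

lemma minor_refl: "is_graph G \<Longrightarrow> minor G G"
  by (rule subgraph_minor) (auto simp: subgraph_def)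

lemma minor_trans:
  assumes HG: "minor H G" and GK: "minor G K" and G: "is_graph G" and K: "is_graph K"
    and H: "is_graph H"
  shows "minor H K"
proof -
  obtain \<mu> where \<mu>: "model H G \<mu>" using HG unfolding minor_iff_model by blast
  obtain \<nu> where \<nu>: "model G K \<nu>" using GK unfolding minor_iff_model by blast
  have "model H K (\<lambda>u. \<Union>v\<in>\<mu> u. \<nu> v)"
  proof (rule modelI)
    fix u assume u: "u \<in> verts H"
    show "(\<Union>v\<in>\<mu> u. \<nu> v) \<subseteq> verts K" using modelD(1)[OF \<mu> u] modelD(1)[OF \<nu>] by blast
    show "connected_set K (\<Union>v\<in>\<mu> u. \<nu> v)"
    proof (rule connected_set_Union[OF K])
      show "\<mu> u \<noteq> {}" using modelD(3)[OF \<mu> u] .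
      show "connected_set K (\<nu> i) \<and> \<nu> i \<subseteq> verts K" if "i \<in> \<mu> u" for i
        using that modelD(1)[OF \<mu> u] modelD(1,2)[OF \<nu>] by blast
      show "\<nu> i \<inter> \<nu> j = {}" if "i \<in> \<mu> u" "j \<in> \<mu> u" "i \<noteq> j" for i j
        using that modelD(1)[OF \<mu> u] modelD(4)[OF \<nu>] by blast
      fix J assume "J \<subseteq> \<mu> u" "J \<noteq> {}" "J \<noteq> \<mu> u"
      then obtain x y where "x \<in> J" "y \<in> \<mu> u - J" "{x, y} \<in> edges G"
        using connected_set_crossing[OF G modelD(2)[OF \<mu> u] modelD(1)[OF \<mu> u]] by blast
      then show "\<exists>i\<in>J. \<exists>j\<in>\<mu> u - J. \<exists>x\<in>\<nu> i. \<exists>y\<in>\<nu> j. {x, y} \<in> edges K"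
        using modelD(5)[OF \<nu>] by blast
    qed
  next
    fix u v assume uv: "u \<in> verts H" "v \<in> verts H" "u \<noteq> v"
    show "(\<Union>w\<in>\<mu> u. \<nu> w) \<inter> (\<Union>w\<in>\<mu> v. \<nu> w) = {}"
      using modelD(1)[OF \<mu> uv(1)] modelD(1)[OF \<mu> uv(2)] modelD(4)[OF \<mu> uv] modelD(4)[OF \<nu>]
      by (smt (verit) UN_iff disjoint_iff subsetD)
  next
    fix u v assume "{u, v} \<in> edges H"
    then show "\<exists>x\<in>(\<Union>w\<in>\<mu> u. \<nu> w). \<exists>y\<in>(\<Union>w\<in>\<mu> v. \<nu> w). {x, y} \<in> edges K"
      using modelD(5)[OF \<mu>] modelD(5)[OF \<nu>] by (metis UN_I)
  qed
  then show ?thesis unfolding minor_iff_model by blast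
qed

text \<open>
  Branch sets are disjoint, so an edge between two of them determines the edge of the minor that it
  realises: choosing a realising edge is injective.
\<close>

lemma model_edge_inj:
  assumes H: "is_graph H" and \<mu>: "model H G \<mu>"
  obtains g where "inj_on g (edges H)" "g ` edges H \<subseteq> edges G"
    "\<And>e x. e \<in> edges H \<Longrightarrow> x \<in> g e \<Longrightarrow> \<exists>u\<in>e. x \<in> \<mu> u"
    "\<And>e u. e \<in> edges H \<Longrightarrow> u \<in> e \<Longrightarrow> \<exists>x\<in>g e. x \<in> \<mu> u"
proof -
  have "\<exists>d\<in>edges G. (\<forall>x\<in>d. \<exists>u\<in>e. x \<in> \<mu> u) \<and> (\<forall>u\<in>e. \<exists>x\<in>d. x \<in> \<mu> u)" if e: "e \<in> edges H" for e
  proof -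
    obtain u v where uv: "e = {u, v}" using edge_in_graphE[OF H e] by metis
    then obtain x y where "x \<in> \<mu> u" "y \<in> \<mu> v" "{x, y} \<in> edges G"
      using modelD(5)[OF \<mu>] e by blast
    then show ?thesis using uv by (intro bexI[of _ "{x, y}"]) auto
  qed
  then obtain g where g: "\<And>e. e \<in> edges H \<Longrightarrow> g e \<in> edges G"
    "\<And>e. e \<in> edges H \<Longrightarrow> \<forall>x\<in>g e. \<exists>u\<in>e. x \<in> \<mu> u" "\<And>e. e \<in> edges H \<Longrightarrow> \<forall>u\<in>e. \<exists>x\<in>g e. x \<in> \<mu> u"
    by metis
  have sub: "e \<subseteq> d" if e: "e \<in> edges H" "d \<in> edges H" "g e = g d" for e d
  proof
    fix u assume u: "u \<in> e"
    then obtain x where x: "x \<in> g e" "x \<in> \<mu> u" using g(3)[OF e(1)] by blast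
    then obtain v where v: "v \<in> d" "x \<in> \<mu> v" using g(2)[OF e(2)] e(3) by auto
    have "u \<in> verts H" "v \<in> verts H" using H e u v unfolding is_graph_def by blast+
    then have "u = v" using modelD(4)[OF \<mu>] x v by blast
    then show "u \<in> d" using v by simp
  qed
  have "inj_on g (edges H)" by (intro inj_onI equalityI sub) auto
  then show ?thesis using that g by blast
qed

lemma model_verts_inj:
  assumes "model H G \<mu>"
  obtains f where "inj_on f (verts H)" "f ` verts H \<subseteq> verts G" "\<And>u. u \<in> verts H \<Longrightarrow> f u \<in> \<mu> u"
proof -
  define f where "f u = (SOME x. x \<in> \<mu> u)" for u
  have f: "f u \<in> \<mu> u" if "u \<in> verts H" for u
    unfolding f_def using modelD(3)[OF assms that] by (simp add: some_in_eq)
  have "inj_on f (verts H)" 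
    using f modelD(4)[OF assms] by (intro inj_onI) (metis disjoint_iff)
  then show ?thesis using that f modelD(1)[OF assms] by blast
qed

lemma minor_card_le:
  assumes "minor H G" "is_graph H" "is_graph G"
  shows "card (verts H) \<le> card (verts G)" "card (edges H) \<le> card (edges G)"
proof -
  obtain \<mu> where \<mu>: "model H G \<mu>" using assms(1) unfolding minor_iff_model by blast
  show "card (verts H) \<le> card (verts G)"
    by (rule model_verts_inj[OF \<mu>]) (meson assms(3) card_inj_on_le finite_verts)
  show "card (edges H) \<le> card (edges G)"
    by (rule model_edge_inj[OF assms(2) \<mu>]) (meson assms(3) card_inj_on_le finite_edges)
qed

text \<open>
  A minor that loses neither vertices nor edges is the graph itself: its branch sets are
  singletons, and they map the edges onto all edges.
\<close>

lemma minor_same_size_isomorphic: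
  assumes "minor H G" and H: "is_graph H" and G: "is_graph G"
    and n: "card (verts G) \<le> card (verts H)" and e: "card (edges G) \<le> card (edges H)"
  obtains f where "bij_betw f (verts H) (verts G)" "edges G = (\<lambda>e. f ` e) ` edges H"
proof -
  obtain \<mu> where \<mu>: "model H G \<mu>" using assms(1) unfolding minor_iff_model by blast
  obtain f where f: "inj_on f (verts H)" "f ` verts H \<subseteq> verts G" "\<And>u. u \<in> verts H \<Longrightarrow> f u \<in> \<mu> u"
    using model_verts_inj[OF \<mu>] by blast
  have "card (f ` verts H) = card (verts H)" using f(1) by (rule card_image)
  then have onto: "f ` verts H = verts G"
    using f(2) n finite_verts[OF G] by (metis card_seteq)
  have single: "\<mu> u = {f u}" if u: "u \<in> verts H" for u
  proof -
    have "x = f u" if x: "x \<in> \<mu> u" for x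
    proof -
      have "x \<in> f ` verts H" using onto modelD(1)[OF \<mu> u] x by blast
      then obtain v where v: "v \<in> verts H" "x = f v" by blast
      then show ?thesis using modelD(4)[OF \<mu> u v(1)] x f(3)[OF v(1)] by blast
    qed
    then show ?thesis using f(3)[OF u] by blast
  qed
  have sub: "(\<lambda>e. f ` e) ` edges H \<subseteq> edges G"
  proof clarify
    fix d assume d: "d \<in> edges H"
    obtain u v where uv: "d = {u, v}" "u \<in> verts H" "v \<in> verts H" using edge_in_graphE[OF H d] by metis
    then show "f ` d \<in> edges G" using modelD(5)[OF \<mu>, of u v] d single by auto
  qed
  have "inj_on (\<lambda>e. f ` e) (edges H)"
  proof (rule inj_onI)
    fix d d' assume "d \<in> edges H" "d' \<in> edges H" "f ` d = f ` d'"
    then show "d = d'" using f(1) H unfolding is_graph_def by (metis inj_on_image_eq_iff)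
  qed
  then have "card ((\<lambda>e. f ` e) ` edges H) = card (edges H)" by (rule card_image)
  then have "(\<lambda>e. f ` e) ` edges H = edges G"
    using sub e finite_edges[OF G] by (metis card_seteq)
  then show ?thesis using that f(1) onto by (metis bij_betw_def)
qed

lemma isomorphic_minor:
  assumes "bij_betw f (verts H) (verts G)" "edges G = (\<lambda>e. f ` e) ` edges H" "is_graph H" "is_graph G"
  shows "minor H G" "minor G H"
proof -
  show "minor H G"
  proof (rule embedding_minor[of _ f])
    fix u v assume "{u, v} \<in> edges H"
    then have "f ` {u, v} \<in> edges G" using assms(2) by blast
    then show "{f u, f v} \<in> edges G" by simp
  qed (use assms in \<open>auto simp: bij_betw_def\<close>)
  let ?g = "the_inv_into (verts H) f"
  have g: "bij_betw ?g (verts G) (verts H)" using assms(1) by (rule bij_betw_the_inv_into)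
  show "minor G H"
  proof (rule embedding_minor[of _ ?g])
    fix u v assume "{u, v} \<in> edges G"
    then obtain e where e: "e \<in> edges H" "{u, v} = f ` e" using assms(2) by blast
    have "e \<subseteq> verts H" using e(1) assms(3) unfolding is_graph_def by blast
    then have "?g ` f ` e = e"
      using assms(1) by (auto simp: bij_betw_def image_image the_inv_into_f_f subset_iff)
    moreover have "?g ` f ` e = {?g u, ?g v}" using e(2) by (metis image_insert image_empty)
    ultimately show "{?g u, ?g v} \<in> edges H" using e(1) by simp
  qed (use assms g in \<open>auto simp: bij_betw_def\<close>)
qed

lemma minor_same_size_sym:
  assumes "minor H G" "is_graph H" "is_graph G"
    and "card (verts G) \<le> card (verts H)" "card (edges G) \<le> card (edges H)"
  shows "minor G H"
proof -
  obtain f where "bij_betw f (verts H) (verts G)" "edges G = (\<lambda>e. f ` e) ` edges H"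
    using minor_same_size_isomorphic[OF assms] by blast
  then show ?thesis by (rule isomorphic_minor(2)[OF _ _ assms(2,3)])
qed

lemma subgraph_same_size:
  assumes "subgraph H G" "is_graph G" 
    and "card (verts G) \<le> card (verts H)" "card (edges G) \<le> card (edges H)"
  shows "H = G"
proof (rule graph.equality)
  show "verts H = verts G"
    using card_seteq[OF finite_verts[OF assms(2)], of "verts H"] assms by (simp add: subgraph_def)
  show "edges H = edges G"
    using card_seteq[OF finite_edges[OF assms(2)], of "edges H"] assms by (simp add: subgraph_def)
qed simp

lemma nat_copy:
  assumes G: "is_graph G"
  obtains H :: "nat graph" where "is_graph H" "minor H G" "minor G H" "verts H = {..<card (verts G)}"
    "card (edges H) = card (edges G)" "G \<cong>\<^sub>g H"
proof -
  obtain f where "bij_betw f (verts G) {0..<card (verts G)}"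
    using ex_bij_betw_finite_nat[OF finite_verts[OF G]] by blast
  then have f: "bij_betw f (verts G) {..<card (verts G)}" by (simp add: atLeast0LessThan)
  define H where "H = \<lparr>verts = {..<card (verts G)}, edges = (\<lambda>e. f ` e) ` edges G\<rparr>"
  have sub: "e \<subseteq> verts G" "card e = 2" if "e \<in> edges G" for e using that G by (auto simp: is_graph_def)
  have inj: "inj_on f (verts G)" using f by (simp add: bij_betw_def)
  have H: "is_graph H"
  proof -
    have "f ` e \<subseteq> {..<card (verts G)}" "card (f ` e) = 2" if e: "e \<in> edges G" for e
      using sub[OF e] f inj
      by (auto simp: bij_betw_def card_image inj_on_subset)
    then show ?thesis by (auto simp: is_graph_def H_def)
  qed
  have "bij_betw f (verts G) (verts H)" "edges H = (\<lambda>e. f ` e) ` edges G"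
    using f by (auto simp: H_def)
  moreover have "card (edges H) = card (edges G)"
    unfolding H_def using sub(1) inj by (simp, intro card_image inj_onI) (metis inj_on_image_eq_iff)
  ultimately show ?thesis 
    using that[OF H isomorphic_minor(2) isomorphic_minor(1)] G H
    by (metis H_def graph.select_convs(1) isomorphic_def)
qed

section \<open>Contracting an edge\<close>

definition nbrs :: "'a graph \<Rightarrow> 'a \<Rightarrow> 'a set" where
  "nbrs G x = {u. {x, u} \<in> edges G}"

lemma nbrs_sym: "y \<in> nbrs G x \<longleftrightarrow> x \<in> nbrs G y"
  by (simp add: nbrs_def insert_commute)

lemma nbrs_subset: "is_graph G \<Longrightarrow> nbrs G x \<subseteq> verts G"
  by (auto simp: nbrs_def dest: edge_in_graphD)

lemma nbrs_irrefl: "is_graph G \<Longrightarrow> x \<notin> nbrs G x"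
  by (auto simp: nbrs_def is_graph_def)

lemma finite_nbrs: "is_graph G \<Longrightarrow> finite (nbrs G x)"
  using nbrs_subset finite_verts by (rule finite_subset)

lemma neighborhood_eq_nbrs: "is_graph G \<Longrightarrow> neighborhood G x = nbrs G x"
  by (auto simp: nbrs_def neighborhood_def insert_commute dest: edge_in_graphD)

lemma incident_edges: "is_graph G \<Longrightarrow> {e \<in> edges G. x \<in> e} = (\<lambda>u. {x, u}) ` nbrs G x"
proof -
  assume G: "is_graph G"
  have "e \<in> (\<lambda>u. {x, u}) ` nbrs G x" if e: "e \<in> edges G" "x \<in> e" for e
  proof -
    obtain a b where ab: "e = {a, b}" using edge_in_graphE[OF G e(1)] by metis
    then have "e = {x, a} \<or> e = {x, b}" using e(2) by blast
    then show ?thesis using e(1) by (auto simp: nbrs_def)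
  qed
  then show ?thesis by (auto simp: nbrs_def)
qed

lemma card_incident_edges: "is_graph G \<Longrightarrow> card {e \<in> edges G. x \<in> e} = card (nbrs G x)"
  unfolding incident_edges by (rule card_image) (auto simp: inj_on_def doubleton_eq_iff)

lemma card_edges_delete:
  assumes "is_graph G"
  shows "card (edges G) = card {e \<in> edges G. x \<notin> e} + card (nbrs G x)"
proof -
  have "card (edges G) = card ({e \<in> edges G. x \<notin> e} \<union> {e \<in> edges G. x \<in> e})"
    by (rule arg_cong[where f = card]) auto
  also have "\<dots> = card {e \<in> edges G. x \<notin> e} + card {e \<in> edges G. x \<in> e}"
    using finite_edges[OF assms] by (intro card_Un_disjoint) auto
  finally show ?thesis using card_incident_edges[OF assms] by metis
qed

text \<open>
  The vertex that results from the contraction keeps the name \<open>x\<close>.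
\<close>

definition contract :: "'a graph \<Rightarrow> 'a \<Rightarrow> 'a \<Rightarrow> 'a graph" where
  "contract G x y = \<lparr>verts = verts G - {y},
     edges = {e \<in> edges G. y \<notin> e} \<union> (\<lambda>u. {x, u}) ` (nbrs G y - {x})\<rparr>"

context
  fixes G :: "'a graph" and x y :: 'a
  assumes G: "is_graph G" and xy: "{x, y} \<in> edges G"
begin

lemma is_graph_contract: "is_graph (contract G x y)"
  using G edge_in_graphD[OF G xy] unfolding contract_def is_graph_def nbrs_def
  by (auto simp: card_2_iff)

lemma contract_minor: "minor (contract G x y) G"
proof -
  have "model (contract G x y) G (\<lambda>u. if u = x then {x, y} else {u})"
  proof (rule modelI)
    fix u assume "u \<in> verts (contract G x y)"
    then show "(if u = x then {x, y} else {u}) \<subseteq> verts G"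
      "connected_set G (if u = x then {x, y} else {u})"
      using edge_in_graphD[OF G xy] connected_set_edge[OF G xy] connected_set_singleton[OF G]
      by (auto simp: contract_def)
  next
    fix u v assume uv: "{u, v} \<in> edges (contract G x y)"
    then consider "{u, v} \<in> edges G" | w where "{u, v} = {x, w}" "{y, w} \<in> edges G" "w \<noteq> x"
      unfolding contract_def nbrs_def by auto
    then show "\<exists>a\<in>if u = x then {x, y} else {u}. \<exists>b\<in>if v = x then {x, y} else {v}. {a, b} \<in> edges G"
    proof cases
      case 1
      then show ?thesis by (intro bexI[of _ u] bexI[of _ v]) auto
    next
      case 2
      then have "(u = x \<and> v = w) \<or> (u = w \<and> v = x)" by (auto simp: doubleton_eq_iff)
      then show ?thesis using 2 by (auto simp: insert_commute)
    qed
  qed (auto simp: contract_def)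
  then show ?thesis unfolding minor_iff_model by blast
qed

lemma connected_contract:
  assumes "connected_graph G"
  shows "connected_graph (contract G x y)"
proof (rule connectedI[OF is_graph_contract])
  show "verts (contract G x y) \<noteq> {}" using edge_in_graphD[OF G xy] by (auto simp: contract_def)
  fix S assume S: "S \<subseteq> verts (contract G x y)" "S \<noteq> {}" "S \<noteq> verts (contract G x y)"
  let ?S = "if x \<in> S then insert y S else S"
  have "?S \<subseteq> verts G" "?S \<noteq> {}" "?S \<noteq> verts G"
    using S edge_in_graphD[OF G xy] by (auto simp: contract_def)
  then obtain a b where ab: "a \<in> ?S" "b \<in> verts G - ?S" "{a, b} \<in> edges G"
    using connected_crossing[OF G assms, of ?S] by blast
  let ?c = "\<lambda>u. if u = y then x else u"
  have "?c a \<in> S" using ab S by (auto simp: contract_def split: if_splits)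
  moreover have "?c b \<in> verts (contract G x y) - S"
    using ab S edge_in_graphD[OF G xy] by (auto simp: contract_def split: if_splits)
  moreover have "{?c a, ?c b} \<in> edges (contract G x y)"
  proof -
    have ne: "?c a \<noteq> ?c b" using calculation by (metis DiffD2)
    show ?thesis
    proof (cases "a = y \<or> b = y")
      case True
      then have "(a = y \<and> b \<noteq> y \<and> b \<noteq> x) \<or> (b = y \<and> a \<noteq> y \<and> a \<noteq> x)" using ne by (auto split: if_splits)
      then show ?thesis
      proof
        assume h: "a = y \<and> b \<noteq> y \<and> b \<noteq> x"
        then have "b \<in> nbrs G y - {x}" using ab(3) by (simp add: nbrs_def)
        then show ?thesis using h by (simp add: contract_def)
      next
        assume h: "b = y \<and> a \<noteq> y \<and> a \<noteq> x"
        then have "a \<in> nbrs G y - {x}" using ab(3) by (simp add: nbrs_def insert_commute)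
        then show ?thesis using h by (simp add: contract_def insert_commute[of a x])
      qed
    next
      case False
      then show ?thesis using ab(3) unfolding contract_def by auto
    qed
  qed
  ultimately show "\<exists>a\<in>S. \<exists>b\<in>verts (contract G x y) - S. {a, b} \<in> edges (contract G x y)" by blast
qed

lemma card_verts_contract: "card (verts (contract G x y)) + 1 = card (verts G)"
  using edge_in_graphD[OF G xy] finite_verts[OF G] card_Suc_Diff1[of "verts G" y]
  by (simp add: contract_def)

text \<open>
  Besides the contracted edge itself, one edge is lost for each common neighbour, where two edges
  become parallel.
\<close>

lemma card_edges_contract:
  "card (edges (contract G x y)) + 1 + card (nbrs G x \<inter> nbrs G y) = card (edges G)"
proof -
  let ?A = "{e \<in> edges G. y \<notin> e}" and ?h = "\<lambda>u. {x, u}"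
  let ?B = "?h ` (nbrs G y - {x})"
  have inj: "inj_on ?h M" for M by (auto simp: inj_on_def doubleton_eq_iff)
  have fin: "finite ?A" "finite ?B" using finite_edges[OF G] finite_nbrs[OF G] by auto
  have "?A \<inter> ?B = ?h ` (nbrs G x \<inter> nbrs G y)"
    using nbrs_irrefl[OF G] edge_in_graphD[OF G xy] by (auto simp: nbrs_def)
  then have "card (?A \<inter> ?B) = card (nbrs G x \<inter> nbrs G y)" by (simp add: card_image inj)
  moreover have "card ?B + 1 = card (nbrs G y)"
  proof -
    have "x \<in> nbrs G y" using xy by (simp add: nbrs_def insert_commute)
    then show ?thesis using card_Suc_Diff1[OF finite_nbrs[OF G], of x y] by (simp add: card_image inj)
  qed
  moreover have "card ?A + card ?B = card (?A \<union> ?B) + card (?A \<inter> ?B)"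
    using fin by (rule card_Un_Int)
  moreover have "card (edges G) = card ?A + card (nbrs G y)" by (rule card_edges_delete[OF G])
  ultimately show ?thesis by (simp add: contract_def)
qed

lemma nbrs_contract:
  assumes "u \<in> verts G" "u \<noteq> y"
  shows "nbrs (contract G x y) u =
    (if u = x then nbrs G x \<union> nbrs G y - {x, y}
     else (nbrs G u - {y}) \<union> (if u \<in> nbrs G y then {x} else {}))"
  using assms nbrs_irrefl[OF G] edge_in_graphD[OF G xy]
  by (auto simp: nbrs_def contract_def doubleton_eq_iff insert_commute)

end

section \<open>A large cyclomatic number forces a daisy, a chain or a diamond\<close>

lemma embedding_minor_image:
  assumes "is_graph G" "f ` verts H \<subseteq> verts G" "inj_on f (verts H)"
    "\<And>e. e \<in> edges H \<Longrightarrow> f ` e \<in> edges G"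
  shows "minor H G"
proof (rule embedding_minor[OF assms(1-3)])
  fix u v assume "{u, v} \<in> edges H"
  then show "{f u, f v} \<in> edges G" using assms(4)[of "{u, v}"] by simp
qed

lemma edges_complete_2: "edges (complete_graph 2) = {{0, 1}}"
proof -
  have "e = {0, 1}" if "e \<subseteq> {..<2}" "card e = 2" for e :: "nat set"
    using that card_subset_eq[of "{..<2}" e] by (auto simp: lessThan_nat_numeral)
  then show ?thesis by (auto simp: complete_graph_def)
qed

lemma verts_complete: "verts (complete_graph n) = {..<n}"
  by (simp add: complete_graph_def)

lemma verts_daisy: "verts (daisy k) = insert None (Some ` ({..<k} \<times> {0, 1}))"
  by (auto simp: daisy_def add_apex_def copies_def complete_graph_def less_2_cases_iff)

lemma edges_daisy:
  "edges (daisy k) = (\<lambda>i. {Some (i, 0), Some (i, 1)}) ` {..<k} \<union>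
     (\<lambda>v. {None, Some v}) ` ({..<k} \<times> {0, 1})"
proof -
  have 1: "edges (copies k (complete_graph 2)) = (\<lambda>i. {(i, 0), (i, 1)}) ` {..<k}"
    by (auto simp: copies_def edges_complete_2)
  have 2: "verts (copies k (complete_graph 2)) = {..<k} \<times> {0, 1}"
    by (auto simp: copies_def complete_graph_def less_2_cases_iff)
  show ?thesis unfolding daisy_def add_apex_def 1 2 by (auto simp: image_image)
qed

lemma daisy_minorI:
  assumes G: "is_graph G" and v: "v \<in> verts G"
    and ab: "\<And>i. i < k \<Longrightarrow> a i \<in> nbrs G v \<and> b i \<in> nbrs G v \<and> {a i, b i} \<in> edges G"
    and inj: "inj_on a {..<k}" "inj_on b {..<k}" "a ` {..<k} \<inter> b ` {..<k} = {}"
  shows "minor (daisy k) G"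
proof -
  let ?f = "\<lambda>p. case p of None \<Rightarrow> v | Some (i, j) \<Rightarrow> if j = (0::nat) then a i else b i"
  show ?thesis
  proof (rule embedding_minor_image[OF G, of ?f])
    show "?f ` verts (daisy k) \<subseteq> verts G"
      using v ab nbrs_subset[OF G, of v] by (auto simp: verts_daisy)
    show "inj_on ?f (verts (daisy k))"
      using inj ab nbrs_irrefl[OF G, of v]
      by (auto simp: verts_daisy inj_on_def split: option.splits if_splits)
    show "?f ` e \<in> edges G" if "e \<in> edges (daisy k)" for e
      using that ab by (auto simp: edges_daisy nbrs_def)
  qed
qed

lemma diamond_minorI:
  assumes G: "is_graph G" and vw: "{v, w} \<in> edges G" and m: "m \<le> card (nbrs G v \<inter> nbrs G w)"
  shows "minor (diamond m) G"
proof -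
  obtain S where S: "S \<subseteq> nbrs G v \<inter> nbrs G w" "card S = m" "finite S"
    using obtain_subset_with_card_n[OF m] by blast
  then obtain h where "bij_betw h {0..<m} S" using ex_bij_betw_nat_finite by metis
  then have h: "inj_on h {..<m}" "h ` {..<m} = S" by (auto simp: bij_betw_def atLeast0LessThan)
  have hi: "h i \<in> nbrs G v" "h i \<in> nbrs G w" if "i < m" for i using h(2) S(1) that by auto
  let ?f = "\<lambda>p. case p of Inl c \<Rightarrow> if c then w else v | Inr i \<Rightarrow> h i"
  show ?thesis
  proof (rule embedding_minor_image[OF G, of ?f])
    show "?f ` verts (diamond m) \<subseteq> verts G"
      using edge_in_graphD[OF G vw] hi nbrs_subset[OF G, of v] by (auto simp: diamond_def)
    show "inj_on ?f (verts (diamond m))"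
    proof -
      have "h i \<noteq> v" "h i \<noteq> w" "v \<noteq> h i" "w \<noteq> h i" if "i < m" for i
        using hi[OF that] nbrs_irrefl[OF G] by metis+
      then show ?thesis using h(1) edge_in_graphD(3)[OF G vw]
        by (auto simp: diamond_def inj_on_def split: if_splits) (metis lessThan_iff)+
    qed
    show "?f ` e \<in> edges G" if "e \<in> edges (diamond m)" for e
      using that hi vw by (auto simp: diamond_def nbrs_def)
  qed
qed

text \<open>
  Greedy matching: as long as the pairs chosen so far and their neighbours do not exhaust the
  set, an uncovered element together with any of its partners extends the matching.
\<close>

lemma matching_in_bounded_degree:
  assumes fin: "finite N" and partner: "\<And>u. u \<in> N \<Longrightarrow> \<exists>w\<in>N. P u w \<and> u \<noteq> w"
    and deg: "\<And>w. w \<in> N \<Longrightarrow> card {u \<in> N. P u w} \<le> m" and big: "2 * k * (m + 1) < card N"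
  shows "\<exists>a b. (\<forall>i<k. a i \<in> N \<and> b i \<in> N \<and> P (a i) (b i)) \<and>
    inj_on a {..<k} \<and> inj_on b {..<k} \<and> a ` {..<k} \<inter> b ` {..<k} = {}"
proof -
  have "\<exists>a b. (\<forall>i<j. a i \<in> N \<and> b i \<in> N \<and> P (a i) (b i)) \<and>
    inj_on a {..<j} \<and> inj_on b {..<j} \<and> a ` {..<j} \<inter> b ` {..<j} = {}" if "j \<le> k" for j
    using that
  proof (induction j)
    case 0
    then show ?case by simp
  next
    case (Suc j)
    then obtain a b where ab: "\<forall>i<j. a i \<in> N \<and> b i \<in> N \<and> P (a i) (b i)"
      "inj_on a {..<j}" "inj_on b {..<j}" "a ` {..<j} \<inter> b ` {..<j} = {}" by auto
    let ?U = "a ` {..<j} \<union> b ` {..<j}"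
    let ?W = "?U \<union> (\<Union>w\<in>?U. {u \<in> N. P u w})"
    have cU: "card ?U \<le> 2 * j"
      using card_Un_le[of "a ` {..<j}" "b ` {..<j}"] card_image_le[of "{..<j}" a]
        card_image_le[of "{..<j}" b] by simp
    have "card (\<Union>w\<in>?U. {u \<in> N. P u w}) \<le> (\<Sum>w\<in>?U. card {u \<in> N. P u w})"
      by (rule card_UN_le) simp
    also have "\<dots> \<le> card ?U * m" using sum_bounded_above[of ?U "\<lambda>w. card {u \<in> N. P u w}" m] deg ab(1)
      by auto
    finally have "card ?W \<le> card ?U + card ?U * m"
      using card_Un_le[of ?U "\<Union>w\<in>?U. {u \<in> N. P u w}"] by linarith
    also have "\<dots> = card ?U * (m + 1)" by simp
    also have "\<dots> \<le> 2 * k * (m + 1)" using cU Suc.prems by (intro mult_right_mono) auto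
    finally have "card ?W < card N" using big by linarith
    have "\<not> N \<subseteq> ?W"
    proof
      assume "N \<subseteq> ?W"
      moreover have "finite ?W" using fin by simp
      ultimately show False using card_mono[of ?W N] \<open>card ?W < card N\<close> by linarith
    qed
    then obtain u where u: "u \<in> N" "u \<notin> ?W" by (meson subsetI)
    obtain w where w: "w \<in> N" "P u w" "u \<noteq> w" using partner[OF u(1)] by blast
    have wU: "w \<notin> ?U"
    proof
      assume wU: "w \<in> ?U"
      have "u \<in> {u \<in> N. P u w}" using u(1) w(2) by simp
      with wU have "u \<in> (\<Union>w\<in>?U. {u \<in> N. P u w})" by (rule UN_I)
      then show False using u(2) by (meson UnI2)
    qed
    have uU: "u \<notin> ?U" using u(2) by (meson UnI1)
    let ?a = "a(j := u)" and ?b = "b(j := w)"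
    have im: "?a ` {..<Suc j} = insert u (a ` {..<j})" "?b ` {..<Suc j} = insert w (b ` {..<j})"
      by (auto simp: lessThan_Suc)
    have "\<forall>i<Suc j. ?a i \<in> N \<and> ?b i \<in> N \<and> P (?a i) (?b i)"
      using ab(1) u(1) w by (auto simp: less_Suc_eq)
    moreover have "inj_on ?a {..<Suc j}" "inj_on ?b {..<Suc j}"
      using ab(2,3) uU wU by (auto simp: lessThan_Suc inj_on_def)
    moreover have "?a ` {..<Suc j} \<inter> ?b ` {..<Suc j} = {}"
      unfolding im using ab(4) uU wU w(3) by blast
    ultimately show ?case by blast
  qed
  then show ?thesis by blast
qed

primrec ball :: "'a graph \<Rightarrow> 'a \<Rightarrow> nat \<Rightarrow> 'a set" where
  "ball G r 0 = {r}"
| "ball G r (Suc i) = ball G r i \<union> (\<Union>u\<in>ball G r i. nbrs G u)"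

lemma finite_ball: "is_graph G \<Longrightarrow> finite (ball G r i)"
  by (induction i) (auto simp: finite_nbrs)

lemma card_ball_le:
  assumes "is_graph G" "\<And>u. card (nbrs G u) \<le> d"
  shows "card (ball G r i) \<le> (d + 1) ^ i"
proof (induction i)
  case (Suc i)
  have "card (\<Union>u\<in>ball G r i. nbrs G u) \<le> (\<Sum>u\<in>ball G r i. card (nbrs G u))"
    by (rule card_UN_le) (rule finite_ball[OF assms(1)])
  also have "\<dots> \<le> card (ball G r i) * d" using sum_bounded_above[of "ball G r i" "\<lambda>u. card (nbrs G u)" d]
      assms(2) by simp
  finally have "card (ball G r (Suc i)) \<le> card (ball G r i) * (d + 1)"
    using card_Un_le[of "ball G r i" "\<Union>u\<in>ball G r i. nbrs G u"] by simp
  also have "\<dots> \<le> (d + 1) ^ i * (d + 1)" by (rule mult_right_mono[OF Suc]) simp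
  finally show ?case by (simp add: mult.commute)
qed simp

definition level :: "'a graph \<Rightarrow> 'a \<Rightarrow> 'a \<Rightarrow> nat" where
  "level G r u = (LEAST i. u \<in> ball G r i)"

lemma ball_mono: "i \<le> j \<Longrightarrow> ball G r i \<subseteq> ball G r j"
  by (induction j) (auto simp: le_Suc_eq)

lemma exhausted_by_balls:
  assumes G: "is_graph G" and con: "connected_graph G" and r: "r \<in> verts G" and u: "u \<in> verts G"
  shows "\<exists>i. u \<in> ball G r i"
proof -
  let ?S = "{u \<in> verts G. \<exists>i. u \<in> ball G r i}"
  have "r \<in> ball G r 0" by simp
  then have "r \<in> ?S" using r by blast
  moreover have "{x, y} \<notin> edges G" if "x \<in> ?S" "y \<in> verts G - ?S" for x y
  proof
    assume xy: "{x, y} \<in> edges G"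
    obtain i where "x \<in> ball G r i" using \<open>x \<in> ?S\<close> by blast
    then have "y \<in> ball G r (Suc i)" using xy by (auto simp: nbrs_def)
    then show False using that by blast
  qed
  ultimately have "?S = verts G" using connected_crossing[OF G con, of ?S]
    by (metis (no_types, lifting) empty_iff mem_Collect_eq subsetI)
  then show ?thesis using u by blast
qed

text \<open>
  The level of a vertex is its distance from the root.
\<close>

lemma level_adjacent:
  assumes "\<exists>i. u \<in> ball G r i" "w \<in> nbrs G u"
  shows "level G r w \<le> Suc (level G r u)"
proof -
  have "u \<in> ball G r (level G r u)" unfolding level_def using assms(1) by (rule LeastI_ex)
  then have "w \<in> ball G r (Suc (level G r u))" using assms(2) by auto
  then show ?thesis unfolding level_def by (rule Least_le)
qed

lemma level_predecessor:
  assumes "\<exists>i. u \<in> ball G r i" "level G r u = Suc i"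
  shows "\<exists>w. w \<in> nbrs G u \<and> w \<in> ball G r i \<and> level G r w = i"
proof -
  have "u \<in> ball G r (Suc i)" using assms LeastI_ex[OF assms(1)] unfolding level_def by metis
  moreover have "u \<notin> ball G r i" using assms(2) not_less_Least[of i "\<lambda>i. u \<in> ball G r i"]
    unfolding level_def by simp
  ultimately obtain w where w: "w \<in> ball G r i" "u \<in> nbrs G w" by auto
  have "level G r w \<le> i" unfolding level_def using w(1) by (rule Least_le)
  moreover have "Suc i \<le> Suc (level G r w)" using level_adjacent[OF _ w(2), of r] w(1) assms(2) by auto
  ultimately show ?thesis using w by (auto simp: nbrs_sym)
qed

text \<open>
  Descending level by level from a vertex of level \<open>n\<close> gives a shortest path to the root.
\<close>

lemma level_path:
  assumes "\<exists>i. u \<in> ball G r i" "level G r u = n"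
  shows "\<exists>x. x n = u \<and> (\<forall>i\<le>n. level G r (x i) = i \<and> (\<exists>j. x i \<in> ball G r j)) \<and>
    (\<forall>i<n. x (Suc i) \<in> nbrs G (x i))"
  using assms
proof (induction n arbitrary: u)
  case 0
  then show ?case by (intro exI[of _ "\<lambda>_. u"]) auto
next
  case (Suc n)
  obtain w where w: "w \<in> nbrs G u" "w \<in> ball G r n" "level G r w = n"
    using level_predecessor[OF Suc.prems] by blast
  then obtain x where x: "x n = w" "\<forall>i\<le>n. level G r (x i) = i \<and> (\<exists>j. x i \<in> ball G r j)"
    "\<forall>i<n. x (Suc i) \<in> nbrs G (x i)"
    using Suc.IH[of w] by blast
  show ?case
    using x w(1) Suc.prems
    by (intro exI[of _ "x(Suc n := u)"]) (auto simp: le_Suc_eq less_Suc_eq nbrs_sym)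
qed

lemma edges_chain_iff: "e \<in> edges (chain k) \<longleftrightarrow> (\<exists>i. 1 \<le> i \<and> i \<le> k \<and>
    (e = {Inl (i - 1), Inl i} \<or> e = {Inl (i - 1), Inr i} \<or> e = {Inl i, Inr i}))"
  by (auto simp: chain_def)

text \<open>
  Edges are unordered pairs, while branch sets are assigned to their ends in a fixed order.
\<close>

lemma doubleton_link:
  assumes "{p, q} = {a, b}" "s \<in> M a" "t \<in> M b" "{s, t} \<in> E"
  shows "\<exists>s\<in>M p. \<exists>t\<in>M q. {s, t} \<in> E"
proof (cases "p = a \<and> q = b")
  case True
  then show ?thesis using assms by blast
next
  case False
  then have "p = b \<and> q = a" using assms(1) by (metis doubleton_eq_iff)
  moreover have "{t, s} \<in> E" using assms(4) by (simp add: insert_commute)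
  ultimately show ?thesis using assms by blast
qed

lemma chain_minorI:
  assumes G: "is_graph G" and r: "r \<in> verts G"
    and x: "\<And>i. i \<le> 2 * l \<Longrightarrow> level G r (x i) = i \<and> (\<exists>j. x i \<in> ball G r j)"
    and adj: "\<And>i. i < 2 * l \<Longrightarrow> {x i, x (Suc i)} \<in> edges G"
    and tri: "\<And>u w. {u, w} \<in> edges G \<Longrightarrow> nbrs G u \<inter> nbrs G w \<noteq> {}"
    and x0: "x 0 \<in> verts G"
  shows "minor (chain l) G"
proof -
  have xV: "x i \<in> verts G" if "i \<le> 2 * l" for i
    using that x0 adj[of "i - 1"] edge_in_graphD(2)[OF G, of "x (i - 1)" "x i"] by (cases i) auto
  have "\<exists>z. z \<in> nbrs G (x i) \<inter> nbrs G (x (Suc i))" if "i < 2 * l" for i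
    using tri[OF adj[OF that]] by blast
  then obtain z where z: "\<And>i. i < 2 * l \<Longrightarrow> z i \<in> nbrs G (x i) \<inter> nbrs G (x (Suc i))" by metis
  have zl: "level G r (z i) = i \<or> level G r (z i) = Suc i" if i: "i < 2 * l" for i
  proof -
    have a: "z i \<in> nbrs G (x i)" "z i \<in> nbrs G (x (Suc i))" using z[OF i] by auto
    have b: "\<exists>j. x i \<in> ball G r j" "level G r (x i) = i" "level G r (x (Suc i)) = Suc i"
      using x i by auto
    then obtain j where "x i \<in> ball G r j" by blast
    then have "z i \<in> ball G r (Suc j)" using a(1) by auto
    then have "Suc i \<le> Suc (level G r (z i))"
      using level_adjacent[of "z i" G r "x (Suc i)"] a(2) b(3) nbrs_sym by metis
    moreover have "level G r (z i) \<le> Suc i" using level_adjacent[OF b(1) a(1)] b(2) by simp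
    ultimately show ?thesis by linarith
  qed
  have zx: "z i \<noteq> x j" if "i < 2 * l" "j \<le> 2 * l" for i j
  proof
    assume eq: "z i = x j"
    then have "j = i \<or> j = Suc i" using zl[OF that(1)] x[OF that(2)] by auto
    then show False using eq z[OF that(1)] nbrs_irrefl[OF G] by auto
  qed
  have zz: "z (2 * i) \<noteq> z (2 * j)" if "2 * i < 2 * l" "2 * j < 2 * l" "i \<noteq> j" for i j
  proof
    assume "z (2 * i) = z (2 * j)"
    moreover have "level G r (z (2 * i)) div 2 = i" "level G r (z (2 * j)) div 2 = j"
      using zl[OF that(1)] zl[OF that(2)] by auto
    ultimately show False using that(3) by simp
  qed
  \<comment> \<open>The triangle over the edge from position 2j-2 to 2j-1 becomes the j-th one of the chain;
    the other path edges are contracted.\<close>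
  let ?\<mu> = "\<lambda>p. case p of Inl j \<Rightarrow> {x (2 * j - 1), x (2 * j)} | Inr j \<Rightarrow> {z (2 * (j - 1))}"
  have "model (chain l) G ?\<mu>"
  proof (rule modelI)
    fix p assume p: "p \<in> verts (chain l)"
    show "?\<mu> p \<subseteq> verts G"
    proof (cases p)
      case (Inl j)
      then have "2 * j - 1 \<le> 2 * l" "2 * j \<le> 2 * l" using p by (auto simp: chain_def)
      then show ?thesis using Inl xV by simp
    next
      case (Inr j)
      then have "2 * (j - 1) < 2 * l" using p by (auto simp: chain_def)
      then have "z (2 * (j - 1)) \<in> verts G" using z nbrs_subset[OF G] by blast
      then show ?thesis using Inr by simp
    qed
    show "connected_set G (?\<mu> p)"
    proof (cases p)
      case (Inl j)
      then have j: "j \<le> l" using p by (auto simp: chain_def)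
      show ?thesis
      proof (cases j)
        case 0
        then show ?thesis using Inl connected_set_singleton[OF G x0] by simp
      next
        case (Suc i)
        then have "{x (2 * j - 1), x (2 * j)} \<in> edges G" using adj[of "2 * j - 1"] j by simp
        then show ?thesis using Inl connected_set_edge[OF G] by simp
      qed
    next
      case (Inr j)
      then have "2 * (j - 1) < 2 * l" using p by (auto simp: chain_def)
      then have "z (2 * (j - 1)) \<in> verts G" using z nbrs_subset[OF G] by blast
      then show ?thesis using Inr connected_set_singleton[OF G] by simp
    qed
  next
    fix p q assume p: "p \<in> verts (chain l)" and q: "q \<in> verts (chain l)" and pq: "p \<noteq> q"
    have xx: "x i \<noteq> x j" if "i \<le> 2 * l" "j \<le> 2 * l" "i \<noteq> j" for i j using x that by metis
    show "?\<mu> p \<inter> ?\<mu> q = {}"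
    proof (cases p; cases q)
      fix i j assume ij: "p = Inl i" "q = Inl j"
      then have "i \<le> l" "j \<le> l" "i \<noteq> j" using p q pq by (auto simp: chain_def)
      then have "x (2 * i - 1) \<noteq> x (2 * j - 1)" "x (2 * i) \<noteq> x (2 * j - 1)"
        "x (2 * i - 1) \<noteq> x (2 * j)" "x (2 * i) \<noteq> x (2 * j)"
        by (intro xx; linarith)+
      then show ?thesis using ij by simp
    next
      fix i j assume ij: "p = Inr i" "q = Inr j"
      then have "2 * (i - 1) < 2 * l" "2 * (j - 1) < 2 * l" "i - 1 \<noteq> j - 1"
        using p q pq by (auto simp: chain_def)
      then show ?thesis using ij zz by simp
    next
      fix i j assume ij: "p = Inl i" "q = Inr j"
      then have "2 * (j - 1) < 2 * l" "2 * i \<le> 2 * l" "2 * i - 1 \<le> 2 * l"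
        using p q pq by (auto simp: chain_def)
      then show ?thesis using ij zx by auto
    next
      fix i j assume ij: "p = Inr i" "q = Inl j"
      then have "2 * (i - 1) < 2 * l" "2 * j \<le> 2 * l" "2 * j - 1 \<le> 2 * l"
        using p q pq by (auto simp: chain_def)
      then show ?thesis using ij zx by auto
    qed
  next
    fix p q assume "{p, q} \<in> edges (chain l)"
    then obtain i where i: "1 \<le> i" "i \<le> l"
      "{p, q} = {Inl (i - 1), Inl i} \<or> {p, q} = {Inl (i - 1), Inr i} \<or> {p, q} = {Inl i, Inr i}"
      unfolding edges_chain_iff by blast
    obtain j where j: "i = Suc j" "2 * j < 2 * l" using i(1,2) by (cases i) auto
    have e: "{x (2 * j), x (2 * i - 1)} \<in> edges G" "{x (2 * j), z (2 * j)} \<in> edges G"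
      "{x (2 * i - 1), z (2 * j)} \<in> edges G"
      using adj[OF j(2)] z[OF j(2)] j(1) by (auto simp: nbrs_def)
    have m: "x (2 * j) \<in> ?\<mu> (Inl j)" "x (2 * i - 1) \<in> ?\<mu> (Inl i)" "z (2 * j) \<in> ?\<mu> (Inr i)"
      using j by auto
    have "i - 1 = j" using j(1) by simp
    then have "{p, q} = {Inl j, Inl i} \<or> {p, q} = {Inl j, Inr i} \<or> {p, q} = {Inl i, Inr i}"
      using i(3) by simp
    then show "\<exists>s\<in>?\<mu> p. \<exists>t\<in>?\<mu> q. {s, t} \<in> edges G"
      using doubleton_link[where M = ?\<mu> and E = "edges G", OF _ m(1,2) e(1)]
        doubleton_link[where M = ?\<mu> and E = "edges G", OF _ m(1,3) e(2)]
        doubleton_link[where M = ?\<mu> and E = "edges G", OF _ m(2,3) e(3)]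
      by (elim disjE)

  qed
  then show ?thesis unfolding minor_iff_model by blast
qed

text \<open>
  If every edge lies in a triangle and the graph is large, then some vertex has large degree or
  some shortest path is long. The neighbourhood of a vertex of large degree induces a graph
  without isolated vertices; a large matching in it gives a daisy, a large star gives a diamond.
  The triangles on every other edge of a long shortest path are disjoint and give a chain.
\<close>

lemma large_triangulated_graph:
  fixes G :: "'a graph"
  assumes G: "is_graph G" and con: "connected_graph G"
    and tri: "\<And>u w. {u, w} \<in> edges G \<Longrightarrow> nbrs G u \<inter> nbrs G w \<noteq> {}"
    and big: "(2 * k * (m + 1) + 1) ^ (2 * l) < card (verts G)"
  shows "minor (daisy k) G \<or> minor (chain l) G \<or> minor (diamond m) G"
proof (cases "\<exists>v. 2 * k * (m + 1) < card (nbrs G v)")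
  case True
  then obtain v where v: "2 * k * (m + 1) < card (nbrs G v)" by blast
  then have "nbrs G v \<noteq> {}" by (metis card.empty not_less_zero)
  then have vV: "v \<in> verts G" unfolding nbrs_def using edge_in_graphD[OF G] by blast
  show ?thesis
  proof (cases "\<exists>w\<in>nbrs G v. m < card (nbrs G v \<inter> nbrs G w)")
    case True
    then obtain w where w: "w \<in> nbrs G v" "m < card (nbrs G v \<inter> nbrs G w)" by blast
    then have "{v, w} \<in> edges G" by (simp add: nbrs_def)
    then show ?thesis using diamond_minorI[OF G, of v w m] w(2) by simp
  next
    case False
    have "\<exists>a b. (\<forall>i<k. a i \<in> nbrs G v \<and> b i \<in> nbrs G v \<and> {a i, b i} \<in> edges G) \<and>
      inj_on a {..<k} \<and> inj_on b {..<k} \<and> a ` {..<k} \<inter> b ` {..<k} = {}"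
    proof (rule matching_in_bounded_degree[OF finite_nbrs[OF G] _ _ v])
      fix u assume "u \<in> nbrs G v"
      then obtain w where "w \<in> nbrs G v" "w \<in> nbrs G u" using tri[of v u] by (auto simp: nbrs_def)
      then show "\<exists>w\<in>nbrs G v. {u, w} \<in> edges G \<and> u \<noteq> w"
        using nbrs_irrefl[OF G] unfolding nbrs_def by blast
    next
      fix w assume w: "w \<in> nbrs G v"
      have "{u \<in> nbrs G v. {u, w} \<in> edges G} = nbrs G v \<inter> nbrs G w"
        by (auto simp: nbrs_def insert_commute)
      then show "card {u \<in> nbrs G v. {u, w} \<in> edges G} \<le> m" using False w by force
    qed
    then show ?thesis using daisy_minorI[OF G vV] by metis
  qed
next
  case False
  obtain r where r: "r \<in> verts G" using connected_nonempty[OF con] by blast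
  have "card (ball G r (2 * l)) \<le> (2 * k * (m + 1) + 1) ^ (2 * l)"
    using False by (intro card_ball_le[OF G]) (simp add: not_less)
  then have "\<not> verts G \<subseteq> ball G r (2 * l)" using big card_mono[OF finite_ball[OF G]] by (meson leD le_trans)
  then obtain u where u: "u \<in> verts G" "u \<notin> ball G r (2 * l)" by blast
  have uex: "\<exists>i. u \<in> ball G r i" using exhausted_by_balls[OF G con r u(1)] .
  have "2 * l \<le> level G r u"
    using u(2) LeastI_ex[OF uex] ball_mono[of "level G r u" "2 * l" G r] unfolding level_def by force
  moreover obtain x where x: "\<forall>i\<le>level G r u. level G r (x i) = i \<and> (\<exists>j. x i \<in> ball G r j)"
    "\<forall>i<level G r u. x (Suc i) \<in> nbrs G (x i)"
    using level_path[OF uex refl] by blast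
  moreover have "x 0 \<in> verts G"
  proof -
    have "level G r (x 0) = 0" "\<exists>j. x 0 \<in> ball G r j" using x(1) by auto
    then have "x 0 \<in> ball G r 0" unfolding level_def by (metis LeastI_ex)
    then show ?thesis using r by simp
  qed
  ultimately have "minor (chain l) G"
    by (intro chain_minorI[OF G r, of l x] tri) (auto simp: nbrs_def)
  then show ?thesis by blast
qed

lemma card_edges_le_choose: "is_graph G \<Longrightarrow> card (edges G) \<le> card (verts G) choose 2"
proof -
  assume G: "is_graph G"
  have "card (edges G) \<le> card {e. e \<subseteq> verts G \<and> card e = 2}"
  proof (rule card_mono)
    show "finite {e. e \<subseteq> verts G \<and> card e = 2}"
      by (rule finite_subset[of _ "Pow (verts G)"]) (use finite_verts[OF G] in auto)
    show "edges G \<subseteq> {e. e \<subseteq> verts G \<and> card e = 2}" using G by (auto simp: is_graph_def)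
  qed
  then show ?thesis using n_subsets[OF finite_verts[OF G], of 2] by simp
qed

lemma card_edges_le_square: "is_graph G \<Longrightarrow> card (edges G) \<le> (card (verts G))\<^sup>2"
proof -
  assume "is_graph G"
  then have "card (edges G) \<le> card (verts G) * (card (verts G) - 1) div 2"
    using card_edges_le_choose by (metis choose_two)
  also have "\<dots> \<le> card (verts G) * card (verts G)"
    by (meson div_le_dividend diff_le_self mult_le_mono2 le_trans)
  finally show ?thesis by (simp add: power2_eq_square)
qed

lemma is_graph_daisy: "is_graph (daisy k)"
  by (auto simp: is_graph_def verts_daisy edges_daisy)

lemma is_graph_chain: "is_graph (chain k)"
  by (auto simp: is_graph_def chain_def)

lemma is_graph_diamond: "is_graph (diamond k)"
  by (auto simp: is_graph_def diamond_def)

text \<open>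
  Contracting an edge in no triangle preserves the number of edges minus the number of vertices.
  Once no such edge is left, the graph has many vertices, as a graph on \<open>n\<close> vertices has at most
  \<open>n\<^sup>2\<close> edges; this is where the square comes from.
\<close>

lemma large_excess_forces_minor:
  fixes G :: "'a graph"
  assumes "is_graph G" "connected_graph G"
    "card (verts G) + ((2 * k * (m + 1) + 1) ^ (2 * l))\<^sup>2 \<le> card (edges G)"
  shows "minor (daisy k) G \<or> minor (chain l) G \<or> minor (diamond m) G"
  using assms
proof (induction "card (verts G)" arbitrary: G rule: less_induct)
  case less
  note G = less.prems(1)
  show ?case
  proof (cases "\<exists>u w. {u, w} \<in> edges G \<and> nbrs G u \<inter> nbrs G w = {}")
    case True
    then obtain u w where uw: "{u, w} \<in> edges G" and no: "nbrs G u \<inter> nbrs G w = {}" by blast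
    note c = card_verts_contract[OF G uw] card_edges_contract[OF G uw, unfolded no]
    have "minor (daisy k) (contract G u w) \<or> minor (chain l) (contract G u w) \<or> minor (diamond m) (contract G u w)"
      using c less.prems(3) by (intro less.hyps is_graph_contract[OF G uw] connected_contract[OF G uw] less.prems(2)) auto
    then show ?thesis
      using minor_trans[OF _ contract_minor[OF G uw] is_graph_contract[OF G uw] G] 
        is_graph_daisy is_graph_chain is_graph_diamond by metis
  next
    case False
    have "card (edges G) \<le> (card (verts G))\<^sup>2" by (rule card_edges_le_square[OF G])
    moreover have "card (verts G) > 0"
      using connected_nonempty[OF less.prems(2)] finite_verts[OF G] by (simp add: card_gt_0_iff)
    ultimately have "((2 * k * (m + 1) + 1) ^ (2 * l))\<^sup>2 < (card (verts G))\<^sup>2"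
      using less.prems(3) by linarith
    then have "(2 * k * (m + 1) + 1) ^ (2 * l) < card (verts G)"
      by (rule power_less_imp_less_base) simp
    then show ?thesis using False by (intro large_triangulated_graph[OF G less.prems(2)]) auto
  qed
qed

section \<open>Gluing two graphs at a vertex\<close>

definition one_sum :: "'a graph \<Rightarrow> 'a graph \<Rightarrow> 'a graph \<Rightarrow> 'a \<Rightarrow> bool" where
  "one_sum G G\<^sub>1 G\<^sub>2 v \<longleftrightarrow> is_graph G\<^sub>1 \<and> is_graph G\<^sub>2 \<and> verts G = verts G\<^sub>1 \<union> verts G\<^sub>2 \<and>
     edges G = edges G\<^sub>1 \<union> edges G\<^sub>2 \<and> verts G\<^sub>1 \<inter> verts G\<^sub>2 = {v}"

lemma one_sum_commute: "one_sum G G\<^sub>1 G\<^sub>2 v \<Longrightarrow> one_sum G G\<^sub>2 G\<^sub>1 v"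
  unfolding one_sum_def by (simp add: Un_commute Int_commute)

context
  fixes G G\<^sub>1 G\<^sub>2 :: "'a graph" and v :: 'a
  assumes sum: "one_sum G G\<^sub>1 G\<^sub>2 v"
begin

lemma one_sum_graph: "is_graph G" "is_graph G\<^sub>1" "is_graph G\<^sub>2"
proof -
  show "is_graph G\<^sub>1" "is_graph G\<^sub>2" using sum by (auto simp: one_sum_def)
  then show "is_graph G" using sum unfolding one_sum_def is_graph_def by (metis (no_types, lifting) Un_iff
        finite_UnI le_supI1 le_supI2)
qed

lemma one_sum_edge:
  assumes "{x, y} \<in> edges G" "x \<in> verts G\<^sub>1" "x \<noteq> v"
  shows "{x, y} \<in> edges G\<^sub>1" "y \<in> verts G\<^sub>1"
proof -
  have "{x, y} \<notin> edges G\<^sub>2"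
    using edge_in_graphD(1)[OF one_sum_graph(3), of x y] assms sum unfolding one_sum_def by blast
  then show 1: "{x, y} \<in> edges G\<^sub>1" using assms(1) sum unfolding one_sum_def by blast
  show "y \<in> verts G\<^sub>1" using edge_in_graphD(2)[OF one_sum_graph(2) 1] .
qed

lemma one_sum_edges_disjoint: "edges G\<^sub>1 \<inter> edges G\<^sub>2 = {}"
proof (rule ccontr)
  assume "edges G\<^sub>1 \<inter> edges G\<^sub>2 \<noteq> {}"
  then obtain e where e: "e \<in> edges G\<^sub>1" "e \<in> edges G\<^sub>2" by blast
  then have "e \<subseteq> {v}" "card e = 2" using one_sum_graph(2,3) sum unfolding is_graph_def one_sum_def by blast+
  then show False using card_mono[of "{v}" e] by simp
qed

lemma one_sum_connected_avoiding:
  assumes "U \<subseteq> verts G" "connected_set G U" "v \<notin> U" "U \<inter> verts G\<^sub>1 \<noteq> {}"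
  shows "U \<subseteq> verts G\<^sub>1"
proof (rule ccontr)
  assume "\<not> U \<subseteq> verts G\<^sub>1"
  then obtain x y where "x \<in> U \<inter> verts G\<^sub>1" "y \<in> U - (U \<inter> verts G\<^sub>1)" "{x, y} \<in> edges G"
    using connected_set_crossing[OF one_sum_graph(1) assms(2,1), of "U \<inter> verts G\<^sub>1"] assms(4) by blast
  then show False using one_sum_edge(2)[of x y] assms(3) by blast
qed

lemma one_sum_connected_meets_both:
  assumes U: "U \<subseteq> verts G" "connected_set G U" and "x \<in> U" "x \<in> verts G\<^sub>1" "y \<in> U" "y \<in> verts G\<^sub>2"
  shows "v \<in> U"
proof (rule ccontr)
  assume "v \<notin> U"
  then have "U \<subseteq> verts G\<^sub>1" using one_sum_connected_avoiding[OF U] assms(3,4) by blast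
  then have "y = v" using assms(5,6) sum unfolding one_sum_def by blast
  then show False using \<open>v \<notin> U\<close> assms(5) by blast
qed

lemma one_sum_connected_part:
  assumes "U \<subseteq> verts G" "connected_set G U" "U \<inter> verts G\<^sub>1 \<noteq> {}"
  shows "connected_set G\<^sub>1 (U \<inter> verts G\<^sub>1)"
proof (rule connected_setI[OF one_sum_graph(2)])
  fix S assume S: "S \<subseteq> U \<inter> verts G\<^sub>1" "S \<noteq> {}" "S \<noteq> U \<inter> verts G\<^sub>1"
  \<comment> \<open>Of the two sides of the cut, take the one without the cut vertex.\<close>
  let ?S = "if v \<in> S then U \<inter> verts G\<^sub>1 - S else S"
  have s: "?S \<subseteq> U \<inter> verts G\<^sub>1" "?S \<noteq> {}" "v \<notin> ?S" using S by auto
  then have "?S \<noteq> U" using S assms(3) by (auto split: if_splits)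
  then obtain x y where xy: "x \<in> ?S" "y \<in> U - ?S" "{x, y} \<in> edges G"
    using connected_set_crossing[OF one_sum_graph(1) assms(2,1), of ?S] s by blast
  then have e: "{x, y} \<in> edges G\<^sub>1" "y \<in> verts G\<^sub>1" using one_sum_edge[of x y] s by blast+
  then have "(x \<in> S \<and> y \<in> U \<inter> verts G\<^sub>1 - S) \<or> (y \<in> S \<and> x \<in> U \<inter> verts G\<^sub>1 - S)"
    using xy by (auto split: if_splits)
  then show "\<exists>x\<in>S. \<exists>y\<in>U \<inter> verts G\<^sub>1 - S. {x, y} \<in> edges G\<^sub>1"
    using e(1) by (metis insert_commute)
qed (use assms in auto)

lemma card_one_sum:
  "card (verts G) + 1 = card (verts G\<^sub>1) + card (verts G\<^sub>2)"
  "card (edges G) = card (edges G\<^sub>1) + card (edges G\<^sub>2)"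
proof -
  show "card (verts G) + 1 = card (verts G\<^sub>1) + card (verts G\<^sub>2)"
    using card_Un_Int[of "verts G\<^sub>1" "verts G\<^sub>2"] sum finite_verts[OF one_sum_graph(2)]
      finite_verts[OF one_sum_graph(3)] by (simp add: one_sum_def)
  show "card (edges G) = card (edges G\<^sub>1) + card (edges G\<^sub>2)"
    using card_Un_disjoint[OF finite_edges[OF one_sum_graph(2)] finite_edges[OF one_sum_graph(3)]]
      one_sum_edges_disjoint sum by (simp add: one_sum_def)
qed

lemma one_sum_subgraph: "subgraph G\<^sub>1 G"
  using sum one_sum_graph unfolding subgraph_def one_sum_def by blast

end

lemma one_sum_connected:
  assumes sum: "one_sum G G\<^sub>1 G\<^sub>2 v" and con: "connected_graph G\<^sub>1" "connected_graph G\<^sub>2"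
  shows "connected_graph G"
proof (rule connectedI[OF one_sum_graph(1)[OF sum]])
  have V: "verts G = verts G\<^sub>1 \<union> verts G\<^sub>2" "v \<in> verts G\<^sub>1" "v \<in> verts G\<^sub>2"
    "edges G = edges G\<^sub>1 \<union> edges G\<^sub>2" using sum by (auto simp: one_sum_def)
  then show "verts G \<noteq> {}" by blast
  fix S assume S: "S \<subseteq> verts G" "S \<noteq> {}" "S \<noteq> verts G"
  show "\<exists>x\<in>S. \<exists>y\<in>verts G - S. {x, y} \<in> edges G"
  proof (cases "S \<inter> verts G\<^sub>1 \<noteq> {} \<and> S \<inter> verts G\<^sub>1 \<noteq> verts G\<^sub>1")
    case True
    then obtain x y where "x \<in> S \<inter> verts G\<^sub>1" "y \<in> verts G\<^sub>1 - S \<inter> verts G\<^sub>1" "{x, y} \<in> edges G\<^sub>1"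
      using connected_crossing[OF one_sum_graph(2)[OF sum] con(1), of "S \<inter> verts G\<^sub>1"] by blast
    then show ?thesis unfolding V by blast
  next
    case False
    then have "S \<inter> verts G\<^sub>2 \<noteq> {} \<and> S \<inter> verts G\<^sub>2 \<noteq> verts G\<^sub>2" using S V by blast
    then obtain x y where "x \<in> S \<inter> verts G\<^sub>2" "y \<in> verts G\<^sub>2 - S \<inter> verts G\<^sub>2" "{x, y} \<in> edges G\<^sub>2"
      using connected_crossing[OF one_sum_graph(3)[OF sum] con(2), of "S \<inter> verts G\<^sub>2"] by blast
    then show ?thesis unfolding V by blast
  qed
qed

lemma one_sum_connected_left:
  assumes sum: "one_sum G G\<^sub>1 G\<^sub>2 v" and con: "connected_graph G"
  shows "connected_graph G\<^sub>1"
proof -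
  have 1: "verts G \<inter> verts G\<^sub>1 = verts G\<^sub>1" "verts G\<^sub>1 \<noteq> {}" using sum by (auto simp: one_sum_def)
  have "connected_set G (verts G)" using con connected_set_verts[OF one_sum_graph(1)[OF sum]] by simp
  then have "connected_set G\<^sub>1 (verts G\<^sub>1)"
    using one_sum_connected_part[OF sum, of "verts G"] 1 by simp
  then show ?thesis using connected_set_verts[OF one_sum_graph(2)[OF sum]] by simp
qed

lemmas one_sum_connected_right = one_sum_connected_left[OF one_sum_commute]

text \<open>
  A branch set that meets both sides contains the cut vertex, so at most one branch set does.
  If there is one, the minor splits at it into minors of the two sides; otherwise, being
  connected, it lives on one side.
\<close>

lemma one_sum_model_side:
  assumes sum: "one_sum G G\<^sub>1 G\<^sub>2 v" and \<mu>: "model H G \<mu>" and H: "is_graph H"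
  shows "minor (induced H {u \<in> verts H. \<mu> u \<inter> verts G\<^sub>1 \<noteq> {}}) G\<^sub>1"
proof -
  let ?U = "{u \<in> verts H. \<mu> u \<inter> verts G\<^sub>1 \<noteq> {}}"
  have vU: "verts (induced H ?U) = ?U" by (rule verts_induced) blast
  have "model (induced H ?U) G\<^sub>1 (\<lambda>u. \<mu> u \<inter> verts G\<^sub>1)"
  proof (rule modelI)
    fix u assume "u \<in> verts (induced H ?U)"
    then have u: "u \<in> verts H" "\<mu> u \<inter> verts G\<^sub>1 \<noteq> {}" using vU by auto
    show "\<mu> u \<inter> verts G\<^sub>1 \<subseteq> verts G\<^sub>1" by blast
    show "connected_set G\<^sub>1 (\<mu> u \<inter> verts G\<^sub>1)"
      using one_sum_connected_part[OF sum modelD(1)[OF \<mu> u(1)] modelD(2)[OF \<mu> u(1)] u(2)] .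
    fix w assume "w \<in> verts (induced H ?U)" "u \<noteq> w"
    then show "\<mu> u \<inter> verts G\<^sub>1 \<inter> (\<mu> w \<inter> verts G\<^sub>1) = {}"
      using modelD(4)[OF \<mu> u(1), of w] vU by blast
  next
    fix u w assume "{u, w} \<in> edges (induced H ?U)"
    then have e: "{u, w} \<in> edges H" and uw: "u \<in> ?U" "w \<in> ?U" unfolding edges_induced by auto
    obtain x y where xy: "x \<in> \<mu> u" "y \<in> \<mu> w" "{x, y} \<in> edges G" using modelD(5)[OF \<mu> e] by blast
    have in_v: "v \<in> \<mu> z" if z: "z \<in> ?U" "t \<in> \<mu> z" "t \<in> verts G\<^sub>2" for z t
    proof -
      obtain s where s: "s \<in> \<mu> z" "s \<in> verts G\<^sub>1" using z(1) by blast
      have "z \<in> verts H" using z(1) by blast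
      then show ?thesis
        using one_sum_connected_meets_both[OF sum modelD(1)[OF \<mu>] modelD(2)[OF \<mu>] s z(2,3)] by blast
    qed
    have "{x, y} \<in> edges G\<^sub>1"
    proof (rule ccontr)
      assume "{x, y} \<notin> edges G\<^sub>1"
      then have "{x, y} \<in> edges G\<^sub>2" using xy sum unfolding one_sum_def by blast
      then have "x \<in> verts G\<^sub>2" "y \<in> verts G\<^sub>2" using edge_in_graphD[OF one_sum_graph(3)[OF sum]] by auto
      then have "v \<in> \<mu> u" "v \<in> \<mu> w" using in_v uw xy by blast+
      then show False using modelD(4)[OF \<mu>, of u w] uw edge_in_graphD(3)[OF H e] by blast
    qed
    then show "\<exists>x\<in>\<mu> u \<inter> verts G\<^sub>1. \<exists>y\<in>\<mu> w \<inter> verts G\<^sub>1. {x, y} \<in> edges G\<^sub>1"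
      using xy edge_in_graphD[OF one_sum_graph(2)[OF sum]] by blast
  qed
  then show ?thesis unfolding minor_iff_model by blast
qed

lemma one_sum_minor_cases:
  assumes sum: "one_sum G G\<^sub>1 G\<^sub>2 v" and H: "is_graph H" and con: "connected_graph H"
    and HG: "minor H G"
  obtains "minor H G\<^sub>1" | "minor H G\<^sub>2"
  | H\<^sub>1 H\<^sub>2 u where "one_sum H H\<^sub>1 H\<^sub>2 u" "minor H\<^sub>1 G\<^sub>1" "minor H\<^sub>2 G\<^sub>2"
proof -
  obtain \<mu> where \<mu>: "model H G \<mu>" using HG unfolding minor_iff_model by blast
  let ?U1 = "{u \<in> verts H. \<mu> u \<inter> verts G\<^sub>1 \<noteq> {}}" and ?U2 = "{u \<in> verts H. \<mu> u \<inter> verts G\<^sub>2 \<noteq> {}}"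
  have m: "minor (induced H ?U1) G\<^sub>1" "minor (induced H ?U2) G\<^sub>2"
    using one_sum_model_side[OF sum \<mu> H] one_sum_model_side[OF one_sum_commute[OF sum] \<mu> H] by auto
  have cover: "?U1 \<union> ?U2 = verts H"
  proof -
    have "\<mu> u \<inter> verts G\<^sub>1 \<noteq> {} \<or> \<mu> u \<inter> verts G\<^sub>2 \<noteq> {}" if u: "u \<in> verts H" for u
    proof -
      have "\<mu> u \<subseteq> verts G\<^sub>1 \<union> verts G\<^sub>2"
        using modelD(1)[OF \<mu> u] sum unfolding one_sum_def by simp
      then show ?thesis using modelD(3)[OF \<mu> u] by blast
    qed
    then show ?thesis by blast
  qed
  have edge_side: "e \<subseteq> ?U1 \<or> e \<subseteq> ?U2" if e: "e \<in> edges H" for e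
  proof -
    obtain u w where uw: "e = {u, w}" "u \<in> verts H" "w \<in> verts H" using edge_in_graphE[OF H e] by metis
    have "{u, w} \<in> edges H" using e uw(1) by simp
    from modelD(5)[OF \<mu> this] obtain x y where
      xy: "x \<in> \<mu> u" "y \<in> \<mu> w" "{x, y} \<in> edges G" by blast
    have "{x, y} \<in> edges G\<^sub>1 \<or> {x, y} \<in> edges G\<^sub>2" using xy(3) sum unfolding one_sum_def by blast
    then have "(x \<in> verts G\<^sub>1 \<and> y \<in> verts G\<^sub>1) \<or> (x \<in> verts G\<^sub>2 \<and> y \<in> verts G\<^sub>2)"
      using edge_in_graphD(1,2)[OF one_sum_graph(2)[OF sum], of x y]
        edge_in_graphD(1,2)[OF one_sum_graph(3)[OF sum], of x y] by argo
    moreover have "e \<subseteq> ?U1" if "x \<in> verts G\<^sub>1 \<and> y \<in> verts G\<^sub>1" using that xy(1,2) uw by auto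
    moreover have "e \<subseteq> ?U2" if "x \<in> verts G\<^sub>2 \<and> y \<in> verts G\<^sub>2" using that xy(1,2) uw by auto
    ultimately show ?thesis by argo
  qed
  have both: "v \<in> \<mu> u" if u: "u \<in> ?U1 \<inter> ?U2" for u
  proof -
    obtain s t where st: "s \<in> \<mu> u" "s \<in> verts G\<^sub>1" "t \<in> \<mu> u" "t \<in> verts G\<^sub>2" using u by blast
    have "u \<in> verts H" using u by blast
    then show ?thesis
      using one_sum_connected_meets_both[OF sum modelD(1)[OF \<mu>] modelD(2)[OF \<mu>] st] by blast
  qed
  show thesis
  proof (cases "?U1 \<inter> ?U2 = {}")
    case True
    have "?U1 = {} \<or> ?U1 = verts H"
    proof (rule ccontr)
      assume "\<not> ?thesis"
      then have "?U1 \<subseteq> verts H" "?U1 \<noteq> {}" "?U1 \<noteq> verts H" by blast+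
      then obtain x y where "x \<in> ?U1" "y \<in> verts H - ?U1" "{x, y} \<in> edges H"
        by (rule connected_crossing[OF H con])
      then show False using edge_side[of "{x, y}"] True by blast
    qed
    then show thesis
    proof
      assume "?U1 = {}"
      then have "?U2 = verts H" using cover by blast
      then show thesis using m(2) that(2) induced_verts[OF H] by simp
    next
      assume "?U1 = verts H"
      then show thesis using m(1) that(1) induced_verts[OF H] by simp
    qed
  next
    case False
    then obtain u where u: "u \<in> ?U1 \<inter> ?U2" by blast
    have "w = u" if "w \<in> ?U1 \<inter> ?U2" for w
      using both[OF u] both[OF that] modelD(4)[OF \<mu>, of w u] u that by blast
    then have U: "?U1 \<inter> ?U2 = {u}" using u by blast
    have V: "verts (induced H ?U1) = ?U1" "verts (induced H ?U2) = ?U2"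
      by (intro verts_induced; blast)+
    have "one_sum H (induced H ?U1) (induced H ?U2) u"
      unfolding one_sum_def V
    proof (intro conjI is_graph_induced[OF H] U cover[symmetric])
      show "edges H = edges (induced H ?U1) \<union> edges (induced H ?U2)"
        unfolding edges_induced using edge_side by blast
    qed
    then show thesis using m that(3) by blast
  qed
qed

section \<open>The excess of connected minors\<close>

text \<open>
  With this normalisation the excess is additive over gluing at a vertex, and a graph has at
  least 3/2 edges per vertex iff its excess is at least 3.
\<close>

definition excess :: "'a graph \<Rightarrow> int" where
  "excess G = 2 * int (card (edges G)) - 3 * int (card (verts G)) + 3"

lemma excess_one_sum: "one_sum G G\<^sub>1 G\<^sub>2 v \<Longrightarrow> excess G = excess G\<^sub>1 + excess G\<^sub>2"
  using card_one_sum[of G G\<^sub>1 G\<^sub>2 v] unfolding excess_def by linarith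

definition excess_bounded :: "'a graph \<Rightarrow> int \<Rightarrow> bool" where
  "excess_bounded G c \<longleftrightarrow>
     (\<forall>H :: nat graph. is_graph H \<and> connected_graph H \<and> minor H G \<longrightarrow> excess H \<le> c)"

lemma excess_bounded_one_sum:
  assumes sum: "one_sum G G\<^sub>1 G\<^sub>2 v" and "excess_bounded G\<^sub>1 c" "excess_bounded G\<^sub>2 d" "0 \<le> c" "0 \<le> d"
  shows "excess_bounded G (c + d)"
  unfolding excess_bounded_def
proof (intro allI impI)
  fix H :: "nat graph" assume H: "is_graph H \<and> connected_graph H \<and> minor H G"
  then have h: "is_graph H" "connected_graph H" "minor H G" by auto
  show "excess H \<le> c + d"
  proof (rule one_sum_minor_cases[OF sum h])
    assume "minor H G\<^sub>1"
    then have "excess H \<le> c" using h assms(2) unfolding excess_bounded_def by blast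
    then show ?thesis using assms(5) by linarith
  next
    assume "minor H G\<^sub>2"
    then have "excess H \<le> d" using h assms(3) unfolding excess_bounded_def by blast
    then show ?thesis using assms(4) by linarith
  next
    fix H\<^sub>1 H\<^sub>2 u assume s: "one_sum H H\<^sub>1 H\<^sub>2 u" "minor H\<^sub>1 G\<^sub>1" "minor H\<^sub>2 G\<^sub>2"
    then have "excess H\<^sub>1 \<le> c" "excess H\<^sub>2 \<le> d"
      using assms(2,3) H one_sum_graph[OF s(1)] one_sum_connected_left[OF s(1)]
        one_sum_connected_right[OF s(1)] unfolding excess_bounded_def by blast+
    then show ?thesis using excess_one_sum[OF s(1)] by linarith
  qed
qed

text \<open>
  In a rigid graph every connected minor that attains the bound is spanning; this will make the
  obstructions incomparable.
\<close>

definition rigid :: "'a graph \<Rightarrow> int \<Rightarrow> bool" where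
  "rigid G c \<longleftrightarrow> (\<forall>H :: nat graph. is_graph H \<and> connected_graph H \<and> minor H G \<longrightarrow>
     excess H \<le> c \<and> (excess H = c \<longrightarrow> card (verts H) = card (verts G)))"

lemma rigid_one_sum:
  assumes sum: "one_sum G G\<^sub>1 G\<^sub>2 v" and "rigid G\<^sub>1 c" "rigid G\<^sub>2 d" "0 < c" "0 < d"
  shows "rigid G (c + d)"
  unfolding rigid_def
proof (intro allI impI)
  fix H :: "nat graph" assume H: "is_graph H \<and> connected_graph H \<and> minor H G"
  then have h: "is_graph H" "connected_graph H" "minor H G" by auto
  show "excess H \<le> c + d \<and> (excess H = c + d \<longrightarrow> card (verts H) = card (verts G))"
  proof (rule one_sum_minor_cases[OF sum h])
    assume "minor H G\<^sub>1"
    then have "excess H \<le> c" using H assms(2) unfolding rigid_def by blast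
    then show ?thesis using assms(5) by linarith
  next
    assume "minor H G\<^sub>2"
    then have "excess H \<le> d" using H assms(3) unfolding rigid_def by blast
    then show ?thesis using assms(4) by linarith
  next
    fix H\<^sub>1 H\<^sub>2 u assume s: "one_sum H H\<^sub>1 H\<^sub>2 u" "minor H\<^sub>1 G\<^sub>1" "minor H\<^sub>2 G\<^sub>2"
    then have r: "excess H\<^sub>1 \<le> c \<and> (excess H\<^sub>1 = c \<longrightarrow> card (verts H\<^sub>1) = card (verts G\<^sub>1))"
      "excess H\<^sub>2 \<le> d \<and> (excess H\<^sub>2 = d \<longrightarrow> card (verts H\<^sub>2) = card (verts G\<^sub>2))"
      using assms(2,3) H one_sum_graph[OF s(1)] one_sum_connected_left[OF s(1)]
        one_sum_connected_right[OF s(1)] unfolding rigid_def by blast+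
    then show ?thesis using excess_one_sum[OF s(1)] card_one_sum(1)[OF s(1)] card_one_sum(1)[OF sum]
      by linarith
  qed
qed

lemma choose_two_small: "Suc 0 choose 2 = 0" "(2::nat) choose 2 = 1" "(3::nat) choose 2 = 3"
  "(4::nat) choose 2 = 6"
  by (simp_all add: choose_two)

lemma excess_bounded_three_vertices:
  assumes G: "is_graph G" and "card (verts G) \<le> 3"
  shows "excess_bounded G 0"
  unfolding excess_bounded_def
proof (intro allI impI)
  fix H :: "nat graph" assume H: "is_graph H \<and> connected_graph H \<and> minor H G"
  then have "card (verts H) \<le> 3" using minor_card_le(1)[of H G] G assms(2) by simp
  moreover have "card (verts H) \<noteq> 0" using H connected_nonempty[of H] finite_verts[of H] by auto
  ultimately consider "card (verts H) = 1" | "card (verts H) = 2" | "card (verts H) = 3" by linarith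
  then show "excess H \<le> 0"
    using card_edges_le_choose[of H] H by cases (auto simp: excess_def choose_two_small)
qed

lemma rigid_four_vertices:
  assumes G: "is_graph G" and n: "card (verts G) = 4"
  shows "rigid G 3"
  unfolding rigid_def
proof (intro allI impI)
  fix H :: "nat graph" assume H: "is_graph H \<and> connected_graph H \<and> minor H G"
  then have "card (verts H) \<le> 4" using minor_card_le(1)[of H G] G n by simp
  moreover have "card (verts H) \<noteq> 0" using H connected_nonempty[of H] finite_verts[of H] by auto
  ultimately consider "card (verts H) = 1" | "card (verts H) = 2" | "card (verts H) = 3" | "card (verts H) = 4"
    by linarith
  then show "excess H \<le> 3 \<and> (excess H = 3 \<longrightarrow> card (verts H) = card (verts G))"
    using card_edges_le_choose[of H] H n by cases (auto simp: excess_def choose_two_small)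
qed

section \<open>2-trees\<close>

lemma verts_delete_vertex: "verts (delete_vertex G v) = verts G - {v}"
  by (auto simp: delete_vertex_def induced_def)

lemma edges_delete_vertex: "is_graph G \<Longrightarrow> edges (delete_vertex G v) = {e \<in> edges G. v \<notin> e}"
  unfolding delete_vertex_def edges_induced is_graph_def by auto

lemma is_graph_delete_vertex: "is_graph G \<Longrightarrow> is_graph (delete_vertex G v)"
  by (simp add: delete_vertex_def is_graph_induced)

lemma induced_induced: "U \<subseteq> W \<Longrightarrow> induced (induced G W) U = induced G U"
  by (auto simp: induced_def)

lemma connected_set_delete_vertex:
  assumes "U \<subseteq> verts G - {v}"
  shows "connected_set (delete_vertex G v) U \<longleftrightarrow> connected_set G U"
  unfolding delete_vertex_def using induced_induced[OF assms] by simp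

lemma subgraph_delete_vertex: "is_graph G \<Longrightarrow> subgraph (delete_vertex G v) G"
  by (auto simp: subgraph_def is_graph_delete_vertex verts_delete_vertex edges_delete_vertex)

definition simplicial2 :: "'a graph \<Rightarrow> 'a \<Rightarrow> 'a \<Rightarrow> 'a \<Rightarrow> bool" where
  "simplicial2 G v a b \<longleftrightarrow> v \<in> verts G \<and> nbrs G v = {a, b} \<and> {a, b} \<in> edges G"

lemma simplicial2_distinct:
  assumes "is_graph G" "simplicial2 G v a b"
  shows "a \<noteq> b" "a \<noteq> v" "b \<noteq> v" "a \<in> verts G" "b \<in> verts G"
  using edge_in_graphD[OF assms(1), of a b] assms nbrs_irrefl[OF assms(1), of v]
  by (auto simp: simplicial2_def)

lemma two_tree_extendE:
  assumes G: "is_graph G" and v: "v \<in> verts G" and iso: "induced G (neighborhood G v) \<cong>\<^sub>g complete_graph 2"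
  obtains a b where "simplicial2 G v a b"
proof -
  have N: "neighborhood G v = nbrs G v" using G by (rule neighborhood_eq_nbrs)
  have V: "verts (induced G (nbrs G v)) = nbrs G v" using nbrs_subset[OF G] by (rule verts_induced)
  obtain f where f: "bij_betw f (nbrs G v) {..<2::nat}"
    "edges (complete_graph 2) = (\<lambda>e. f ` e) ` edges (induced G (nbrs G v))"
    using iso unfolding isomorphic_def N V verts_complete by blast
  then have "card (nbrs G v) = 2" using bij_betw_same_card by fastforce
  then obtain a b where ab: "nbrs G v = {a, b}" "a \<noteq> b" unfolding card_2_iff by blast
  have "edges (induced G (nbrs G v)) \<noteq> {}" using f(2) edges_complete_2 by force
  then obtain e where e: "e \<in> edges G" "e \<subseteq> {a, b}" unfolding edges_induced ab by blast
  have "card e = 2" using G e(1) by (simp add: is_graph_def)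
  then have "e = {a, b}" using card_subset_eq[OF _ e(2)] ab(2) by simp
  then show ?thesis using that ab v e unfolding simplicial2_def by blast
qed

lemma two_tree_extendI:
  assumes G: "is_graph G" and s: "simplicial2 G v a b" and T: "two_tree (delete_vertex G v)"
    and n: "3 < card (verts G)"
  shows "two_tree G"
proof (rule two_tree.extend[OF G n _ _ T])
  show "v \<in> verts G" using s by (simp add: simplicial2_def)
  have ab: "a \<noteq> b" using simplicial2_distinct[OF G s] by simp
  have N: "neighborhood G v = {a, b}" "{a, b} \<in> edges G" "{a, b} \<subseteq> verts G"
    using s neighborhood_eq_nbrs[OF G] simplicial2_distinct[OF G s] by (auto simp: simplicial2_def)
  let ?f = "\<lambda>x. if x = a then 0 else (1::nat)"
  have "edges (induced G {a, b}) = {{a, b}}"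
  proof -
    have "e = {a, b}" if "e \<in> edges G" "e \<subseteq> {a, b}" for e
      using that G ab card_subset_eq[of "{a, b}" e] by (simp add: is_graph_def)
    then show ?thesis unfolding edges_induced using N(2) by blast
  qed
  then show "induced G (neighborhood G v) \<cong>\<^sub>g complete_graph 2"
    unfolding isomorphic_def N(1) verts_induced[OF N(3)] edges_complete_2 verts_complete
    using ab by (intro exI[of _ ?f]) (auto simp: bij_betw_def inj_on_def lessThan_nat_numeral lessThan_Suc)
qed

lemma two_tree_triangleI:
  assumes "a \<noteq> b" "a \<noteq> c" "b \<noteq> c"
  shows "two_tree \<lparr>verts = {a, b, c}, edges = {{a, b}, {a, c}, {b, c}}\<rparr>" (is "two_tree ?G")
proof (rule two_tree.triangle)
  show "is_graph ?G" using assms by (auto simp: is_graph_def)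
  let ?f = "\<lambda>x. if x = a then 0 else if x = b then 1 else (2::nat)"
  have K: "edges (complete_graph 3) = {{0, 1}, {0, 2}, {1, 2::nat}}"
  proof -
    have "e \<in> {{0, 1}, {0, 2}, {1, 2::nat}}" if e: "e \<subseteq> {..<3}" "card e = 2" for e :: "nat set"
    proof -
      obtain x y where xy: "e = {x, y}" "x \<noteq> y" using e(2) unfolding card_2_iff by blast
      then have "x \<in> {0, 1, 2}" "y \<in> {0, 1, 2}" using e(1) by auto
      then show ?thesis using xy by auto
    qed
    then show ?thesis by (auto simp: complete_graph_def)
  qed
  have "bij_betw ?f (verts ?G) (verts (complete_graph 3))" using assms
    unfolding verts_complete by (auto simp: bij_betw_def inj_on_def lessThan_nat_numeral lessThan_Suc)
  moreover have "edges (complete_graph 3) = (\<lambda>e. ?f ` e) ` edges ?G" unfolding K using assms by auto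
  ultimately show "?G \<cong>\<^sub>g complete_graph 3" unfolding isomorphic_def by (intro exI[of _ ?f] conjI)
qed

lemma isomorphic_completeD:
  assumes G: "is_graph G" and iso: "G \<cong>\<^sub>g complete_graph n"
  shows "card (verts G) = n"
    and "x \<in> verts G \<Longrightarrow> y \<in> verts G \<Longrightarrow> x \<noteq> y \<Longrightarrow> {x, y} \<in> edges G"
proof -
  obtain f where f: "bij_betw f (verts G) {..<n}"
    "edges (complete_graph n) = (\<lambda>e. f ` e) ` edges G"
    using iso unfolding isomorphic_def verts_complete by blast
  show "card (verts G) = n" using bij_betw_same_card[OF f(1)] by simp
  show "{x, y} \<in> edges G" if xy: "x \<in> verts G" "y \<in> verts G" "x \<noteq> y" for x y
  proof -
    have "f x \<noteq> f y" using f(1) xy by (auto simp: bij_betw_def inj_on_def)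
    moreover have "f x < n" "f y < n" using f(1) xy by (auto simp: bij_betw_def)
    ultimately have "{f x, f y} \<in> edges (complete_graph n)" by (auto simp: complete_graph_def)
    then obtain e where e: "e \<in> edges G" "{f x, f y} = f ` e" unfolding f(2) by blast
    have "f ` {x, y} = f ` e" using e(2) by simp
    moreover have "e \<subseteq> verts G" "{x, y} \<subseteq> verts G" using G e(1) xy by (auto simp: is_graph_def)
    ultimately have "{x, y} = e" using f(1) by (metis bij_betw_def inj_on_image_eq_iff)
    then show ?thesis using e(1) by simp
  qed
qed

lemma card_edges_clique:
  assumes G: "is_graph G"
    and adj: "\<And>x y. x \<in> verts G \<Longrightarrow> y \<in> verts G \<Longrightarrow> x \<noteq> y \<Longrightarrow> {x, y} \<in> edges G"
  shows "card (edges G) = card (verts G) choose 2"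
proof -
  have "edges G = {e. e \<subseteq> verts G \<and> card e = 2}"
  proof (intro equalityI subsetI)
    fix e assume "e \<in> {e. e \<subseteq> verts G \<and> card e = 2}"
    then show "e \<in> edges G" using adj unfolding card_2_iff by auto
  qed (use G in \<open>auto simp: is_graph_def\<close>)
  then show ?thesis using n_subsets[OF finite_verts[OF G], of 2] by simp
qed

lemma two_tree_graph: "two_tree G \<Longrightarrow> is_graph G"
  by (auto elim: two_tree.cases)

lemma two_tree_induct [consumes 1, case_names triangle extend]:
  assumes "two_tree G"
    and "\<And>G. is_graph G \<Longrightarrow> card (verts G) = 3 \<Longrightarrow>
      (\<And>x y. x \<in> verts G \<Longrightarrow> y \<in> verts G \<Longrightarrow> x \<noteq> y \<Longrightarrow> {x, y} \<in> edges G) \<Longrightarrow> P G"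
    and "\<And>G v a b. is_graph G \<Longrightarrow> 3 < card (verts G) \<Longrightarrow> simplicial2 G v a b \<Longrightarrow>
      two_tree (delete_vertex G v) \<Longrightarrow> P (delete_vertex G v) \<Longrightarrow> P G"
  shows "P G"
  using assms(1)
proof (induction G rule: two_tree.induct)
  case (triangle G)
  then show ?case using assms(2) isomorphic_completeD by metis
next
  case (extend G v)
  then show ?case using two_tree_extendE[OF extend(1,3,4)] assms(3) by metis
qed

lemma two_tree_card:
  assumes "two_tree G"
  shows "3 \<le> card (verts G)" "card (edges G) + 3 = 2 * card (verts G)"
proof -
  have "3 \<le> card (verts G) \<and> card (edges G) + 3 = 2 * card (verts G)"
    using assms
  proof (induction rule: two_tree_induct)
    case (triangle G)
    then have "card (edges G) = 3" using card_edges_clique[OF triangle(1,3)] choose_two_small by simp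
    then show ?case using triangle(2) by simp
  next
    case (extend G v a b)
    have "v \<in> verts G" "card (nbrs G v) = 2"
      using extend(3) simplicial2_distinct[OF extend(1,3)] by (auto simp: simplicial2_def)
    then have "card (verts (delete_vertex G v)) + 1 = card (verts G)"
      "card (edges G) = card (edges (delete_vertex G v)) + 2"
      using card_Suc_Diff1[OF finite_verts[OF extend(1)]] card_edges_delete[OF extend(1), of v]
      by (simp_all add: verts_delete_vertex edges_delete_vertex[OF extend(1)])
    then show ?case using extend(5) by linarith
  qed
  then show "3 \<le> card (verts G)" "card (edges G) + 3 = 2 * card (verts G)" by auto
qed

text \<open>
  Deleting a simplicial vertex of degree 2 from a graph: its branch set either is a singleton,
  and then its vertex of the minor has degree at most 2, or it can give up the vertex, because
  the two neighbours are adjacent.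
\<close>

lemma minor_delete_simplicial:
  fixes H :: "'b graph"
  assumes G: "is_graph G" and s: "simplicial2 G v a b" and HG: "minor H G" and H: "is_graph H"
  shows "minor H (delete_vertex G v) \<or>
    (\<exists>u\<in>verts H. minor (delete_vertex H u) (delete_vertex G v) \<and> card (nbrs H u) \<le> 2)"
proof -
  obtain \<mu> where \<mu>: "model H G \<mu>" using HG unfolding minor_iff_model by blast
  let ?D = "delete_vertex G v"
  have edgeD: "{x, y} \<in> edges ?D" if "{x, y} \<in> edges G" "x \<noteq> v" "y \<noteq> v" for x y
    using that by (simp add: edges_delete_vertex[OF G])
  have nv: "y \<in> {a, b}" if "{v, y} \<in> edges G" for y
    using that s by (auto simp: simplicial2_def nbrs_def)
  note ab = simplicial2_distinct[OF G s]
  have abE: "{x, y} \<in> edges G" if "x \<in> {a, b}" "y \<in> {a, b}" "x \<noteq> y" for x y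
    using that s unfolding simplicial2_def by (auto simp: insert_commute)
  show ?thesis
  proof (cases "\<exists>u\<in>verts H. v \<in> \<mu> u")
    case False
    have "model H ?D \<mu>"
    proof (rule modelI)
      fix u assume u: "u \<in> verts H"
      then have "\<mu> u \<subseteq> verts G - {v}" using modelD(1)[OF \<mu> u] False by blast
      then show "\<mu> u \<subseteq> verts ?D" "connected_set ?D (\<mu> u)"
        using modelD(2)[OF \<mu> u] connected_set_delete_vertex[of "\<mu> u" G v] by (auto simp: verts_delete_vertex)
    next
      fix u w assume e: "{u, w} \<in> edges H"
      then obtain x y where "x \<in> \<mu> u" "y \<in> \<mu> w" "{x, y} \<in> edges G" using modelD(5)[OF \<mu>] by blast
      moreover from this have "x \<noteq> v" "y \<noteq> v" using False edge_in_graphD[OF H e] by blast+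
      ultimately show "\<exists>x\<in>\<mu> u. \<exists>y\<in>\<mu> w. {x, y} \<in> edges ?D" using edgeD by blast
    qed (rule modelD(4)[OF \<mu>])
    then show ?thesis unfolding minor_iff_model by blast
  next
    case True
    then obtain u where u: "u \<in> verts H" "v \<in> \<mu> u" by blast
    have only: "v \<notin> \<mu> w" if "w \<in> verts H" "w \<noteq> u" for w using modelD(4)[OF \<mu>, of w u] that u by blast
    show ?thesis
    proof (cases "\<mu> u = {v}")
      case True
      have "model (delete_vertex H u) ?D \<mu>"
      proof (rule modelI)
        fix w assume "w \<in> verts (delete_vertex H u)"
        then have w: "w \<in> verts H" "w \<noteq> u" by (auto simp: verts_delete_vertex)
        then have "\<mu> w \<subseteq> verts G - {v}" using modelD(1)[OF \<mu> w(1)] only by blast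
        then show "\<mu> w \<subseteq> verts ?D" "connected_set ?D (\<mu> w)"
          using modelD(2)[OF \<mu> w(1)] connected_set_delete_vertex[of "\<mu> w" G v] by (auto simp: verts_delete_vertex)
      next
        fix w z assume "w \<in> verts (delete_vertex H u)" "z \<in> verts (delete_vertex H u)" "w \<noteq> z"
        then show "\<mu> w \<inter> \<mu> z = {}" using modelD(4)[OF \<mu>] by (auto simp: verts_delete_vertex)
      next
        fix w z assume "{w, z} \<in> edges (delete_vertex H u)"
        then have e: "{w, z} \<in> edges H" "w \<noteq> u" "z \<noteq> u" by (auto simp: edges_delete_vertex[OF H])
        then obtain x y where "x \<in> \<mu> w" "y \<in> \<mu> z" "{x, y} \<in> edges G" using modelD(5)[OF \<mu>] by blast
        moreover from this have "x \<noteq> v" "y \<noteq> v" using only edge_in_graphD[OF H e(1)] e by blast+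
        ultimately show "\<exists>x\<in>\<mu> w. \<exists>y\<in>\<mu> z. {x, y} \<in> edges ?D" using edgeD by blast
      qed
      moreover have "card (nbrs H u) \<le> 2"
      proof -
        have "\<exists>y\<in>{a, b}. y \<in> \<mu> w" if "w \<in> nbrs H u" for w
          using modelD(5)[OF \<mu>, of u w] that True nv by (auto simp: nbrs_def)
        then obtain f where f: "\<And>w. w \<in> nbrs H u \<Longrightarrow> f w \<in> {a, b} \<and> f w \<in> \<mu> w" by metis
        have "inj_on f (nbrs H u)"
          using f modelD(4)[OF \<mu>] nbrs_subset[OF H, of u] by (intro inj_onI) (metis disjoint_iff subsetD)
        then have "card (nbrs H u) \<le> card {a, b}" using f by (intro card_inj_on_le[of f]) auto
        then show ?thesis using ab by simp
      qed
      ultimately show ?thesis using u(1) unfolding minor_iff_model by blast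
    next
      case False
      let ?\<nu> = "\<mu>(u := \<mu> u - {v})"
      obtain c where c: "c \<in> \<mu> u" "{v, c} \<in> edges G" "c \<noteq> v"
        using connected_set_crossing[OF G modelD(2)[OF \<mu> u(1)] modelD(1)[OF \<mu> u(1)], of "{v}"] u(2) False
        by (metis DiffE empty_not_insert empty_subsetI insert_subset insertI1 singletonD)
      have con: "connected_set G (\<mu> u - {v})"
      proof (rule connected_setI[OF G])
        show "\<mu> u - {v} \<subseteq> verts G" using modelD(1)[OF \<mu> u(1)] by blast
        show "\<mu> u - {v} \<noteq> {}" using c by blast
        fix S assume S: "S \<subseteq> \<mu> u - {v}" "S \<noteq> {}" "S \<noteq> \<mu> u - {v}"
        obtain x y where xy: "x \<in> S" "y \<in> \<mu> u - S" "{x, y} \<in> edges G"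
          using connected_set_crossing[OF G modelD(2)[OF \<mu> u(1)] modelD(1)[OF \<mu> u(1)], of S] S u(2)
          by blast
        obtain x' y' where xy': "x' \<in> insert v S" "y' \<in> \<mu> u - insert v S" "{x', y'} \<in> edges G"
          using connected_set_crossing[OF G modelD(2)[OF \<mu> u(1)] modelD(1)[OF \<mu> u(1)], of "insert v S"] S u(2)
          by blast
        show "\<exists>x\<in>S. \<exists>y\<in>\<mu> u - {v} - S. {x, y} \<in> edges G"
        proof (cases "y = v \<and> x' = v")
          case True
          then have "x \<in> {a, b}" "y' \<in> {a, b}" using nv xy(3) xy'(3) by (auto simp: insert_commute)
          moreover have "x \<noteq> y'" using xy(1) xy'(2) by blast
          ultimately have "{x, y'} \<in> edges G" using abE by blast
          then show ?thesis using xy(1) xy'(2) by blast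
        next
          case False
          then show ?thesis using xy xy' by blast
        qed
      qed
      have "model H ?D ?\<nu>"
      proof (rule modelI)
        fix w assume w: "w \<in> verts H"
        have sub: "?\<nu> w \<subseteq> verts G - {v}" using modelD(1)[OF \<mu> w] only[OF w] by auto
        have "connected_set G (?\<nu> w)" using modelD(2)[OF \<mu> w] con by simp
        then show "?\<nu> w \<subseteq> verts ?D" "connected_set ?D (?\<nu> w)"
          using sub connected_set_delete_vertex[OF sub] by (simp_all add: verts_delete_vertex)
      next
        fix w z assume "w \<in> verts H" "z \<in> verts H" "w \<noteq> z"
        then show "?\<nu> w \<inter> ?\<nu> z = {}" using modelD(4)[OF \<mu>, of w z] by (auto split: if_splits)
      next
        have vcase: "\<exists>y'\<in>?\<nu> z. \<exists>x\<in>?\<nu> u. {x, y'} \<in> edges ?D"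
          if z: "z \<in> verts H" "z \<noteq> u" "y \<in> \<mu> z" "{v, y} \<in> edges G" for y z
        proof -
          have "y \<noteq> c" using c(1) z modelD(4)[OF \<mu>, of z u] u(1) by blast
          then have "{c, y} \<in> edges G" using nv[OF z(4)] nv[OF c(2)] abE by blast
          moreover have "y \<noteq> v" using edge_in_graphD(3)[OF G z(4)] by blast
          ultimately have "{c, y} \<in> edges ?D" using edgeD c(3) by blast
          then show ?thesis using z c by (intro bexI[of _ y] bexI[of _ c]) auto
        qed
        fix w z assume e: "{w, z} \<in> edges H"
        note wz = edge_in_graphD[OF H e]
        obtain x y where xy: "x \<in> \<mu> w" "y \<in> \<mu> z" "{x, y} \<in> edges G" using modelD(5)[OF \<mu> e] by blast
        consider "x = v" | "y = v" | "x \<noteq> v" "y \<noteq> v" by blast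
        then show "\<exists>x\<in>?\<nu> w. \<exists>y\<in>?\<nu> z. {x, y} \<in> edges ?D"
        proof cases
          case 1
          then have "w = u" using only wz xy by blast
          then show ?thesis using vcase[of z y] wz xy 1 by metis
        next
          case 2
          then have zu: "z = u" using only wz xy by blast
          have "{v, x} \<in> edges G" using xy(3) 2 by (simp add: insert_commute)
          then obtain y' x' where "y' \<in> ?\<nu> w" "x' \<in> ?\<nu> u" "{x', y'} \<in> edges ?D"
            using vcase[of w x] wz xy zu by metis
          then show ?thesis using zu by (metis insert_commute)
        next
          case 3
          then have "x \<in> ?\<nu> w" "y \<in> ?\<nu> z" using xy by auto
          then show ?thesis using edgeD[OF xy(3) 3] by blast
        qed
      qed
      then show ?thesis unfolding minor_iff_model by blast
    qed
  qed
qed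

text \<open>
  Following the construction of the 2-tree backwards, each of its vertices can be deleted at the cost
  of at most one vertex of degree at most 2 of the minor.
\<close>

lemma two_tree_minor_edges:
  fixes H :: "'b graph"
  assumes "two_tree G" "is_graph H" "minor H G" "2 \<le> card (verts H)"
  shows "card (edges H) + 3 \<le> 2 * card (verts H)"
  using assms
proof (induction arbitrary: H rule: two_tree_induct)
  case (triangle G)
  have "card (verts H) \<le> 3" using minor_card_le(1)[OF triangle(5,4,1)] triangle(2) by simp
  then have "card (verts H) = 2 \<or> card (verts H) = 3" using triangle(6) by linarith
  then show ?case using card_edges_le_choose[OF triangle(4)] by (auto simp: choose_two_small)
next
  case (extend G v a b)
  note H = \<open>is_graph H\<close>
  consider "minor H (delete_vertex G v)"
    | u where "u \<in> verts H" "minor (delete_vertex H u) (delete_vertex G v)" "card (nbrs H u) \<le> 2"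
    using minor_delete_simplicial[OF extend(1,3) \<open>minor H G\<close> H] by blast
  then show ?case
  proof cases
    case 1
    then show ?thesis using extend by blast
  next
    case 2
    let ?D = "delete_vertex H u"
    have c: "card (verts ?D) + 1 = card (verts H)" "card (edges H) = card (edges ?D) + card (nbrs H u)"
      using card_Suc_Diff1[OF finite_verts[OF H] 2(1)] card_edges_delete[OF H, of u]
      by (simp_all add: verts_delete_vertex edges_delete_vertex[OF H])
    show ?thesis
    proof (cases "2 \<le> card (verts ?D)")
      case True
      then have "card (edges ?D) + 3 \<le> 2 * card (verts ?D)"
        using extend(5) 2(2) is_graph_delete_vertex[OF H] by blast
      then show ?thesis using c 2(3) by linarith
    next
      case False
      then have "card (verts H) = 2" using c(1) \<open>2 \<le> card (verts H)\<close> by linarith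
      then show ?thesis using card_edges_le_choose[OF H] by (simp add: choose_two_small)
    qed
  qed
qed

text \<open>
  A connected minor on \<open>n \<ge> 2\<close> vertices has at most \<open>2n - 3\<close> edges and hence excess at most \<open>n - 3\<close>; the
  bound is attained only at full order. The one-vertex minor has excess 0, which is why the case of
  the triangle is excluded.
\<close>

lemma two_tree_rigid:
  assumes T: "two_tree G" and n: "4 \<le> card (verts G)"
  shows "rigid G (int (card (verts G)) - 3)"
  unfolding rigid_def
proof (intro allI impI)
  fix H :: "nat graph" assume H: "is_graph H \<and> connected_graph H \<and> minor H G"
  have le: "card (verts H) \<le> card (verts G)" using minor_card_le(1) H two_tree_graph[OF T] by blast
  have "card (verts H) \<noteq> 0" using H connected_nonempty[of H] finite_verts[of H] by auto
  then consider "card (verts H) = 1" | "2 \<le> card (verts H)" by linarith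
  then show "excess H \<le> int (card (verts G)) - 3 \<and>
    (excess H = int (card (verts G)) - 3 \<longrightarrow> card (verts H) = card (verts G))"
  proof cases
    case 1
    then show ?thesis using card_edges_le_choose[of H] H n by (simp add: excess_def choose_two_small)
  next
    case 2
    then have "card (edges H) + 3 \<le> 2 * card (verts H)" using two_tree_minor_edges[OF T] H by blast
    then show ?thesis using le unfolding excess_def by linarith
  qed
qed

lemma two_tree_excess: "two_tree G \<Longrightarrow> excess G = int (card (verts G)) - 3"
  using two_tree_card[of G] unfolding excess_def by linarith

section \<open>Blocks\<close>

lemma equiv_reachable: "equiv (verts G) (reachable G)"
proof (rule equivI)
  let ?r = "{(u, v). {u, v} \<in> edges G}\<^sup>*"
  show "reachable G \<subseteq> verts G \<times> verts G" by (auto simp: reachable_def)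
  show "refl_on (verts G) (reachable G)" by (auto simp: reachable_def refl_on_def)
  have "sym {(u, v). {u, v} \<in> edges G}" by (simp add: sym_def insert_commute)
  then have "sym ?r" by (rule sym_rtrancl)
  then show "sym (reachable G)" unfolding reachable_def by (auto simp: sym_def)
  show "trans (reachable G)" unfolding reachable_def
    by (rule transI) (auto intro: rtrancl_trans)
qed

lemma finite_components: "is_graph G \<Longrightarrow> finite (components G)"
  unfolding components_def by (rule finite_quotient) (auto simp: finite_verts reachable_def)

text \<open>
  Bridges are defined by counting components, so connectivity has to be expressed by their number.
\<close>

lemma connected_iff_one_component:
  assumes "verts G \<noteq> {}"
  shows "connected_graph G \<longleftrightarrow> card (components G) = 1"
proof
  assume "connected_graph G"
  then have r: "reachable G = verts G \<times> verts G" by (simp add: connected_graph_def)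
  have "components G = {verts G}" unfolding components_def quotient_def r using assms by auto
  then show "card (components G) = 1" by simp
next
  assume "card (components G) = 1"
  then obtain C where C: "components G = {C}" by (auto simp: card_1_singleton_iff)
  have "(x, y) \<in> reachable G" if "x \<in> verts G" "y \<in> verts G" for x y
  proof -
    have "reachable G `` {x} = C" "reachable G `` {y} = C"
      using that C quotientI[of _ "verts G" "reachable G"] unfolding components_def by auto
    then show ?thesis using that eq_equiv_class[OF _ equiv_reachable] by metis
  qed
  then have "reachable G = verts G \<times> verts G" by (auto simp: reachable_def)
  then show "connected_graph G" using assms by (simp add: connected_graph_def)
qed

lemma is_graph_delete_edge: "is_graph G \<Longrightarrow> is_graph (delete_edge G e)"
  by (simp add: is_graph_def delete_edge_def)

lemma bridge_iff:
  assumes G: "is_graph G" and con: "connected_graph G"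
  shows "bridge G e \<longleftrightarrow> e \<in> edges G \<and> \<not> connected_graph (delete_edge G e)"
proof -
  have V: "verts G \<noteq> {}" "verts (delete_edge G e) \<noteq> {}"
    using connected_nonempty[OF con] by (auto simp: delete_edge_def)
  have "components (delete_edge G e) \<noteq> {}" using V(2) by (simp add: components_def quotient_def)
  then have "card (components (delete_edge G e)) \<noteq> 0"
    using finite_components[OF is_graph_delete_edge[OF G]] by simp
  then show ?thesis
    using connected_iff_one_component[OF V(1)] connected_iff_one_component[OF V(2)] con
    unfolding bridge_def by force
qed

lemma two_connectedD:
  assumes "two_connected G"
  shows "3 \<le> card (verts G)" "connected_graph G" "v \<in> verts G \<Longrightarrow> connected_graph (delete_vertex G v)"
  using assms by (auto simp: two_connected_def)

text \<open>
  If deleting the edge \<open>xy\<close> separated the graph, then after deletion of \<open>x\<close> or of \<open>y\<close> no edge would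
  cross the cut, so both sides would be singletons.
\<close>

lemma two_connected_no_bridge:
  assumes G: "is_graph G" and two: "two_connected G"
  shows "\<not> bridge G e"
proof
  assume "bridge G e"
  then have e: "e \<in> edges G" "\<not> connected_graph (delete_edge G e)"
    using bridge_iff[OF G two_connectedD(2)[OF two]] by auto
  have V: "verts (delete_edge G e) = verts G" by (simp add: delete_edge_def)
  then have "verts (delete_edge G e) \<noteq> {}" using two_connectedD(1)[OF two] by auto
  then obtain S where S: "separated (delete_edge G e) S"
    using e(2) connected_iff_no_separation[OF is_graph_delete_edge[OF G]] by blast
  have cross: "{x, y} = e" if "x \<in> S" "y \<in> verts G - S" "{x, y} \<in> edges G" for x y
    using S that unfolding separated_def V by (auto simp: delete_edge_def)
  obtain x y where xy: "x \<in> S" "y \<in> verts G - S" "{x, y} \<in> edges G"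
    using S connected_crossing[OF G two_connectedD(2)[OF two], of S] unfolding separated_def V by blast
  have e_xy: "e = {x, y}" using cross[OF xy] by simp
  have no: "S - {z} = {} \<or> verts G - S - {z} = {}" if z: "z \<in> {x, y}" for z
  proof (rule ccontr)
    assume h: "\<not> ?thesis"
    have "z \<in> verts G" using z xy S unfolding separated_def V by blast
    then have "connected_graph (delete_vertex G z)" using two_connectedD(3)[OF two] by blast
    moreover have "S - {z} \<subseteq> verts (delete_vertex G z)" "S - {z} \<noteq> {}" "S - {z} \<noteq> verts (delete_vertex G z)"
      using h S unfolding separated_def V verts_delete_vertex by blast+
    ultimately obtain s t where st: "s \<in> S - {z}" "t \<in> verts (delete_vertex G z) - (S - {z})"
      "{s, t} \<in> edges (delete_vertex G z)"
      using connected_crossing[OF is_graph_delete_vertex[OF G]] by metis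
    then have "{s, t} = e" "z \<notin> {s, t}"
      using cross[of s t] by (auto simp: verts_delete_vertex edges_delete_vertex[OF G])
    then show False using e_xy z by blast
  qed
  have "x \<noteq> y" using xy by blast
  then have "S = {x} \<and> verts G - S = {y}" using no[of x] no[of y] xy by blast
  then have "verts G = {x, y}" using S unfolding separated_def V by blast
  then show False using two_connectedD(1)[OF two] by (simp add: card_insert_if split: if_splits)
qed

lemma blocks_two_connected:
  assumes G: "is_graph G" and two: "two_connected G"
  shows "blocks G = {G}"
proof (intro equalityI subsetI)
  have GG: "subgraph G G" using G by (simp add: subgraph_def)
  fix B assume "B \<in> blocks G"
  then have "subgraph B G \<and> (\<forall>B'. subgraph B' G \<and> two_connected B' \<and> subgraph B B' \<longrightarrow> B' = B)"
    using two_connected_no_bridge[OF G two] unfolding blocks_def by blast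
  then show "B \<in> {G}" using GG two by blast
next
  fix B assume "B \<in> {G}"
  moreover have "B' = G" if "subgraph B' G" "subgraph G B'" for B'
    by (rule graph.equality) (use that in \<open>auto simp: subgraph_def\<close>)
  moreover have "subgraph G G" using G by (simp add: subgraph_def)
  ultimately show "B \<in> blocks G" using two unfolding blocks_def by blast
qed

lemma connected_set_clique:
  assumes G: "is_graph G" and U: "U \<subseteq> verts G" "U \<noteq> {}"
    and adj: "\<And>x y. x \<in> U \<Longrightarrow> y \<in> U \<Longrightarrow> x \<noteq> y \<Longrightarrow> {x, y} \<in> edges G"
  shows "connected_set G U"
proof (rule connected_setI[OF G U])
  fix S assume S: "S \<subseteq> U" "S \<noteq> {}" "S \<noteq> U"
  then obtain x y where "x \<in> S" "y \<in> U - S" by blast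
  moreover from this have "{x, y} \<in> edges G" using adj[of x y] S(1) by blast
  ultimately show "\<exists>x\<in>S. \<exists>y\<in>U - S. {x, y} \<in> edges G" by blast
qed

text \<open>
  A new vertex has two neighbours, so one of them survives the deletion of any other vertex.
\<close>

lemma two_tree_connected_deletion:
  assumes "two_tree G"
  shows "connected_graph G \<and> (\<forall>u\<in>verts G. connected_graph (delete_vertex G u))"
  using assms
proof (induction rule: two_tree_induct)
  case (triangle G)
  have "connected_set G U" if U: "U \<subseteq> verts G" "U \<noteq> {}" for U
    using U triangle(3) by (intro connected_set_clique[OF triangle(1)]) blast+
  moreover have "verts G - {u} \<noteq> {}" for u
  proof
    assume "verts G - {u} = {}"
    then have "verts G \<subseteq> {u}" by blast
    then show False using card_mono[of "{u}" "verts G"] triangle(2) by simp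
  qed
  ultimately show ?case using connected_set_verts[OF triangle(1)]
    unfolding delete_vertex_def by (metis Diff_subset empty_Diff order_refl)
next
  case (extend G v a b)
  note G = extend(1)
  note ab = simplicial2_distinct[OF extend(1,3)]
  have va: "{v, a} \<in> edges G" "{v, b} \<in> edges G" using extend(3) by (auto simp: simplicial2_def nbrs_def)
  have v: "v \<in> verts G" using extend(3) by (simp add: simplicial2_def)
  have add: "connected_set G (insert v U)"
    if U: "U \<subseteq> verts G" "connected_set G U" "a \<in> U \<or> b \<in> U" for U
    using connected_set_union[OF G connected_set_singleton[OF G v] _ U(2,1)] va U(3) v by auto
  have Gv: "connected_set G (verts G - {v})" using extend(5) unfolding delete_vertex_def by blast
  have "insert v (verts G - {v}) = verts G" using v by blast
  then have con: "connected_graph G"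
    using add[OF _ Gv] ab connected_set_verts[OF G] by auto
  have "connected_graph (delete_vertex G u)" if u: "u \<in> verts G" for u
  proof (cases "u = v")
    case True
    then show ?thesis using Gv by (simp add: delete_vertex_def)
  next
    case False
    then have "u \<in> verts (delete_vertex G v)" using u by (simp add: verts_delete_vertex)
    then have "connected_graph (delete_vertex (delete_vertex G v) u)" using extend(5) by blast
    then have "connected_set G (verts G - {v} - {u})"
      unfolding delete_vertex_def[of "delete_vertex G v"] verts_delete_vertex
      using connected_set_delete_vertex[of "verts G - {v} - {u}" G v] by blast
    moreover have "a \<in> verts G - {v} - {u} \<or> b \<in> verts G - {v} - {u}" using ab by blast
    ultimately have "connected_set G (insert v (verts G - {v} - {u}))" by (intro add) auto
    moreover have "insert v (verts G - {v} - {u}) = verts G - {u}" using v False by blast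
    ultimately show ?thesis by (simp add: delete_vertex_def)
  qed
  then show ?case using con by blast
qed

lemma two_tree_two_connected: "two_tree G \<Longrightarrow> two_connected G"
  using two_tree_connected_deletion two_tree_card(1) unfolding two_connected_def by blast

lemma two_tree_connected: "two_tree G \<Longrightarrow> connected_graph G"
  using two_tree_connected_deletion by blast

text \<open>
  A 2-connected subgraph cannot have vertices on both sides of a cut vertex: removing the cut
  vertex would disconnect it.
\<close>

lemma two_connected_subgraph_one_sum:
  assumes sum: "one_sum G G\<^sub>1 G\<^sub>2 v" and B: "subgraph B G" and two: "two_connected B"
  shows "subgraph B G\<^sub>1 \<or> subgraph B G\<^sub>2"
proof -
  note gr = one_sum_graph[OF sum]
  have gB: "is_graph B" using B by (simp add: subgraph_def)
  have inside: "subgraph B H" if H: "verts B \<subseteq> verts H" "one_sum G H K v" for H K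
  proof -
    have "e \<in> edges H" if e: "e \<in> edges B" for e
    proof (rule ccontr)
      assume "e \<notin> edges H"
      then have "e \<in> edges K" using e B H(2) unfolding subgraph_def one_sum_def by blast
      then have "e \<subseteq> verts K" "e \<subseteq> verts H" "card e = 2"
        using H gB e one_sum_graph(3)[OF H(2)] unfolding is_graph_def by blast+
      then have "e \<subseteq> {v}" using H(2) unfolding one_sum_def by blast
      then show False using card_mono[of "{v}" e] \<open>card e = 2\<close> by simp
    qed
    then show ?thesis using H gB unfolding subgraph_def by blast
  qed
  let ?W = "verts B - {v}"
  have W: "connected_set B ?W"
  proof (cases "v \<in> verts B")
    case True
    then show ?thesis using two_connectedD(3)[OF two] by (simp add: delete_vertex_def)
  next
    case False
    then show ?thesis using two_connectedD(2)[OF two] connected_set_verts[OF gB] by simp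
  qed
  have VB: "verts B \<subseteq> verts G\<^sub>1 \<union> verts G\<^sub>2" "v \<in> verts G\<^sub>1" "v \<in> verts G\<^sub>2"
    using B sum unfolding subgraph_def one_sum_def by blast+
  show ?thesis
  proof (cases "?W \<inter> verts G\<^sub>1 = {} \<or> ?W \<inter> verts G\<^sub>1 = ?W")
    case True
    then have "verts B \<subseteq> verts G\<^sub>1 \<or> verts B \<subseteq> verts G\<^sub>2" using VB by blast
    then show ?thesis using inside sum one_sum_commute[OF sum] by blast
  next
    case False
    then obtain x y where xy: "x \<in> ?W \<inter> verts G\<^sub>1" "y \<in> ?W - (?W \<inter> verts G\<^sub>1)" "{x, y} \<in> edges B"
      using connected_set_crossing[OF gB W, of "?W \<inter> verts G\<^sub>1"] by blast
    then have "{x, y} \<in> edges G" using B unfolding subgraph_def by blast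
    then have "y \<in> verts G\<^sub>1" using one_sum_edge(2)[OF sum, of x y] xy by blast
    then show ?thesis using xy(2) by blast
  qed
qed

lemma bridge_one_sum:
  assumes sum: "one_sum G G\<^sub>1 G\<^sub>2 v" and con: "connected_graph G" and e: "e \<in> edges G\<^sub>1"
  shows "bridge G e \<longleftrightarrow> bridge G\<^sub>1 e"
proof -
  have c: "connected_graph G\<^sub>1" "connected_graph G\<^sub>2"
    using one_sum_connected_left[OF sum con] one_sum_connected_right[OF sum con] .
  have "e \<notin> edges G\<^sub>2" using e one_sum_edges_disjoint[OF sum] by blast
  then have s: "one_sum (delete_edge G e) (delete_edge G\<^sub>1 e) G\<^sub>2 v"
    using sum is_graph_delete_edge[of G\<^sub>1 e] unfolding one_sum_def by (auto simp: delete_edge_def)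
  have "connected_graph (delete_edge G e) \<longleftrightarrow> connected_graph (delete_edge G\<^sub>1 e)"
    using one_sum_connected[OF s _ c(2)] one_sum_connected_left[OF s] by blast
  moreover have "e \<in> edges G" using e sum unfolding one_sum_def by blast
  ultimately show ?thesis
    using bridge_iff[OF one_sum_graph(1)[OF sum] con] bridge_iff[OF one_sum_graph(2)[OF sum] c(1)] e by blast
qed

lemma block_card: "B \<in> blocks G \<Longrightarrow> is_graph G \<Longrightarrow> 2 \<le> card (verts B) \<and> is_graph B \<and> verts B \<subseteq> verts G"
proof -
  assume B: "B \<in> blocks G" and G: "is_graph G"
  consider "subgraph B G" "two_connected B" | e where "B = \<lparr>verts = e, edges = {e}\<rparr>" "e \<in> edges G"
    using B unfolding blocks_def bridge_def by blast
  then show ?thesis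
  proof cases
    case 1
    then show ?thesis using two_connectedD(1)[OF 1(2)] by (simp add: subgraph_def)
  next
    case 2
    then have "card e = 2" "e \<subseteq> verts G" using G by (auto simp: is_graph_def)
    moreover from this have "finite e" by (metis card.infinite zero_neq_numeral)
    ultimately show ?thesis using 2 by (simp add: is_graph_def)
  qed
qed

lemma blocks_one_sum_subset:
  assumes sum: "one_sum G G\<^sub>1 G\<^sub>2 v" and con: "connected_graph G"
  shows "blocks G\<^sub>1 \<subseteq> blocks G"
proof
  fix B assume "B \<in> blocks G\<^sub>1"
  then consider "subgraph B G\<^sub>1" "two_connected B" "\<forall>B'. subgraph B' G\<^sub>1 \<and> two_connected B' \<and> subgraph B B' \<longrightarrow> B' = B"
    | e where "B = \<lparr>verts = e, edges = {e}\<rparr>" "bridge G\<^sub>1 e"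
    unfolding blocks_def by blast
  then show "B \<in> blocks G"
  proof cases
    case 1
    have "subgraph B G" using 1(1) one_sum_subgraph[OF sum] unfolding subgraph_def by blast
    moreover have "B' = B" if B': "subgraph B' G" "two_connected B'" "subgraph B B'" for B'
    proof -
      have "\<not> subgraph B' G\<^sub>2"
      proof
        assume "subgraph B' G\<^sub>2"
        then have "verts B \<subseteq> {v}" using 1(1) B'(3) sum unfolding subgraph_def one_sum_def by blast
        then have "card (verts B) \<le> 1" using card_mono[of "{v}" "verts B"] by simp
        then show False using two_connectedD(1)[OF 1(2)] by simp
      qed
      then show ?thesis using two_connected_subgraph_one_sum[OF sum B'(1,2)] 1(3) B' by blast
    qed
    ultimately show ?thesis using 1(2) unfolding blocks_def by blast
  next
    case 2
    then have "bridge G e" using bridge_one_sum[OF sum con, of e] by (simp add: bridge_def)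
    then show ?thesis using 2(1) unfolding blocks_def by blast
  qed
qed

text \<open>
  Both 2-connected subgraphs and bridges live on one side of the cut vertex, and each block has at
  least two vertices, so no block belongs to both sides.
\<close>

lemma blocks_one_sum:
  assumes sum: "one_sum G G\<^sub>1 G\<^sub>2 v" and con: "connected_graph G"
  shows "blocks G = blocks G\<^sub>1 \<union> blocks G\<^sub>2" "blocks G\<^sub>1 \<inter> blocks G\<^sub>2 = {}"
proof -
  have side: "B \<in> blocks H" if B: "B \<in> blocks G" "subgraph B H" "one_sum G H K v" "two_connected B" for B H K
  proof -
    have nb: "\<not> (\<exists>e. B = \<lparr>verts = e, edges = {e}\<rparr> \<and> bridge G e)"
    proof
      assume "\<exists>e. B = \<lparr>verts = e, edges = {e}\<rparr> \<and> bridge G e"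
      then obtain e where "B = \<lparr>verts = e, edges = {e}\<rparr>" "e \<in> edges G" unfolding bridge_def by blast
      then have "card (verts B) = 2" using one_sum_graph(1)[OF sum] by (simp add: is_graph_def)
      then show False using two_connectedD(1)[OF B(4)] by simp
    qed
    have "subgraph B' G" if "subgraph B' H" for B'
      using that one_sum_subgraph[OF B(3)] unfolding subgraph_def by blast
    then show ?thesis using B nb unfolding blocks_def by blast
  qed
  have "B \<in> blocks G\<^sub>1 \<union> blocks G\<^sub>2" if B: "B \<in> blocks G" for B
  proof -
    consider "subgraph B G" "two_connected B" | e where "B = \<lparr>verts = e, edges = {e}\<rparr>" "bridge G e"
      using B unfolding blocks_def by blast
    then show ?thesis
    proof cases
      case 1
      then show ?thesis using two_connected_subgraph_one_sum[OF sum 1] side[OF B _ _ 1(2)] sum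
          one_sum_commute[OF sum] by blast
    next
      case 2
      then have "e \<in> edges G\<^sub>1 \<or> e \<in> edges G\<^sub>2" using sum unfolding bridge_def one_sum_def by blast
      then have "bridge G\<^sub>1 e \<or> bridge G\<^sub>2 e"
        using bridge_one_sum[OF sum con, of e] bridge_one_sum[OF one_sum_commute[OF sum] con, of e] 2(2) by blast
      then show ?thesis using 2(1) unfolding blocks_def by blast
    qed
  qed
  then show "blocks G = blocks G\<^sub>1 \<union> blocks G\<^sub>2"
    using blocks_one_sum_subset[OF sum con] blocks_one_sum_subset[OF one_sum_commute[OF sum] con] by blast
  show "blocks G\<^sub>1 \<inter> blocks G\<^sub>2 = {}"
  proof (rule ccontr)
    assume "blocks G\<^sub>1 \<inter> blocks G\<^sub>2 \<noteq> {}"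
    then obtain B where B: "B \<in> blocks G\<^sub>1" "B \<in> blocks G\<^sub>2" by blast
    then have "verts B \<subseteq> {v}" "2 \<le> card (verts B)"
      using block_card[OF B(1) one_sum_graph(2)[OF sum]] block_card[OF B(2) one_sum_graph(3)[OF sum]] sum
      unfolding one_sum_def by blast+
    then show False using card_mono[of "{v}" "verts B"] by simp
  qed
qed

lemma cut_vertex_one_sum:
  assumes G: "is_graph G" and con: "connected_graph G" and v: "v \<in> verts G"
    and ncon: "\<not> connected_graph (delete_vertex G v)" and n: "2 \<le> card (verts G)"
  obtains G\<^sub>1 G\<^sub>2 where "one_sum G G\<^sub>1 G\<^sub>2 v" "2 \<le> card (verts G\<^sub>1)" "2 \<le> card (verts G\<^sub>2)"
proof -
  let ?D = "delete_vertex G v"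
  have "verts ?D \<noteq> {}"
  proof
    assume "verts ?D = {}"
    then have "verts G \<subseteq> {v}" by (auto simp: verts_delete_vertex)
    then show False using card_mono[of "{v}" "verts G"] n by simp
  qed
  then obtain S where S: "separated ?D S"
    using ncon connected_iff_no_separation[OF is_graph_delete_vertex[OF G]] by blast
  let ?A = "insert v S" and ?B = "verts G - S"
  have sub: "?A \<subseteq> verts G" "?B \<subseteq> verts G" "v \<notin> S"
    using S v unfolding separated_def verts_delete_vertex by blast+
  have VA: "verts (induced G ?A) = ?A" "verts (induced G ?B) = ?B"
    using sub by (auto simp: induced_def)
  have side: "e \<subseteq> ?A \<or> e \<subseteq> ?B" if e: "e \<in> edges G" for e
  proof -
    obtain x y where xy: "e = {x, y}" "x \<in> verts G" "y \<in> verts G" using edge_in_graphE[OF G e] by metis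
    show ?thesis
    proof (rule ccontr)
      assume h: "\<not> ?thesis"
      then have "v \<notin> e" using xy sub(3) v by blast
      then have "{x, y} \<in> edges ?D" "{y, x} \<in> edges ?D" using e xy by (simp_all add: edges_delete_vertex[OF G] insert_commute)
      moreover have "(x \<in> S \<and> y \<in> verts ?D - S) \<or> (y \<in> S \<and> x \<in> verts ?D - S)"
        using h xy \<open>v \<notin> e\<close> unfolding verts_delete_vertex by blast
      ultimately show False using S unfolding separated_def by blast
    qed
  qed
  have "one_sum G (induced G ?A) (induced G ?B) v"
    unfolding one_sum_def VA
  proof (intro conjI is_graph_induced[OF G])
    show "verts G = ?A \<union> ?B" using sub by blast
    show "edges G = edges (induced G ?A) \<union> edges (induced G ?B)" unfolding edges_induced using side by blast
    show "?A \<inter> ?B = {v}" using sub v by blast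
  qed
  moreover have "2 \<le> card ?A"
  proof -
    obtain s where "s \<in> S" using S unfolding separated_def by blast
    then have "{v, s} \<subseteq> ?A" "v \<noteq> s" using sub by blast+
    moreover have "finite ?A" using sub(1) finite_verts[OF G] by (rule finite_subset)
    ultimately show ?thesis using card_mono[of ?A "{v, s}"] by simp
  qed
  moreover have "2 \<le> card ?B"
  proof -
    obtain s where "s \<in> verts ?D - S" using S unfolding separated_def by blast
    then have "{v, s} \<subseteq> ?B" "v \<noteq> s" using sub v unfolding verts_delete_vertex by blast+
    moreover have "finite ?B" using finite_verts[OF G] by simp
    ultimately show ?thesis using card_mono[of ?B "{v, s}"] by simp
  qed
  ultimately show ?thesis using that VA by metis
qed

text \<open>
  The excess of a graph whose blocks are 2-trees is the sum over the blocks, and it is attained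
  by no smaller connected minor.
\<close>

lemma two_tree_blocks_rigid:
  fixes G :: "'a graph"
  assumes "is_graph G" "connected_graph G" "2 \<le> card (verts G)" "finite (blocks G)"
    "\<And>B. B \<in> blocks G \<Longrightarrow> two_tree B \<and> 4 \<le> card (verts B)"
  shows "0 < (\<Sum>B\<in>blocks G. int (card (verts B)) - 3) \<and>
    excess G = (\<Sum>B\<in>blocks G. int (card (verts B)) - 3) \<and>
    rigid G (\<Sum>B\<in>blocks G. int (card (verts B)) - 3)"
  using assms
proof (induction "card (verts G)" arbitrary: G rule: less_induct)
  case less
  note G = less.prems(1) and con = less.prems(2)
  show ?case
  proof (cases "two_connected G")
    case True
    then have B: "blocks G = {G}" by (rule blocks_two_connected[OF G])
    then have "two_tree G" "4 \<le> card (verts G)" using less.prems(5) by auto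
    then show ?thesis unfolding B using two_tree_excess[of G] two_tree_rigid[of G] by simp
  next
    case False
    have "card (verts G) \<noteq> 2"
    proof
      assume n2: "card (verts G) = 2"
      then obtain a b where ab: "verts G = {a, b}" "a \<noteq> b" unfolding card_2_iff by blast
      have a: "{a} \<subseteq> verts G" "{a} \<noteq> {}" "{a} \<noteq> verts G" using ab by auto
      obtain x y where xy: "x \<in> {a}" "y \<in> verts G - {a}" "{x, y} \<in> edges G"
        by (rule connected_crossing[OF G con a])
      then have e: "{a, b} \<in> edges G" using ab by auto
      have "\<not> connected_graph (delete_edge G {a, b})"
      proof
        assume c: "connected_graph (delete_edge G {a, b})"
        have V: "verts (delete_edge G {a, b}) = verts G" by (simp add: delete_edge_def)
        obtain x y where "x \<in> {a}" "y \<in> verts G - {a}" "{x, y} \<in> edges (delete_edge G {a, b})"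
          by (rule connected_crossing[OF is_graph_delete_edge[OF G] c, unfolded V, OF a])
        then show False using ab by (auto simp: delete_edge_def)
      qed
      then have "bridge G {a, b}" using bridge_iff[OF G con] e by blast
      then have "\<lparr>verts = {a, b}, edges = {{a, b}}\<rparr> \<in> blocks G" unfolding blocks_def by blast
      then have "4 \<le> card {a, b}" using less.prems(5) by force
      then show False using ab(2) by simp
    qed
    then obtain v where v: "v \<in> verts G" "\<not> connected_graph (delete_vertex G v)"
      using False less.prems(3) con unfolding two_connected_def by force
    obtain G\<^sub>1 G\<^sub>2 where s: "one_sum G G\<^sub>1 G\<^sub>2 v" "2 \<le> card (verts G\<^sub>1)" "2 \<le> card (verts G\<^sub>2)"
      using cut_vertex_one_sum[OF G con v less.prems(3)] by blast
    note bl = blocks_one_sum[OF s(1) con]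
    have small: "card (verts G\<^sub>1) < card (verts G)" "card (verts G\<^sub>2) < card (verts G)"
      using card_one_sum(1)[OF s(1)] s(2,3) by linarith+
    have fin: "finite (blocks G\<^sub>1)" "finite (blocks G\<^sub>2)" using less.prems(4) unfolding bl(1) by auto
    have tt: "two_tree B \<and> 4 \<le> card (verts B)" if "B \<in> blocks G\<^sub>1 \<or> B \<in> blocks G\<^sub>2" for B
      using less.prems(5) that unfolding bl(1) by blast
    note IH1 = less.hyps[OF small(1) one_sum_graph(2)[OF s(1)] one_sum_connected_left[OF s(1) con] s(2) fin(1)]
    note IH2 = less.hyps[OF small(2) one_sum_graph(3)[OF s(1)] one_sum_connected_right[OF s(1) con] s(3) fin(2)]
    have 1: "0 < (\<Sum>B\<in>blocks G\<^sub>1. int (card (verts B)) - 3) \<and>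
      excess G\<^sub>1 = (\<Sum>B\<in>blocks G\<^sub>1. int (card (verts B)) - 3) \<and>
      rigid G\<^sub>1 (\<Sum>B\<in>blocks G\<^sub>1. int (card (verts B)) - 3)" by (rule IH1) (use tt in blast)
    have 2: "0 < (\<Sum>B\<in>blocks G\<^sub>2. int (card (verts B)) - 3) \<and>
      excess G\<^sub>2 = (\<Sum>B\<in>blocks G\<^sub>2. int (card (verts B)) - 3) \<and>
      rigid G\<^sub>2 (\<Sum>B\<in>blocks G\<^sub>2. int (card (verts B)) - 3)" by (rule IH2) (use tt in blast)
    have sum: "(\<Sum>B\<in>blocks G. int (card (verts B)) - 3) =
      (\<Sum>B\<in>blocks G\<^sub>1. int (card (verts B)) - 3) + (\<Sum>B\<in>blocks G\<^sub>2. int (card (verts B)) - 3)"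
      unfolding bl(1) by (rule sum.union_disjoint[OF fin bl(2)])
    show ?thesis unfolding sum using 1 2 excess_one_sum[OF s(1)] rigid_one_sum[OF s(1)] by simp
  qed
qed

text \<open>
  The two properties of the graphs in \<open>\<A>\<close> that matter for their classes: the excess is just large
  enough for density 3/2, and proper connected minors have smaller excess.
\<close>

definition tight :: "'a graph \<Rightarrow> bool" where
  "tight A \<longleftrightarrow> is_graph A \<and> connected_graph A \<and> excess A = 3 \<and> rigid A 3"

lemma tight_of_blocks:
  assumes "is_graph G" "connected_graph G" "finite (blocks G)" "blocks G \<noteq> {}"
    "\<And>B. B \<in> blocks G \<Longrightarrow> two_tree B \<and> 4 \<le> card (verts B)"
    "(\<Sum>B\<in>blocks G. int (card (verts B)) - 3) = 3"
  shows "tight G"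
proof -
  obtain B where B: "B \<in> blocks G" using assms(4) by blast
  have "card (verts B) \<le> card (verts G)"
    using block_card[OF B assms(1)] card_mono[OF finite_verts[OF assms(1)]] by blast
  then have "2 \<le> card (verts G)" using assms(5)[OF B] by linarith
  then show ?thesis using two_tree_blocks_rigid[OF assms(1,2) _ assms(3,5)] assms(1,2,6)
    unfolding tight_def by simp
qed

lemma tight_\<A>:
  assumes "A \<in> \<A>"
  shows "tight A"
proof -
  consider "A \<in> \<A>\<^sub>4" | "A \<in> \<A>\<^sub>6" | "A \<in> \<A>\<^sub>8" | "A \<in> \<A>\<^sub>1\<^sub>0" using assms unfolding \<A>_def by blast
  then show ?thesis
  proof cases
    case 1
    then have A: "is_graph A" and iso: "A \<cong>\<^sub>g complete_graph 4" by (auto simp: \<A>\<^sub>4_def)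
    note n = isomorphic_completeD(1)[OF A iso] and all = isomorphic_completeD(2)[OF A iso]
    have "card (edges A) = 6" using card_edges_clique[OF A all] n choose_two_small by simp
    moreover have "connected_graph A"
    proof -
      have "verts A \<noteq> {}" using n by auto
      then show ?thesis
        using connected_set_clique[OF A subset_refl _ all] connected_set_verts[OF A] by blast
    qed
    ultimately show ?thesis using n A rigid_four_vertices[OF A n] by (simp add: tight_def excess_def)
  next
    case 2
    then have "two_tree A" "card (verts A) = 6" by (auto simp: \<A>\<^sub>6_def)
    then show ?thesis using two_tree_graph[of A] two_tree_connected[of A] two_tree_excess[of A]
        two_tree_rigid[of A] by (simp add: tight_def)
  next
    case 3
    then obtain B\<^sub>1 B\<^sub>2 where "is_graph A" "connected_graph A" "B\<^sub>1 \<noteq> B\<^sub>2" "blocks A = {B\<^sub>1, B\<^sub>2}"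
      "two_tree B\<^sub>1" "card (verts B\<^sub>1) = 5" "two_tree B\<^sub>2" "card (verts B\<^sub>2) = 4" 
      unfolding \<A>\<^sub>8_def by blast
    then show ?thesis by (intro tight_of_blocks) auto
  next
    case 4
    then have A: "is_graph A" "connected_graph A" "card (blocks A) = 3"
      "\<forall>B\<in>blocks A. two_tree B \<and> card (verts B) = 4" unfolding \<A>\<^sub>1\<^sub>0_def by auto
    have "finite (blocks A)" using A(3) by (metis card.infinite zero_neq_numeral)
    moreover have "blocks A \<noteq> {}" using A(3) by force
    ultimately show ?thesis using A by (intro tight_of_blocks) auto
  qed
qed

section \<open>Rooted triangles in 2-trees\<close>

definition touching :: "'a graph \<Rightarrow> 'a set \<Rightarrow> 'a set \<Rightarrow> bool" where
  "touching G X Y \<longleftrightarrow> (\<exists>x\<in>X. \<exists>y\<in>Y. {x, y} \<in> edges G)"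

lemma touching_sym: "touching G X Y \<Longrightarrow> touching G Y X"
  unfolding touching_def by (metis insert_commute)

lemma touchingI: "x \<in> X \<Longrightarrow> y \<in> Y \<Longrightarrow> {x, y} \<in> edges G \<Longrightarrow> touching G X Y"
  unfolding touching_def by blast

lemma touching_mono: "touching T X Y \<Longrightarrow> edges T \<subseteq> edges G \<Longrightarrow> X \<subseteq> X' \<Longrightarrow> Y \<subseteq> Y' \<Longrightarrow> touching G X' Y'"
  unfolding touching_def by blast

lemma connected_set_subgraph:
  assumes "subgraph T G" "is_graph G" "U \<subseteq> verts T" "connected_set T U"
  shows "connected_set G U"
proof (rule connected_supergraph[OF assms(4)])
  show "is_graph (induced T U)" "is_graph (induced G U)"
    using assms is_graph_induced by (auto simp: subgraph_def)
  show "verts (induced T U) = verts (induced G U)" "edges (induced T U) \<subseteq> edges (induced G U)"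
    using assms(1,3) by (auto simp: subgraph_def induced_def)
qed

lemma complete_4_minorI:
  assumes G: "is_graph G" and sub: "A \<subseteq> verts G" "B \<subseteq> verts G" "C \<subseteq> verts G" "D \<subseteq> verts G"
    and con: "connected_set G A" "connected_set G B" "connected_set G C" "connected_set G D"
    and disj: "A \<inter> B = {}" "A \<inter> C = {}" "A \<inter> D = {}" "B \<inter> C = {}" "B \<inter> D = {}" "C \<inter> D = {}"
    and adj: "touching G A B" "touching G A C" "touching G A D" "touching G B C" "touching G B D" "touching G C D"
  shows "minor (complete_graph 4) G"
proof -
  define \<mu> where "\<mu> i = (if i = 0 then A else if i = 1 then B else if i = 2 then C else D)" for i :: nat
  have V: "u = 0 \<or> u = 1 \<or> u = 2 \<or> u = 3" if "u \<in> verts (complete_graph 4)" for u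
    using that by (auto simp: verts_complete)
  have m: "\<mu> 0 = A" "\<mu> 1 = B" "\<mu> (Suc 0) = B" "\<mu> 2 = C" "\<mu> 3 = D" by (auto simp: \<mu>_def)
  have "model (complete_graph 4) G \<mu>"
  proof (rule modelI)
    fix u :: nat assume u: "u \<in> verts (complete_graph 4)"
    show "\<mu> u \<subseteq> verts G" "connected_set G (\<mu> u)" using V[OF u] sub con m by auto
  next
    fix u w :: nat assume uw: "u \<in> verts (complete_graph 4)" "w \<in> verts (complete_graph 4)" "u \<noteq> w"
    have "B \<inter> A = {}" "C \<inter> A = {}" "D \<inter> A = {}" "C \<inter> B = {}" "D \<inter> B = {}" "D \<inter> C = {}"
      using disj by blast+
    then show "\<mu> u \<inter> \<mu> w = {}" using V[OF uw(1)] V[OF uw(2)] uw(3) disj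
      by (elim disjE) (simp_all add: m)
  next
    fix u w :: nat assume e: "{u, w} \<in> edges (complete_graph 4)"
    then have uw: "u \<in> verts (complete_graph 4)" "w \<in> verts (complete_graph 4)" "u \<noteq> w"
      by (auto simp: complete_graph_def card_insert_if split: if_splits)
    have "touching G (\<mu> u) (\<mu> w)"
      using V[OF uw(1)] V[OF uw(2)] uw(3) adj adj[THEN touching_sym] by (elim disjE) (simp_all add: m)
    then show "\<exists>x\<in>\<mu> u. \<exists>y\<in>\<mu> w. {x, y} \<in> edges G" unfolding touching_def .
  qed
  then show ?thesis unfolding minor_iff_model by blast
qed

definition rooted_triangle :: "'a graph \<Rightarrow> 'a \<Rightarrow> 'a \<Rightarrow> 'a \<Rightarrow> bool" where
  "rooted_triangle T a b c \<longleftrightarrow> (\<exists>A B C. a \<in> A \<and> b \<in> B \<and> c \<in> C \<and>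
     A \<subseteq> verts T \<and> B \<subseteq> verts T \<and> C \<subseteq> verts T \<and>
     connected_set T A \<and> connected_set T B \<and> connected_set T C \<and>
     A \<inter> B = {} \<and> A \<inter> C = {} \<and> B \<inter> C = {} \<and>
     touching T A B \<and> touching T A C \<and> touching T B C)"

lemma rooted_triangleI:
  assumes "a \<in> A" "b \<in> B" "c \<in> C" "A \<subseteq> verts T" "B \<subseteq> verts T" "C \<subseteq> verts T"
    "connected_set T A" "connected_set T B" "connected_set T C"
    "A \<inter> B = {}" "A \<inter> C = {}" "B \<inter> C = {}" "touching T A B" "touching T A C" "touching T B C"
  shows "rooted_triangle T a b c"
  unfolding rooted_triangle_def using assms by (intro exI[of _ A] exI[of _ B] exI[of _ C] conjI)

lemma rooted_triangleE:
  assumes "rooted_triangle T a b c"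
  obtains A B C where "a \<in> A" "b \<in> B" "c \<in> C" "A \<subseteq> verts T" "B \<subseteq> verts T" "C \<subseteq> verts T"
    "connected_set T A" "connected_set T B" "connected_set T C"
    "A \<inter> B = {}" "A \<inter> C = {}" "B \<inter> C = {}" "touching T A B" "touching T A C" "touching T B C"
  using assms unfolding rooted_triangle_def by (elim exE conjE) rule

lemma rooted_triangle_swap:
  assumes "rooted_triangle T a b c"
  shows "rooted_triangle T b a c"
  using assms
proof (rule rooted_triangleE)
  fix A B C assume h: "a \<in> A" "b \<in> B" "c \<in> C" "A \<subseteq> verts T" "B \<subseteq> verts T" "C \<subseteq> verts T"
    "connected_set T A" "connected_set T B" "connected_set T C"
    "A \<inter> B = {}" "A \<inter> C = {}" "B \<inter> C = {}" "touching T A B" "touching T A C" "touching T B C"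
  have "B \<inter> A = {}" using h(10) by blast
  then show ?thesis
    by (rule rooted_triangleI[OF h(2,1,3,5,4,6,8,7,9) _ h(12,11) touching_sym[OF h(13)] h(15,14)])
qed

lemma rooted_triangle_rotate:
  assumes "rooted_triangle T a b c"
  shows "rooted_triangle T b c a"
  using assms
proof (rule rooted_triangleE)
  fix A B C assume h: "a \<in> A" "b \<in> B" "c \<in> C" "A \<subseteq> verts T" "B \<subseteq> verts T" "C \<subseteq> verts T"
    "connected_set T A" "connected_set T B" "connected_set T C"
    "A \<inter> B = {}" "A \<inter> C = {}" "B \<inter> C = {}" "touching T A B" "touching T A C" "touching T B C"
  have "B \<inter> A = {}" "C \<inter> A = {}" using h(10,11) by blast+
  then show ?thesis
    by (rule rooted_triangleI[OF h(2,3,1,5,6,4,8,9,7,12) _ _ h(15) touching_sym[OF h(13)] touching_sym[OF h(14)]])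
qed

lemma rooted_triangle_clique:
  assumes T: "is_graph T" and abc: "{a, b} \<in> edges T" "{a, c} \<in> edges T" "{b, c} \<in> edges T"
  shows "rooted_triangle T a b c"
  by (rule rooted_triangleI[of a "{a}" b "{b}" c "{c}"])
    (use edge_in_graphD[OF T abc(1)] edge_in_graphD[OF T abc(2)] edge_in_graphD[OF T abc(3)] abc
      connected_set_singleton[OF T] in \<open>auto simp: touching_def\<close>)

text \<open>
  If the last vertex of the 2-tree is a root, then one of its two neighbours can replace it as a
  root, and its branch set absorbs the vertex; the exception is that the neighbours are the
  other two roots, and then all three roots are adjacent.
\<close>

lemma two_tree_rooted_triangle:
  assumes "two_tree T" "a \<in> verts T" "b \<in> verts T" "c \<in> verts T" "a \<noteq> b" "a \<noteq> c" "b \<noteq> c"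
  shows "rooted_triangle T a b c"
  using assms
proof (induction arbitrary: a b c rule: two_tree_induct)
  case (triangle T)
  then show ?case by (intro rooted_triangle_clique) auto
next
  case (extend T v p q)
  note T = extend(1)
  let ?D = "delete_vertex T v"
  note pq = simplicial2_distinct[OF T extend(3)]
  have lift: "connected_set T U" if "U \<subseteq> verts ?D" "connected_set ?D U" for U
    using connected_set_subgraph[OF subgraph_delete_vertex[OF T] T that] .
  have ED: "edges ?D \<subseteq> edges T" using edges_delete_vertex[OF T] by auto
  have root_v: "rooted_triangle T v b c"
    if bc: "b \<in> verts T" "c \<in> verts T" "b \<noteq> v" "c \<noteq> v" "b \<noteq> c" for b c
  proof (cases "{b, c} = {p, q}")
    case True
    then have "{v, b} \<in> edges T" "{v, c} \<in> edges T" "{b, c} \<in> edges T"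
      using extend(3) by (auto simp: simplicial2_def nbrs_def)
    then show ?thesis by (rule rooted_triangle_clique[OF T])
  next
    case False
    then obtain r where r: "r \<in> {p, q}" "r \<noteq> b" "r \<noteq> c" using bc(5) pq(1) by blast
    have vr: "{v, r} \<in> edges T" using r(1) extend(3) by (auto simp: simplicial2_def nbrs_def)
    have "r \<in> verts ?D" "b \<in> verts ?D" "c \<in> verts ?D" using r(1) pq bc by (auto simp: verts_delete_vertex)
    then have "rooted_triangle ?D r b c" using extend.IH r bc(5) by blast
    then show ?thesis
    proof (rule rooted_triangleE)
      fix A B C assume h: "r \<in> A" "b \<in> B" "c \<in> C" "A \<subseteq> verts ?D" "B \<subseteq> verts ?D" "C \<subseteq> verts ?D"
        "connected_set ?D A" "connected_set ?D B" "connected_set ?D C"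
        "A \<inter> B = {}" "A \<inter> C = {}" "B \<inter> C = {}" "touching ?D A B" "touching ?D A C" "touching ?D B C"
      have sub: "A \<subseteq> verts T" "B \<subseteq> verts T" "C \<subseteq> verts T" "v \<notin> A" "v \<notin> B" "v \<notin> C"
        using h(4-6) by (auto simp: verts_delete_vertex)
      have v: "v \<in> verts T" using extend(3) by (simp add: simplicial2_def)
      have "connected_set T ({v} \<union> A)"
        using connected_set_union[OF T connected_set_singleton[OF T v] _ lift[OF h(4,7)] sub(1)] v vr h(1) by blast
      moreover have "v \<in> {v} \<union> A" "{v} \<union> A \<subseteq> verts T" "({v} \<union> A) \<inter> B = {}" "({v} \<union> A) \<inter> C = {}"
        using sub v h(10,11) by auto
      moreover have "touching T ({v} \<union> A) B" "touching T ({v} \<union> A) C" "touching T B C"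
        using touching_mono[OF h(13) ED Un_upper2 subset_refl] touching_mono[OF h(14) ED Un_upper2 subset_refl]
          touching_mono[OF h(15) ED subset_refl subset_refl] by blast+
      ultimately show ?thesis
        using rooted_triangleI[of v "{v} \<union> A" b B c C T] h(2,3) sub(2,3) lift[OF h(5,8)] lift[OF h(6,9)] h(12)
        by simp
    qed
  qed
  consider "a = v" | "b = v" | "c = v" | "a \<noteq> v" "b \<noteq> v" "c \<noteq> v" by blast
  then show ?case
  proof cases
    case 1
    then show ?thesis using root_v[of b c] extend.prems by blast
  next
    case 2
    then show ?thesis using root_v[of a c] extend.prems rooted_triangle_swap by metis
  next
    case 3
    then show ?thesis using root_v[of a b] extend.prems rooted_triangle_rotate by metis
  next
    case 4
    then have "rooted_triangle ?D a b c" using extend.IH extend.prems by (simp add: verts_delete_vertex)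
    then show ?thesis
    proof (rule rooted_triangleE)
      fix A B C assume h: "a \<in> A" "b \<in> B" "c \<in> C" "A \<subseteq> verts ?D" "B \<subseteq> verts ?D" "C \<subseteq> verts ?D"
        "connected_set ?D A" "connected_set ?D B" "connected_set ?D C"
        "A \<inter> B = {}" "A \<inter> C = {}" "B \<inter> C = {}" "touching ?D A B" "touching ?D A C" "touching ?D B C"
      have "A \<subseteq> verts T" "B \<subseteq> verts T" "C \<subseteq> verts T" using h(4-6) by (auto simp: verts_delete_vertex)
      moreover have "touching T A B" "touching T A C" "touching T B C"
        using touching_mono[OF _ ED subset_refl subset_refl] h(13-15) by blast+
      ultimately show ?thesis
        using rooted_triangleI[of a A b B c C T] h(1-3,10-12) lift[OF h(4,7)] lift[OF h(5,8)] lift[OF h(6,9)]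
        by simp
    qed
  qed
qed

text \<open>
  Joining two non-adjacent vertices of a 2-tree by a connected set outside it creates a minor
  isomorphic to the complete graph on four vertices: the later of the two in the construction of
  the 2-tree was attached to two adjacent vertices, which together with the earlier one
  are the roots of a triangle.
\<close>

lemma joined_nonadjacent_complete_4:
  assumes G: "is_graph G" and T: "two_tree T"
    and "subgraph T G" "X \<subseteq> verts G" "connected_set G X" "X \<inter> verts T = {x}" "y \<in> verts T" "x \<noteq> y"
    "{x, y} \<notin> edges T" "w \<in> X" "{w, y} \<in> edges G"
  shows "minor (complete_graph 4) G"
  using T assms(3-)
proof (induction rule: two_tree_induct)
  case (triangle T)
  then have "{x, y} \<in> edges T" by blast
  then show ?case using triangle by blast
next
  case (extend T v a b)
  note T = extend.hyps(1) and sub = \<open>subgraph T G\<close> and X = \<open>X \<subseteq> verts G\<close> \<open>connected_set G X\<close> \<open>X \<inter> verts T = {x}\<close>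
    and y = \<open>y \<in> verts T\<close> \<open>x \<noteq> y\<close> \<open>{x, y} \<notin> edges T\<close> and w = \<open>w \<in> X\<close> \<open>{w, y} \<in> edges G\<close>
  let ?D = "delete_vertex T v"
  note ab = simplicial2_distinct[OF T extend.hyps(3)]
  have va: "{v, a} \<in> edges T" "{v, b} \<in> edges T" and v: "v \<in> verts T"
    using extend.hyps(3) by (auto simp: simplicial2_def nbrs_def)
  have subT: "verts T \<subseteq> verts G" "edges T \<subseteq> edges G" using sub by (auto simp: subgraph_def)
  have subD: "subgraph ?D G" "edges ?D \<subseteq> edges G" "verts ?D \<subseteq> verts G"
    using subT subgraph_delete_vertex[OF T, of v] by (auto simp: subgraph_def)
  have x: "x \<in> verts T" "x \<in> X" using X(3) by blast+
  consider "x \<noteq> v" "y \<noteq> v" | "x = v" | "y = v" by blast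
  then show ?case
  proof cases
    case 1
    have "X \<inter> verts ?D = {x}" "y \<in> verts ?D" using X(3) x y 1 by (auto simp: verts_delete_vertex)
    moreover have "{x, y} \<notin> edges ?D" using y(3) by (simp add: edges_delete_vertex[OF T])
    ultimately show ?thesis using extend.IH subD(1) X y w by blast
  next
    case 2
    have "a \<noteq> y" "b \<noteq> y" using va y(3) 2 by blast+
    moreover have "y \<in> verts ?D" "a \<in> verts ?D" "b \<in> verts ?D"
      using y 2 ab by (auto simp: verts_delete_vertex)
    ultimately have "rooted_triangle ?D a b y" using two_tree_rooted_triangle[OF extend.hyps(4)] ab(1) by blast
    then show ?thesis
    proof (rule rooted_triangleE)
      fix A B C assume h: "a \<in> A" "b \<in> B" "y \<in> C" "A \<subseteq> verts ?D" "B \<subseteq> verts ?D" "C \<subseteq> verts ?D"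
        "connected_set ?D A" "connected_set ?D B" "connected_set ?D C"
        "A \<inter> B = {}" "A \<inter> C = {}" "B \<inter> C = {}" "touching ?D A B" "touching ?D A C" "touching ?D B C"
      have out: "Z \<inter> X = {}" if "Z \<subseteq> verts ?D" for Z
        using that X(3) 2 by (auto simp: verts_delete_vertex)
      have xA: "touching G X A" "touching G X B" "touching G X C"
        using touchingI[OF x(2) h(1), of G] touchingI[OF x(2) h(2), of G] touchingI[OF w(1) h(3) w(2)]
          va subT 2 by auto
      have t: "touching G A B" "touching G A C" "touching G B C"
        using h(13-15) touching_mono[OF _ subD(2) subset_refl subset_refl] by blast+
      have c: "connected_set G A" "connected_set G B" "connected_set G C"
        using connected_set_subgraph[OF subD(1) G] h(4-9) by blast+
      show ?thesis
        by (rule complete_4_minorI[OF G _ _ _ X(1) c X(2) h(10,11) out[OF h(4)] h(12) out[OF h(5)] out[OF h(6)]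
              t(1,2) xA(1)[THEN touching_sym] t(3) xA(2)[THEN touching_sym] xA(3)[THEN touching_sym]])
          (use h(4-6) subD(3) in blast)+
    qed
  next
    case 3
    have e: "{v, x} \<notin> edges T" using y(3) 3 by (simp add: insert_commute)
    have "a \<noteq> x" "b \<noteq> x" using va e by blast+
    moreover have "x \<in> verts ?D" "a \<in> verts ?D" "b \<in> verts ?D"
      using x y 3 ab by (auto simp: verts_delete_vertex)
    ultimately have "rooted_triangle ?D a b x" using two_tree_rooted_triangle[OF extend.hyps(4)] ab(1) by blast
    then show ?thesis
    proof (rule rooted_triangleE)
      fix A B C assume h: "a \<in> A" "b \<in> B" "x \<in> C" "A \<subseteq> verts ?D" "B \<subseteq> verts ?D" "C \<subseteq> verts ?D"
        "connected_set ?D A" "connected_set ?D B" "connected_set ?D C"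
        "A \<inter> B = {}" "A \<inter> C = {}" "B \<inter> C = {}" "touching ?D A B" "touching ?D A C" "touching ?D B C"
      have VD: "verts ?D \<subseteq> verts T" "v \<notin> verts ?D" by (auto simp: verts_delete_vertex)
      have out: "Z \<inter> (C \<union> X) = {}" if "Z \<subseteq> verts ?D" "Z \<inter> C = {}" for Z
      proof -
        have "Z \<inter> X \<subseteq> {x}" using that(1) X(3) VD(1) by blast
        then show ?thesis using that(2) h(3) by blast
      qed
      have "v \<notin> X"
      proof
        assume "v \<in> X"
        then have "v \<in> X \<inter> verts T" using v by simp
        then show False using X(3) y(2) 3 by simp
      qed
      then have outv: "{v} \<inter> A = {}" "{v} \<inter> B = {}" "{v} \<inter> (C \<union> X) = {}" using h(4-6) VD by blast+
      have tv: "touching G {v} A" "touching G {v} B" "touching G {v} (C \<union> X)"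
        using touchingI[of v "{v}" a A G] touchingI[of v "{v}" b B G] touchingI[of v "{v}" w "C \<union> X" G]
          h(1,2) w va subT 3 by (auto simp: insert_commute)
      have t: "touching G A B" "touching G A (C \<union> X)" "touching G B (C \<union> X)"
        using h(13-15) touching_mono[OF _ subD(2)] by (metis Un_upper1 subset_refl)+
      have c: "connected_set G A" "connected_set G B" "connected_set G C"
        using connected_set_subgraph[OF subD(1) G] h(4-9) by blast+
      have cX: "connected_set G (C \<union> X)"
        using connected_set_union[OF G c(3) _ X(2,1)] h(3,6) x(2) subD(3) by blast
      have vG: "v \<in> verts G" using v subT by blast
      show ?thesis
        by (rule complete_4_minorI[OF G _ _ _ _ connected_set_singleton[OF G vG] c(1,2) cX
              outv h(10) out[OF h(4,11)] out[OF h(5,12)] tv t])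
          (use h(4-6) subD(3) vG X(1) in blast)+
    qed
  qed
qed

section \<open>Minimal dense connected graphs\<close>

lemma isomorphic_connected:
  assumes "H \<cong>\<^sub>g K" and H: "is_graph H" and K: "is_graph K" and con: "connected_graph H"
  shows "connected_graph K"
proof -
  obtain f where f: "bij_betw f (verts H) (verts K)" "edges K = (\<lambda>e. f ` e) ` edges H"
    using assms(1) unfolding isomorphic_def by blast
  have onto: "f ` verts H = verts K" using f(1) by (simp add: bij_betw_def)
  show ?thesis
  proof (rule connectedI[OF K])
    show "verts K \<noteq> {}" using connected_nonempty[OF con] onto by blast
    fix S assume S: "S \<subseteq> verts K" "S \<noteq> {}" "S \<noteq> verts K"
    let ?S = "{u \<in> verts H. f u \<in> S}"
    obtain a b where "a \<in> S" "b \<in> verts K" "b \<notin> S" using S by blast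
    moreover from this have "a \<in> f ` verts H" "b \<in> f ` verts H" using onto S(1) by auto
    ultimately have s: "?S \<subseteq> verts H" "?S \<noteq> {}" "?S \<noteq> verts H" by auto
    obtain x y where xy: "x \<in> ?S" "y \<in> verts H - ?S" "{x, y} \<in> edges H"
      by (rule connected_crossing[OF H con s])
    then have "f ` {x, y} \<in> edges K" unfolding f(2) by blast
    then have "{f x, f y} \<in> edges K" by simp
    moreover have "f x \<in> S" "f y \<in> verts K - S" using xy(1,2) onto by auto
    ultimately show "\<exists>x\<in>S. \<exists>y\<in>verts K - S. {x, y} \<in> edges K" by blast
  qed
qed

definition dense :: "'a graph \<Rightarrow> bool" where
  "dense G \<longleftrightarrow> 3 * card (verts G) \<le> 2 * card (edges G)"

text \<open>
  Minimality refers to the sum of the numbers of vertices and edges; as both are monotone under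
  minors, a dense connected minor of a minimal graph agrees with it in both.
\<close>

definition minimal_dense :: "nat graph \<Rightarrow> bool" where
  "minimal_dense G \<longleftrightarrow> is_graph G \<and> connected_graph G \<and> dense G \<and>
     (\<forall>H :: nat graph. is_graph H \<and> connected_graph H \<and> dense H \<and> minor H G \<longrightarrow>
        card (verts G) + card (edges G) \<le> card (verts H) + card (edges H))"

lemma minimal_dense_minor:
  fixes G :: "nat graph"
  assumes "is_graph G" "connected_graph G" "dense G"
  obtains H where "minimal_dense H" "minor H G" "verts H = {..<card (verts H)}"
proof -
  let ?P = "\<lambda>H :: nat graph. is_graph H \<and> connected_graph H \<and> dense H \<and> minor H G"
  obtain H where H: "?P H" "\<And>K. ?P K \<Longrightarrow> card (verts H) + card (edges H) \<le> card (verts K) + card (edges K)"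
    using ex_has_least_nat[of ?P G "\<lambda>H. card (verts H) + card (edges H)"] assms minor_refl by blast
  obtain K :: "nat graph" where K: "is_graph K" "minor K H" "minor H K" "verts K = {..<card (verts H)}"
    "card (edges K) = card (edges H)" "H \<cong>\<^sub>g K"
    using nat_copy[of H] H(1) by blast
  have "connected_graph K" using isomorphic_connected[OF K(6) _ K(1)] H(1) by blast
  moreover have "dense K" using H(1) K(4,5) by (simp add: dense_def)
  moreover have "card (verts K) + card (edges K) = card (verts H) + card (edges H)" using K(4,5) by simp
  moreover have "minor L H" if "minor L K" "is_graph L" for L :: "nat graph"
    using minor_trans[OF that(1) K(2) K(1) _ that(2)] H(1) by blast
  moreover have "minor L G" if "minor L H" "is_graph L" for L :: "nat graph"
    using minor_trans[OF that(1) _ _ assms(1) that(2)] H(1) by blast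
  ultimately have "minimal_dense K" unfolding minimal_dense_def using K(1) H(2) by (metis (no_types))
  moreover have "minor K G" using minor_trans[OF K(2) _ _ assms(1) K(1)] H(1) by blast
  ultimately show ?thesis using that K(4) by simp
qed

context
  fixes G :: "nat graph"
  assumes minimal: "minimal_dense G"
begin

lemma minimal_dense_graph: "is_graph G" and minimal_dense_connected: "connected_graph G" and minimal_dense_dense: "dense G"
  using minimal by (simp_all add: minimal_dense_def)

lemma dense_minor_same_size:
  fixes H :: "nat graph"
  assumes "is_graph H" "connected_graph H" "dense H" "minor H G"
  shows "card (verts H) = card (verts G)" "card (edges H) = card (edges G)"
proof -
  have "\<forall>H :: nat graph. is_graph H \<and> connected_graph H \<and> dense H \<and> minor H G \<longrightarrow>
      card (verts G) + card (edges G) \<le> card (verts H) + card (edges H)"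
    using minimal by (simp add: minimal_dense_def)
  then have "card (verts G) + card (edges G) \<le> card (verts H) + card (edges H)"
    using assms by simp
  then show "card (verts H) = card (verts G)" "card (edges H) = card (edges G)"
    using minor_card_le[OF assms(4,1) minimal_dense_graph] by linarith+
qed

lemma dense_subgraph_eq:
  assumes "subgraph H G" "connected_graph H" "dense H"
  shows "H = G"
proof -
  have "is_graph H" using assms(1) by (simp add: subgraph_def)
  then show ?thesis
    using dense_minor_same_size[OF _ assms(2,3) subgraph_minor[OF minimal_dense_graph assms(1)]]
      subgraph_same_size[OF assms(1) minimal_dense_graph] by simp
qed

text \<open>
  Contracting an edge in no triangle loses one vertex and one edge only, and the result would still
  be dense.
\<close>

lemma edge_in_triangle:
  assumes xy: "{x, y} \<in> edges G"
  shows "nbrs G x \<inter> nbrs G y \<noteq> {}"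
proof
  assume no: "nbrs G x \<inter> nbrs G y = {}"
  note c = card_verts_contract[OF minimal_dense_graph xy] card_edges_contract[OF minimal_dense_graph xy, unfolded no]
  have "dense (contract G x y)" using c minimal_dense_dense unfolding dense_def by simp
  then have "card (verts (contract G x y)) = card (verts G)"
    using dense_minor_same_size[OF is_graph_contract[OF minimal_dense_graph xy] connected_contract[OF minimal_dense_graph xy minimal_dense_connected]
        _ contract_minor[OF minimal_dense_graph xy]] by blast
  then show False using c(1) by simp
qed

text \<open>
  Otherwise contracting the whole triangle to a vertex would lose two vertices and three edges.
\<close>

lemma triangle_has_neighbour_triangle:
  assumes xy: "{x, y} \<in> edges G" and xz: "{x, z} \<in> edges G" and yz: "{y, z} \<in> edges G"
  shows "\<exists>u. u \<notin> {x, y, z} \<and> (u \<in> nbrs G x \<inter> nbrs G y \<or> u \<in> nbrs G x \<inter> nbrs G z \<or> u \<in> nbrs G y \<inter> nbrs G z)"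
proof (rule ccontr)
  assume no: "\<not> ?thesis"
  note G = minimal_dense_graph
  note d = edge_in_graphD[OF G xy] edge_in_graphD[OF G xz] edge_in_graphD[OF G yz]
  have irr: "u \<notin> nbrs G u" for u by (rule nbrs_irrefl[OF G])
  have z: "z \<in> nbrs G x" "z \<in> nbrs G y" using xz yz by (auto simp: nbrs_def)
  have none: "u \<in> {x, y, z}"
    if "u \<in> nbrs G x \<inter> nbrs G y \<or> u \<in> nbrs G x \<inter> nbrs G z \<or> u \<in> nbrs G y \<inter> nbrs G z" for u
    using no that by metis
  have "u = z" if u: "u \<in> nbrs G x \<inter> nbrs G y" for u
  proof -
    have "u \<noteq> x" "u \<noteq> y" using u irr by auto
    then show ?thesis using none[of u] u by blast
  qed
  then have "nbrs G x \<inter> nbrs G y = {z}" using z by blast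
  then have c: "card (verts (contract G x y)) + 1 = card (verts G)"
    "card (edges (contract G x y)) + 2 = card (edges G)"
    using card_verts_contract[OF G xy] card_edges_contract[OF G xy] by auto
  let ?H = "contract G x y"
  have H: "is_graph ?H" "connected_graph ?H"
    using is_graph_contract[OF G xy] connected_contract[OF G xy minimal_dense_connected] .
  have xzH: "{x, z} \<in> edges ?H" using xz d unfolding contract_def by simp
  have "nbrs ?H x = nbrs G x \<union> nbrs G y - {x, y}"
    using nbrs_contract[OF G xy, of x] d by simp
  moreover have "nbrs ?H z \<subseteq> insert x (nbrs G z)"
    using nbrs_contract[OF G xy, of z] d by (auto split: if_splits)
  moreover have False if u: "u \<in> nbrs G x \<union> nbrs G y - {x, y}" "u \<in> insert x (nbrs G z)" for u
  proof -
    have "u \<in> nbrs G z" "u \<noteq> x" "u \<noteq> y" "u \<noteq> z" using u irr[of z] by auto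
    then show False using none[of u] u(1) by blast
  qed
  ultimately have "nbrs ?H x \<inter> nbrs ?H z = {}" by blast
  then have c': "card (verts (contract ?H x z)) + 1 = card (verts ?H)"
    "card (edges (contract ?H x z)) + 1 = card (edges ?H)"
    using card_verts_contract[OF H(1) xzH] card_edges_contract[OF H(1) xzH] by auto
  have "dense (contract ?H x z)" using c c' minimal_dense_dense unfolding dense_def by simp
  moreover have "minor (contract ?H x z) G"
    using minor_trans[OF contract_minor[OF H(1) xzH] contract_minor[OF G xy] H(1) G is_graph_contract[OF H(1) xzH]] .
  ultimately have "card (verts (contract ?H x z)) = card (verts G)"
    using dense_minor_same_size(1)[OF is_graph_contract[OF H(1) xzH] connected_contract[OF H(1) xzH H(2)]] by blast
  then show False using c c' by simp
qed

text \<open>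
  An edge of a triangle can be deleted without disconnecting the graph.
\<close>

lemma edges_nearly_tight: "2 * card (edges G) \<le> 3 * card (verts G) + 1"
proof (rule ccontr)
  assume no: "\<not> ?thesis"
  then have "edges G \<noteq> {}" by auto
  then obtain x y where xy: "{x, y} \<in> edges G" using edge_in_graphE[OF minimal_dense_graph] by (metis ex_in_conv)
  obtain z where z: "z \<in> nbrs G x \<inter> nbrs G y" using edge_in_triangle[OF xy] by blast
  let ?D = "delete_edge G {x, y}"
  have V: "verts ?D = verts G" by (simp add: delete_edge_def)
  have D: "is_graph ?D" by (rule is_graph_delete_edge[OF minimal_dense_graph])
  have zz: "z \<noteq> x" "z \<noteq> y" "z \<in> verts G" "{x, z} \<in> edges G" "{y, z} \<in> edges G"
    using z nbrs_irrefl[OF minimal_dense_graph] nbrs_subset[OF minimal_dense_graph, of x] by (auto simp: nbrs_def)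
  have e: "{x, z} \<in> edges ?D" "{y, z} \<in> edges ?D" "{z, x} \<in> edges ?D" "{z, y} \<in> edges ?D"
    using zz by (auto simp: delete_edge_def doubleton_eq_iff insert_commute)
  have "connected_graph ?D"
  proof (rule connectedI[OF D])
    show "verts ?D \<noteq> {}" using V zz by auto
    fix S assume S: "S \<subseteq> verts ?D" "S \<noteq> {}" "S \<noteq> verts ?D"
    then have S': "S \<subseteq> verts G" "S \<noteq> {}" "S \<noteq> verts G" by (auto simp: V)
    obtain a b where ab: "a \<in> S" "b \<in> verts G - S" "{a, b} \<in> edges G"
      by (rule connected_crossing[OF minimal_dense_graph minimal_dense_connected S'])
    show "\<exists>x\<in>S. \<exists>y\<in>verts ?D - S. {x, y} \<in> edges ?D"
    proof (cases "{a, b} = {x, y}")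
      case True
      then have "{a, z} \<in> edges ?D" "{z, b} \<in> edges ?D" using e by (auto simp: doubleton_eq_iff)
      then show ?thesis using ab zz(3) unfolding V by blast
    next
      case False
      then have "{a, b} \<in> edges ?D" using ab(3) by (simp add: delete_edge_def)
      then show ?thesis using ab unfolding V by blast
    qed
  qed
  moreover have c: "card (edges ?D) + 1 = card (edges G)"
    using card_Suc_Diff1[OF finite_edges[OF minimal_dense_graph] xy] by (simp add: delete_edge_def)
  then have "dense ?D" using no unfolding dense_def V by linarith
  moreover have "subgraph ?D G" using D by (auto simp: subgraph_def delete_edge_def)
  ultimately have "?D = G" using dense_subgraph_eq by blast
  then show False using c by simp
qed

end

section \<open>Four-vertex 2-trees in minimal dense graphs\<close>

lemma diamond_two_tree:
  assumes d: "p \<noteq> q" "p \<noteq> r" "q \<noteq> r" "u \<notin> {p, q, r}"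
  shows "two_tree \<lparr>verts = {p, q, r, u}, edges = {{p, q}, {p, r}, {q, r}, {p, u}, {q, u}}\<rparr>" (is "two_tree ?D")
proof (rule two_tree_extendI[of _ u p q])
  show g: "is_graph ?D" using d by (auto simp: is_graph_def)
  show "simplicial2 ?D u p q" using d by (auto simp: simplicial2_def nbrs_def doubleton_eq_iff)
  have "delete_vertex ?D u = \<lparr>verts = {p, q, r}, edges = {{p, q}, {p, r}, {q, r}}\<rparr>"
    by (rule graph.equality) (use d in \<open>auto simp: verts_delete_vertex edges_delete_vertex[OF g]\<close>)
  then show "two_tree (delete_vertex ?D u)" using two_tree_triangleI d by metis
  have "p \<noteq> u" "q \<noteq> u" "r \<noteq> u" using d(4) by auto
  then show "3 < card (verts ?D)" using d(1-3) by simp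
qed

text \<open>
  A triangle together with a vertex adjacent to two of its vertices contains the 2-tree on four
  vertices.
\<close>

lemma edge_in_diamond:
  assumes minimal: "minimal_dense G" and xy: "{x, y} \<in> edges G"
  obtains D where "subgraph D G" "two_tree D" "card (verts D) = 4" "{x, y} \<in> edges D"
proof -
  note G = minimal_dense_graph[OF minimal]
  have diamond: "\<exists>D. subgraph D G \<and> two_tree D \<and> card (verts D) = 4 \<and> {{p, q}, {p, r}, {q, r}} \<subseteq> edges D"
    if e: "{p, q} \<in> edges G" "{p, r} \<in> edges G" "{q, r} \<in> edges G" and u: "u \<notin> {p, q, r}" "u \<in> nbrs G p \<inter> nbrs G q"
    for p q r u
  proof -
    let ?D = "\<lparr>verts = {p, q, r, u}, edges = {{p, q}, {p, r}, {q, r}, {p, u}, {q, u}}\<rparr>"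
    have d: "p \<noteq> q" "p \<noteq> r" "q \<noteq> r" using edge_in_graphD(3)[OF G] e by auto
    have "two_tree ?D" by (rule diamond_two_tree[OF d u(1)])
    moreover have "subgraph ?D G"
      using e u(2) edge_in_graphD(1,2)[OF G e(1)] edge_in_graphD(1,2)[OF G e(2)] nbrs_subset[OF G, of p]
        two_tree_graph[OF calculation] by (auto simp: subgraph_def nbrs_def)
    moreover have "card (verts ?D) = 4"
    proof -
      have "p \<noteq> u" "q \<noteq> u" "r \<noteq> u" using u(1) by auto
      then show ?thesis using d by simp
    qed
    ultimately show ?thesis by (intro exI[of _ ?D]) auto
  qed
  obtain z where "z \<in> nbrs G x \<inter> nbrs G y" using edge_in_triangle[OF minimal xy] by blast
  then have e: "{x, z} \<in> edges G" "{y, z} \<in> edges G" "{y, x} \<in> edges G" "{z, x} \<in> edges G" "{z, y} \<in> edges G"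
    using xy by (auto simp: nbrs_def insert_commute)
  obtain u where u: "u \<notin> {x, y, z}"
    "u \<in> nbrs G x \<inter> nbrs G y \<or> u \<in> nbrs G x \<inter> nbrs G z \<or> u \<in> nbrs G y \<inter> nbrs G z"
    using triangle_has_neighbour_triangle[OF minimal xy e(1,2)] by blast
  have "\<exists>D. subgraph D G \<and> two_tree D \<and> card (verts D) = 4 \<and> {x, y} \<in> edges D"
    using u(2)
  proof (elim disjE)
    assume "u \<in> nbrs G x \<inter> nbrs G y"
    then show ?thesis using diamond[OF xy e(1,2) u(1)] by blast
  next
    assume "u \<in> nbrs G x \<inter> nbrs G z"
    then show ?thesis using diamond[OF e(1) xy e(5), of u] u(1) by blast
  next
    assume "u \<in> nbrs G y \<inter> nbrs G z"
    then show ?thesis using diamond[OF e(2) e(3) e(4), of u] u(1) by (metis insert_iff insert_commute insert_subset)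
  qed
  then show ?thesis using that by blast
qed

section \<open>A largest 2-tree in a minimal dense graph\<close>

text \<open>
  Growing two disjoint connected sets inside a connected set until they fill it.
\<close>

lemma connected_bipartition:
  assumes G: "is_graph G" and K: "K \<subseteq> verts G" "connected_set G K" and ab: "a \<in> K" "b \<in> K" "a \<noteq> b"
  obtains A B where "a \<in> A" "b \<in> B" "A \<union> B = K" "A \<inter> B = {}" "connected_set G A" "connected_set G B"
proof -
  let ?P = "\<lambda>p. a \<in> fst p \<and> b \<in> snd p \<and> fst p \<union> snd p \<subseteq> K \<and> fst p \<inter> snd p = {} \<and>
    connected_set G (fst p) \<and> connected_set G (snd p)"
  have fK: "finite K" using K(1) finite_verts[OF G] by (rule finite_subset)
  have a0: "?P ({a}, {b})" using ab K connected_set_singleton[OF G] by auto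
  have bound: "card (fst p \<union> snd p) < card K + 1" if "?P p" for p
    using card_mono[OF fK, of "fst p \<union> snd p"] that by linarith
  obtain p where p: "?P p" "\<And>q. ?P q \<Longrightarrow> card (fst q \<union> snd q) \<le> card (fst p \<union> snd p)"
    using ex_has_greatest_nat[of ?P "({a}, {b})" "\<lambda>p. card (fst p \<union> snd p)" "card K + 1"] a0 bound
    by (metis (no_types, lifting) less_imp_le)
  obtain A B where AB: "p = (A, B)" by (cases p)
  have h: "a \<in> A" "b \<in> B" "A \<union> B \<subseteq> K" "A \<inter> B = {}" "connected_set G A" "connected_set G B"
    using p(1) AB by auto
  have "A \<union> B = K"
  proof (rule ccontr)
    assume ne: "A \<union> B \<noteq> K"
    have neA: "A \<union> B \<noteq> {}" using h(1) by blast
    obtain x z where xz: "x \<in> A \<union> B" "z \<in> K - (A \<union> B)" "{x, z} \<in> edges G"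
      by (rule connected_set_crossing[OF G K(2,1) h(3) neA ne])
    have zV: "z \<in> verts G" using xz(2) K(1) by blast
    have grow: "connected_set G (insert z U)" if "connected_set G U" "U \<subseteq> K" "x \<in> U" for U
    proof -
      have "connected_set G (U \<union> {z})"
        using connected_set_union[OF G that(1) _ connected_set_singleton[OF G zV]] that K(1) xz(3) zV by blast
      then show ?thesis by simp
    qed
    have fin: "finite (A \<union> B)" using h(3) fK by (rule finite_subset)
    have "card (insert z (A \<union> B)) \<le> card (A \<union> B)"
    proof (cases "x \<in> A")
      case True
      have "connected_set G (insert z A)" using grow[OF h(5) _ True] h(3) by blast
      then have "?P (insert z A, B)" using h xz(2) by auto
      then show ?thesis using p(2)[of "(insert z A, B)"] AB by simp
    next
      case False
      then have "connected_set G (insert z B)" using grow[OF h(6)] h(3) xz(1) by blast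
      then have "?P (A, insert z B)" using h xz(2) by auto
      then show ?thesis using p(2)[of "(A, insert z B)"] AB by simp
    qed
    then show False using xz(2) fin by simp
  qed
  then show ?thesis using that h by blast
qed

context
  fixes G T :: "nat graph"
  assumes minimal: "minimal_dense G" and no_K4: "\<not> minor (complete_graph 4) G"
    and T: "two_tree T" and TG: "subgraph T G"
    and largest: "\<And>T'. two_tree T' \<Longrightarrow> subgraph T' G \<Longrightarrow> card (verts T') \<le> card (verts T)"
    and four: "4 \<le> card (verts T)"
begin

lemma largest_sub: "verts T \<subseteq> verts G" "edges T \<subseteq> edges G" "is_graph T"
  using TG by (auto simp: subgraph_def)

lemma largest_induced:
  assumes "{x, y} \<in> edges G" "x \<in> verts T" "y \<in> verts T"
  shows "{x, y} \<in> edges T"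
proof (rule ccontr)
  assume "{x, y} \<notin> edges T"
  moreover have "x \<noteq> y" "x \<in> verts G" using edge_in_graphD[OF minimal_dense_graph[OF minimal] assms(1)] by auto
  ultimately show False
    using joined_nonadjacent_complete_4[OF minimal_dense_graph[OF minimal] T TG, of "{x}" x y x] no_K4 assms
      connected_set_singleton[OF minimal_dense_graph[OF minimal], of x] by simp
qed

text \<open>
  If the two vertices are adjacent, the common neighbour extends the largest 2-tree; otherwise it
  joins them.
\<close>

lemma no_common_neighbour_outside:
  assumes k: "k \<notin> verts T" and xy: "x \<in> verts T" "y \<in> verts T" "x \<noteq> y"
    and kx: "{x, k} \<in> edges G" and ky: "{y, k} \<in> edges G"
  shows False
proof -
  note G = minimal_dense_graph[OF minimal]
  have kV: "k \<in> verts G" using edge_in_graphD(2)[OF G kx] .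
  have e: "{x, y} \<in> edges T"
  proof (rule ccontr)
    assume ne: "{x, y} \<notin> edges T"
    have "{x, k} \<inter> verts T = {x}" "{x, k} \<subseteq> verts G" using k xy largest_sub kV by auto
    moreover have "{k, y} \<in> edges G" using ky by (simp add: insert_commute)
    ultimately show False
      using joined_nonadjacent_complete_4[OF G T TG, of "{x, k}" x y k] no_K4 xy ne
        connected_set_edge[OF G kx] by blast
  qed
  let ?T = "\<lparr>verts = insert k (verts T), edges = edges T \<union> {{x, k}, {y, k}}\<rparr>"
  have kxy: "k \<noteq> x" "k \<noteq> y" using k xy by auto
  have g: "is_graph ?T" using largest_sub(3) kxy xy by (auto simp: is_graph_def)
  have no_k: "k \<notin> e" if "e \<in> edges T" for e using that largest_sub(3) k by (auto simp: is_graph_def)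
  have "nbrs ?T k = {x, y}" using no_k kxy by (auto simp: nbrs_def doubleton_eq_iff)
  then have s: "simplicial2 ?T k x y" using e by (simp add: simplicial2_def)
  have "delete_vertex ?T k = T"
  proof (rule graph.equality)
    show "verts (delete_vertex ?T k) = verts T" unfolding verts_delete_vertex using k by auto
    show "edges (delete_vertex ?T k) = edges T" unfolding edges_delete_vertex[OF g] using no_k by auto
  qed simp
  moreover have c: "card (verts ?T) = card (verts T) + 1" using k finite_verts[OF largest_sub(3)] by simp
  ultimately have "two_tree ?T" using two_tree_extendI[OF g s] T four by simp
  moreover have "subgraph ?T G" using g largest_sub kV kx ky by (auto simp: subgraph_def)
  ultimately show False using largest[of ?T] c by simp
qed

text \<open>
  A connected set outside the 2-tree that is adjacent to two of its vertices could be contracted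
  to two adjacent vertices, one of them a common neighbour with the first: the 2-tree and the two
  new vertices would span four more edges and form a dense minor.
\<close>

lemma outside_attached_once:
  assumes K: "K \<subseteq> verts G - verts T" "connected_set G K"
    and x: "x \<in> verts T" "k \<in> K" "{x, k} \<in> edges G" and y: "y \<in> verts T" "l \<in> K" "{y, l} \<in> edges G"
  shows "x = y"
proof (rule ccontr)
  assume xy: "x \<noteq> y"
  note G = minimal_dense_graph[OF minimal]
  obtain k' where "k' \<in> nbrs G x \<inter> nbrs G k" using edge_in_triangle[OF minimal x(3)] by blast
  then have k': "{x, k'} \<in> edges G" "{k, k'} \<in> edges G" by (auto simp: nbrs_def)
  have kT: "k \<notin> verts T" using K x by blast
  have k'T: "k' \<notin> verts T"
  proof
    assume h: "k' \<in> verts T"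
    have "{k', k} \<in> edges G" using k'(2) by (simp add: insert_commute)
    then show False using no_common_neighbour_outside[OF kT x(1) h _ x(3)] edge_in_graphD(3)[OF G k'(1)] by blast
  qed
  have kk: "k \<noteq> k'" "k' \<in> verts G" using edge_in_graphD[OF G k'(2)] by auto
  let ?K = "insert k' K"
  have KK: "?K \<subseteq> verts G - verts T" "?K \<subseteq> verts G" using K kk k'T by auto
  have "connected_set G (K \<union> {k'})"
    using connected_set_union[OF G K(2) _ connected_set_singleton[OF G kk(2)]] K(1) kk(2) k'(2) x(2) by blast
  then have conK: "connected_set G ?K" by simp
  have "k \<in> ?K" "k' \<in> ?K" using x(2) by auto
  then obtain A B where AB: "k \<in> A" "k' \<in> B" "A \<union> B = ?K" "A \<inter> B = {}" "connected_set G A" "connected_set G B"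
    using connected_bipartition[OF G KK(2) conK _ _ kk(1)] by blast
  define t where "t = (if l \<in> A then k else k')"
  have t: "t = k \<and> l \<in> A \<or> t = k' \<and> l \<in> B" using AB(3) y(2) unfolding t_def by auto
  let ?H = "\<lparr>verts = insert k (insert k' (verts T)),
    edges = edges T \<union> {{x, k}, {x, k'}, {k, k'}, {y, t}}\<rparr>"
  have tne: "t \<noteq> y" "t \<in> {k, k'}" using t kT k'T y(1) by auto
  have xne: "x \<noteq> k" "x \<noteq> k'" "y \<noteq> k" "y \<noteq> k'" using kT k'T x(1) y(1) by auto
  have gH: "is_graph ?H" using largest_sub(3) x(1) y(1) kk(1) tne xne by (auto simp: is_graph_def)
  have subTH: "subgraph T ?H" using largest_sub(3) by (auto simp: subgraph_def)
  have conH: "connected_graph ?H"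
  proof -
    have "connected_set ?H (verts T)"
      using connected_set_subgraph[OF subTH gH subset_refl] two_tree_connected[OF T]
        connected_set_verts[OF largest_sub(3)] by blast
    then have "connected_set ?H (verts T \<union> {k, k'})"
      using connected_set_union[OF gH _ _ connected_set_edge[OF gH, of k k']] x(1) by auto
    moreover have "verts T \<union> {k, k'} = verts ?H" by auto
    ultimately show ?thesis using connected_set_verts[OF gH] by metis
  qed
  have no_k: "k \<notin> e" "k' \<notin> e" if "e \<in> edges T" for e using that largest_sub(3) kT k'T by (auto simp: is_graph_def)
  have cV: "card (verts ?H) = card (verts T) + 2"
    using kT k'T kk(1) finite_verts[OF largest_sub(3)] by simp
  have cE: "card (edges ?H) = card (edges T) + 4"
  proof -
    have "card {{x, k}, {x, k'}, {k, k'}, {y, t}} = 4"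
      using xne tne kk(1) xy by (auto simp: card_insert_if doubleton_eq_iff)
    moreover have "edges T \<inter> {{x, k}, {x, k'}, {k, k'}, {y, t}} = {}" using no_k tne(2) by blast
    ultimately show ?thesis using card_Un_disjoint[OF finite_edges[OF largest_sub(3)], of "{{x, k}, {x, k'}, {k, k'}, {y, t}}"]
      by simp
  qed
  have dH: "dense ?H" using cV cE two_tree_card[OF T] four unfolding dense_def by linarith
  define \<mu> where "\<mu> u = (if u = k then A else if u = k' then B else {u})" for u
  have \<mu>: "\<mu> k = A" "\<mu> k' = B" "\<And>u. u \<in> verts T \<Longrightarrow> \<mu> u = {u}"
    using kk(1) kT k'T by (auto simp: \<mu>_def)
  have AB_T: "A \<inter> verts T = {}" "B \<inter> verts T = {}" "A \<subseteq> verts G" "B \<subseteq> verts G" using AB(3) KK by auto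
  have "model ?H G \<mu>"
  proof (rule modelI)
    fix u assume "u \<in> verts ?H"
    then consider "u = k" | "u = k'" | "u \<in> verts T" by auto
    then have "\<mu> u \<subseteq> verts G \<and> connected_set G (\<mu> u)"
    proof cases
      case 1
      then show ?thesis using \<mu>(1) AB(5) AB_T(3) by simp
    next
      case 2
      then show ?thesis using \<mu>(2) AB(6) AB_T(4) by simp
    next
      case 3
      then show ?thesis using \<mu>(3) largest_sub(1) connected_set_singleton[OF G, of u] by auto
    qed
    then show "\<mu> u \<subseteq> verts G" "connected_set G (\<mu> u)" by auto
  next
    fix u w assume uw: "u \<in> verts ?H" "w \<in> verts ?H" "u \<noteq> w"
    have new: "\<mu> s \<inter> \<mu> r = {}" if "s \<in> {k, k'}" "r \<in> verts T" for s r
      using that \<mu> AB_T by auto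
    have AB': "\<mu> k \<inter> \<mu> k' = {}" using \<mu> AB(4) by simp
    consider "u \<in> {k, k'}" "w \<in> verts T" | "w \<in> {k, k'}" "u \<in> verts T" | "u \<in> {k, k'}" "w \<in> {k, k'}"
      | "u \<in> verts T" "w \<in> verts T" using uw by auto
    then show "\<mu> u \<inter> \<mu> w = {}"
    proof cases
      case 1
      then show ?thesis by (rule new)
    next
      case 2
      then show ?thesis using new[OF 2] by (simp add: Int_commute)
    next
      case 3
      then have "(u = k \<and> w = k') \<or> (u = k' \<and> w = k)" using uw(3) by blast
      then show ?thesis using AB' by (auto simp: Int_commute)
    next
      case 4
      then show ?thesis using \<mu>(3) uw(3) by simp
    qed
  next
    fix u w assume "{u, w} \<in> edges ?H"
    then have "{u, w} \<in> edges T \<or> {u, w} = {x, k} \<or> {u, w} = {x, k'} \<or> {u, w} = {k, k'} \<or> {u, w} = {y, t}"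
      by (simp only: graph.select_convs Un_iff insert_iff empty_iff simp_thms)
    then show "\<exists>s\<in>\<mu> u. \<exists>r\<in>\<mu> w. {s, r} \<in> edges G"
    proof (elim disjE)
      assume h: "{u, w} \<in> edges T"
      then have "u \<in> verts T" "w \<in> verts T" "{u, w} \<in> edges G" using edge_in_graphD[OF largest_sub(3) h] largest_sub by auto
      then show ?thesis using \<mu>(3) by simp
    next
      assume "{u, w} = {x, k}"
      then show ?thesis by (rule doubleton_link[of u w x k x \<mu> k]) (use \<mu> x AB in auto)
    next
      assume "{u, w} = {x, k'}"
      then show ?thesis by (rule doubleton_link[of u w x k' x \<mu> k']) (use \<mu> x k' AB in auto)
    next
      assume "{u, w} = {k, k'}"
      then show ?thesis by (rule doubleton_link[of u w k k' k \<mu> k']) (use \<mu> k' AB in auto)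
    next
      assume "{u, w} = {y, t}"
      then show ?thesis by (rule doubleton_link[of u w y t y \<mu> l]) (use \<mu> y t in auto)
    qed
  qed
  then have "card (verts T) + 2 = card (verts G)"
    using dense_minor_same_size(1)[OF minimal gH conH dH] cV unfolding minor_iff_model by metis
  moreover have "card (verts T) + card ?K \<le> card (verts G)"
  proof -
    have "card (verts T \<union> ?K) = card (verts T) + card ?K"
      using KK finite_verts[OF G] finite_verts[OF largest_sub(3)] by (intro card_Un_disjoint) (auto intro: finite_subset)
    moreover have "card (verts T \<union> ?K) \<le> card (verts G)"
      using KK largest_sub finite_verts[OF G] by (intro card_mono) auto
    ultimately show ?thesis by simp
  qed
  ultimately have "card ?K \<le> card {k, k'}" using kk(1) by simp
  moreover have "{k, k'} \<subseteq> ?K" "finite ?K" using x(2) KK(2) finite_verts[OF G] finite_subset by auto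
  ultimately have "?K = {k, k'}" using card_seteq by metis
  then have "l = k \<or> l = k'" using y(2) by blast
  then show False
    using no_common_neighbour_outside[OF kT x(1) y(1) xy x(3)] no_common_neighbour_outside[OF k'T x(1) y(1) xy k'(1)] y(3)
    by blast
qed

text \<open>
  A 2-connected subgraph that leaves the 2-tree and shares two vertices with it would contain a
  connected set outside the 2-tree attached to it at two vertices.
\<close>

lemma two_connected_meets_once:
  assumes D: "subgraph D G" "two_connected D" and e: "{x, y} \<in> edges D" "{x, y} \<notin> edges T"
    and p: "p \<in> verts D \<inter> verts T" "q \<in> verts D \<inter> verts T"
  shows "p = q"
proof (rule ccontr)
  assume pq: "p \<noteq> q"
  note G = minimal_dense_graph[OF minimal]
  have gD: "is_graph D" and subD: "verts D \<subseteq> verts G" "edges D \<subseteq> edges G" using D(1) by (auto simp: subgraph_def)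
  have "x \<notin> verts T \<or> y \<notin> verts T" using largest_induced[of x y] e subD by blast
  then obtain d where d: "d \<in> verts D - verts T" using edge_in_graphD[OF gD e(1)] by blast
  let ?P = "\<lambda>W. d \<in> W \<and> W \<subseteq> verts D - verts T \<and> connected_set G W"
  have fin: "finite (verts D)" by (rule finite_verts[OF gD])
  have "?P {d}" using d subD connected_set_singleton[OF G, of d] by auto
  moreover have "card W < card (verts D) + 1" if "?P W" for W
    using card_mono[OF fin, of W] that by (simp add: subset_eq less_Suc_eq_le)
  ultimately obtain W where W: "?P W" "\<And>W'. ?P W' \<Longrightarrow> card W' \<le> card W"
    using ex_has_greatest_nat[of ?P "{d}" card "card (verts D) + 1"] by (metis (no_types, lifting) less_imp_le)
  have WG: "W \<subseteq> verts G" and fW: "finite W" using W(1) subD fin finite_subset by (blast, metis Diff_subset finite_subset)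
  have exit: "z \<in> verts T" if "w \<in> W" "z \<in> verts D - W" "{w, z} \<in> edges G" for w z
  proof (rule ccontr)
    assume z: "z \<notin> verts T"
    have zV: "z \<in> verts G" using that(2) subD by blast
    have "connected_set G (W \<union> {z})"
      using connected_set_union[OF G _ WG connected_set_singleton[OF G zV]] W(1) that zV by blast
    then have "?P (insert z W)" using W(1) that(2) z by auto
    then have "card (insert z W) \<le> card W" by (rule W(2))
    then show False using that(2) fW by simp
  qed
  have leave: "\<exists>w\<in>W. \<exists>z\<in>verts T. z \<noteq> u \<and> {z, w} \<in> edges G" if u: "u \<in> verts D \<inter> verts T" for u
  proof -
    have c: "connected_graph (delete_vertex D u)" using two_connectedD(3)[OF D(2)] u by blast
    have V: "verts (delete_vertex D u) = verts D - {u}" by (rule verts_delete_vertex)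
    obtain r where r: "r \<in> verts D \<inter> verts T" "r \<noteq> u" using p pq by blast
    have s: "W \<subseteq> verts (delete_vertex D u)" "W \<noteq> {}" "W \<noteq> verts (delete_vertex D u)"
      unfolding V using W(1) u r by blast+
    obtain w z where wz: "w \<in> W" "z \<in> verts (delete_vertex D u) - W" "{w, z} \<in> edges (delete_vertex D u)"
      by (rule connected_crossing[OF is_graph_delete_vertex[OF gD] c s])
    then have "{w, z} \<in> edges G" "z \<in> verts D - W" "z \<noteq> u"
      using subD(2) V edges_delete_vertex[OF gD] by auto
    then have "z \<in> verts T" using exit wz(1) by blast
    then show ?thesis using wz(1) \<open>z \<noteq> u\<close> \<open>{w, z} \<in> edges G\<close> by (metis insert_commute)
  qed
  obtain w z where wz: "w \<in> W" "z \<in> verts T" "{z, w} \<in> edges G" using leave[OF p(1)] by blast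
  have K: "W \<subseteq> verts G - verts T" "connected_set G W" using W(1) WG by auto
  have zD: "z' = z" if "w' \<in> W" "z' \<in> verts T" "{z', w'} \<in> edges G" for w' z'
    using outside_attached_once[OF K that(2,1,3) wz(2,1,3)] .
  obtain u where u: "u \<in> verts D \<inter> verts T" "u = z \<or> z \<notin> verts D" using p wz(2) by blast
  show False
  proof (cases "z \<in> verts D")
    case True
    then show False using leave[of z] zD wz(2) by blast
  next
    case False
    have c: "connected_graph D" using two_connectedD(2)[OF D(2)] .
    have s: "W \<subseteq> verts D" "W \<noteq> {}" "W \<noteq> verts D" using W(1) p by blast+
    obtain w' z' where "w' \<in> W" "z' \<in> verts D - W" "{w', z'} \<in> edges D"
      by (rule connected_crossing[OF gD c s])
    then have "z' = z" using exit zD subD(2) by (metis insert_commute subsetD)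
    then show False using False \<open>z' \<in> verts D - W\<close> by blast
  qed
qed

end

section \<open>Dense connected graphs contain an obstruction\<close>

lemma largest_two_tree:
  assumes minimal: "minimal_dense G"
  obtains T where "two_tree T" "subgraph T G" "\<And>T'. two_tree T' \<Longrightarrow> subgraph T' G \<Longrightarrow> card (verts T') \<le> card (verts T)"
    "4 \<le> card (verts T)"
proof -
  note G = minimal_dense_graph[OF minimal]
  have "verts G \<noteq> {}" using connected_nonempty[OF minimal_dense_connected[OF minimal]] .
  then have "card (verts G) \<noteq> 0" using finite_verts[OF G] by simp
  then have "edges G \<noteq> {}" using minimal_dense_dense[OF minimal] unfolding dense_def by auto
  then obtain x y where "{x, y} \<in> edges G" using edge_in_graphE[OF G] by (metis ex_in_conv)
  then obtain D where D: "subgraph D G" "two_tree D" "card (verts D) = 4" using edge_in_diamond[OF minimal] by metis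
  have "card (verts T) < card (verts G) + 1" if "two_tree T \<and> subgraph T G" for T
    using that card_mono[OF finite_verts[OF G]] by (simp add: subgraph_def less_Suc_eq_le)
  then obtain T where "two_tree T \<and> subgraph T G" "\<And>T'. two_tree T' \<and> subgraph T' G \<Longrightarrow> card (verts T') \<le> card (verts T)"
    using ex_has_greatest_nat[of "\<lambda>T. two_tree T \<and> subgraph T G" D "\<lambda>T. card (verts T)" "card (verts G) + 1"] D
    by (metis (no_types, lifting) less_imp_le)
  then show ?thesis using that D by metis
qed

lemma leaving_edge:
  assumes G: "is_graph G" "connected_graph G" and H: "subgraph H G" "verts H \<noteq> {}" "H \<noteq> G"
  obtains x y where "x \<in> verts H" "{x, y} \<in> edges G" "{x, y} \<notin> edges H"
proof (cases "verts H = verts G")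
  case True
  then have "edges H \<noteq> edges G" using H(3) by (auto intro: graph.equality)
  then obtain e where e: "e \<in> edges G" "e \<notin> edges H" using H(1) unfolding subgraph_def by blast
  obtain x y where "e = {x, y}" "x \<in> verts G" using edge_in_graphE[OF G(1) e(1)] by metis
  then show ?thesis using that e True by blast
next
  case False
  have sub: "verts H \<subseteq> verts G" "is_graph H" using H(1) by (auto simp: subgraph_def)
  obtain x y where "x \<in> verts H" "y \<in> verts G - verts H" "{x, y} \<in> edges G"
    by (rule connected_crossing[OF G sub(1) H(2) False])
  then show ?thesis using that edge_in_graphD(2)[OF sub(2)] by blast
qed

definition graph_union :: "'a graph \<Rightarrow> 'a graph \<Rightarrow> 'a graph" where
  "graph_union H K = \<lparr>verts = verts H \<union> verts K, edges = edges H \<union> edges K\<rparr>"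

lemma graph_union_one_sum:
  "is_graph H \<Longrightarrow> is_graph K \<Longrightarrow> verts H \<inter> verts K = {v} \<Longrightarrow> one_sum (graph_union H K) H K v"
  by (simp add: one_sum_def graph_union_def)

lemma graph_union_subgraph:
  assumes "subgraph H G" "subgraph K G"
  shows "subgraph (graph_union H K) G"
  using assms unfolding subgraph_def graph_union_def is_graph_def by auto

text \<open>
  By minimality the graph equals every dense connected subgraph of it. If a largest 2-tree has at least
  six vertices, it is dense. If it has five vertices, a four-vertex 2-tree on an edge leaving it meets it
  in one vertex, and the union with 8 vertices and 12 edges is dense. If it has four vertices, adding
  a second and a third 2-tree in the same way gives 15 edges on at most 10 vertices.
\<close>

lemma minimal_dense_in_\<A>:
  assumes minimal: "minimal_dense G"
  shows "G \<in> \<A> \<and> card (verts G) \<le> 10"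
proof (cases "minor (complete_graph 4) G")
  case True
  have K4: "is_graph (complete_graph 4)" by (auto simp: is_graph_def complete_graph_def)
  have n: "card (verts (complete_graph 4)) = 4" by (simp add: verts_complete)
  have E: "card (edges (complete_graph 4)) = 6"
    using n_subsets[of "{..<4::nat}" 2] choose_two_small by (simp add: complete_graph_def)
  have con: "connected_graph (complete_graph 4)"
  proof -
    have "connected_set (complete_graph 4) (verts (complete_graph 4))"
      by (rule connected_set_clique[OF K4]) (auto simp: complete_graph_def lessThan_nat_numeral)
    then show ?thesis using connected_set_verts[OF K4] by blast
  qed
  have "dense (complete_graph 4)" unfolding dense_def n E by simp
  then have same: "card (verts (complete_graph 4)) = card (verts G)" "card (edges (complete_graph 4)) = card (edges G)"
    using dense_minor_same_size[OF minimal K4 con _ True] by auto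
  have G: "is_graph G" using minimal_dense_graph[OF minimal] .
  have "minor G (complete_graph 4)" by (rule minor_same_size_sym[OF True K4 G]) (use same in simp_all)
  then obtain f where "bij_betw f (verts G) (verts (complete_graph 4))"
    "edges (complete_graph 4) = (\<lambda>e. f ` e) ` edges G"
    using minor_same_size_isomorphic[OF _ G K4] same by (metis order_refl)
  then have "G \<in> \<A>\<^sub>4" using G unfolding \<A>\<^sub>4_def isomorphic_def by blast
  then show ?thesis using same(1) n by (simp add: \<A>_def)
next
  case no_K4: False
  note G = minimal_dense_graph[OF minimal] and con = minimal_dense_connected[OF minimal]
  obtain T where T: "two_tree T" "subgraph T G"
    "\<And>T'. two_tree T' \<Longrightarrow> subgraph T' G \<Longrightarrow> card (verts T') \<le> card (verts T)" "4 \<le> card (verts T)"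
    using largest_two_tree[OF minimal] by blast
  have gT: "is_graph T" and cT: "connected_graph T" using two_tree_graph two_tree_connected T(1) by auto
  note cardT = two_tree_card[OF T(1)]
  \<comment> \<open>A four-vertex 2-tree on an edge that leaves a largest 2-tree meets it in one vertex only.\<close>
  have new_diamond: "\<exists>D. subgraph D G \<and> two_tree D \<and> card (verts D) = 4 \<and> {x, y} \<in> edges D \<and>
      (\<forall>T'. two_tree T' \<and> subgraph T' G \<and> card (verts T') = card (verts T) \<and> {x, y} \<notin> edges T' \<longrightarrow>
        (\<forall>p\<in>verts D \<inter> verts T'. \<forall>q\<in>verts D \<inter> verts T'. p = q))"
    if xy: "{x, y} \<in> edges G" for x y
  proof -
    obtain D where D: "subgraph D G" "two_tree D" "card (verts D) = 4" "{x, y} \<in> edges D"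
      using edge_in_diamond[OF minimal xy] by blast
    have "p = q" if T': "two_tree T'" "subgraph T' G" "card (verts T') = card (verts T)" "{x, y} \<notin> edges T'"
      and "p \<in> verts D \<inter> verts T'" "q \<in> verts D \<inter> verts T'" for T' p q
      using two_connected_meets_once[OF minimal no_K4 T'(1,2) _ _ D(1) two_tree_two_connected[OF D(2)] D(4) T'(4)] that T
      by simp
    then show ?thesis using D by blast
  qed
  have glue: "one_sum (graph_union H D) H D x \<and> subgraph (graph_union H D) G \<and> connected_graph (graph_union H D)"
    if h: "subgraph H G" "connected_graph H" "subgraph D G" "two_tree D" "verts H \<inter> verts D = {x}" for H D x
  proof -
    have "is_graph H" "is_graph D" using h(1,3) by (auto simp: subgraph_def)
    then have "one_sum (graph_union H D) H D x" using graph_union_one_sum h(5) by metis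
    then show ?thesis
      using graph_union_subgraph[OF h(1,3)] one_sum_connected[OF _ h(2) two_tree_connected[OF h(4)]] by metis
  qed
  consider "6 \<le> card (verts T)" | "card (verts T) = 5" | "card (verts T) = 4" using T(4) by linarith
  then show ?thesis
  proof cases
    case 1
    then have "dense T" using cardT unfolding dense_def by linarith
    then have TG: "T = G" using dense_subgraph_eq[OF minimal T(2) cT] by blast
    have "card (verts T) = 6"
    proof (rule ccontr)
      assume "card (verts T) \<noteq> 6"
      then have "7 \<le> card (verts T)" using 1 by linarith
      moreover have "card (verts T) = 3 \<or> (\<exists>v. v \<in> verts T \<and> two_tree (delete_vertex T v))"
        using T(1) by (induction rule: two_tree_induct) (auto simp: simplicial2_def)
      ultimately obtain v where v: "v \<in> verts T" "two_tree (delete_vertex T v)" by auto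
      have c: "card (verts (delete_vertex T v)) + 1 = card (verts T)"
        using card_Suc_Diff1[OF finite_verts[OF gT] v(1)] by (simp add: verts_delete_vertex)
      then have "dense (delete_vertex T v)"
        using two_tree_card[OF v(2)] \<open>7 \<le> card (verts T)\<close> unfolding dense_def by linarith
      then have "delete_vertex T v = G"
        using dense_subgraph_eq[OF minimal _ two_tree_connected[OF v(2)]] subgraph_delete_vertex[OF gT, of v] TG by simp
      then show False using c TG by simp
    qed
    then have "G \<in> \<A>\<^sub>6" "card (verts G) = 6" using T(1) TG by (simp_all add: \<A>\<^sub>6_def)
    then show ?thesis by (simp add: \<A>_def)
  next
    case 2
    have "\<not> dense T" using 2 cardT unfolding dense_def by linarith
    then have "T \<noteq> G" using minimal_dense_dense[OF minimal] by blast
    then obtain x y where xy: "x \<in> verts T" "{x, y} \<in> edges G" "{x, y} \<notin> edges T"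
      using leaving_edge[OF G con T(2) connected_nonempty[OF cT]] by blast
    obtain D where D: "subgraph D G" "two_tree D" "card (verts D) = 4" "{x, y} \<in> edges D"
      "\<forall>p\<in>verts D \<inter> verts T. \<forall>q\<in>verts D \<inter> verts T. p = q"
      using new_diamond[OF xy(2)] T(1,2) xy(3) by blast
    have "x \<in> verts D" using edge_in_graphD(1)[OF two_tree_graph[OF D(2)] D(4)] .
    then have "verts T \<inter> verts D = {x}" using D(5) xy(1) by blast
    then have U: "one_sum (graph_union T D) T D x" "subgraph (graph_union T D) G" "connected_graph (graph_union T D)"
      using glue[OF T(2) cT D(1,2)] by blast+
    have "dense (graph_union T D)"
      using card_one_sum[OF U(1)] 2 cardT two_tree_card[OF D(2)] D(3) unfolding dense_def by linarith
    then have UG: "graph_union T D = G" using dense_subgraph_eq[OF minimal U(2,3)] by blast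
    have "blocks G = {T, D}"
      using blocks_one_sum(1)[OF U(1,3)] blocks_two_connected[OF gT two_tree_two_connected[OF T(1)]]
        blocks_two_connected[OF two_tree_graph[OF D(2)] two_tree_two_connected[OF D(2)]] UG by auto
    moreover have "T \<noteq> D" using 2 D(3) by auto
    ultimately have "G \<in> \<A>\<^sub>8" using G con T(1) 2 D(2,3) unfolding \<A>\<^sub>8_def by blast
    moreover have "card (verts G) = 8" using card_one_sum(1)[OF U(1)] 2 D(3) unfolding UG by linarith
    ultimately show ?thesis by (simp add: \<A>_def)
  next
    case 3
    have bl: "blocks D = {D}" if "two_tree D" for D :: "nat graph"
      using blocks_two_connected[OF two_tree_graph two_tree_two_connected] that by blast
    have "\<not> dense T" using 3 cardT unfolding dense_def by linarith
    then have "T \<noteq> G" using minimal_dense_dense[OF minimal] by blast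
    then obtain x y where xy: "x \<in> verts T" "{x, y} \<in> edges G" "{x, y} \<notin> edges T"
      using leaving_edge[OF G con T(2) connected_nonempty[OF cT]] by blast
    obtain D where D: "subgraph D G" "two_tree D" "card (verts D) = 4" "{x, y} \<in> edges D"
      "\<forall>p\<in>verts D \<inter> verts T. \<forall>q\<in>verts D \<inter> verts T. p = q"
      using new_diamond[OF xy(2)] T(1,2) xy(3) by blast
    have gD: "is_graph D" using two_tree_graph[OF D(2)] .
    have "x \<in> verts D" using edge_in_graphD(1)[OF gD D(4)] .
    then have "verts T \<inter> verts D = {x}" using D(5) xy(1) by blast
    let ?U = "graph_union T D"
    have U: "one_sum ?U T D x" "subgraph ?U G" "connected_graph ?U"
      using glue[OF T(2) cT D(1,2) \<open>verts T \<inter> verts D = {x}\<close>] by blast+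
    note gU = one_sum_graph(1)[OF U(1)]
    have cU: "card (verts ?U) = 7" "card (edges ?U) = 10"
      using card_one_sum[OF U(1)] 3 cardT two_tree_card[OF D(2)] D(3) by linarith+
    have "\<not> dense ?U" using cU unfolding dense_def by linarith
    then have "?U \<noteq> G" using minimal_dense_dense[OF minimal] by metis
    then obtain u w where uw: "u \<in> verts ?U" "{u, w} \<in> edges G" "{u, w} \<notin> edges ?U"
      using leaving_edge[OF G con U(2) connected_nonempty[OF U(3)]] by blast
    then have notin: "{u, w} \<notin> edges T" "{u, w} \<notin> edges D" by (auto simp: graph_union_def)
    obtain E where E0: "subgraph E G" "two_tree E" "card (verts E) = 4" "{u, w} \<in> edges E"
      and once: "\<forall>T'. two_tree T' \<and> subgraph T' G \<and> card (verts T') = card (verts T) \<and> {u, w} \<notin> edges T' \<longrightarrow>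
        (\<forall>p\<in>verts E \<inter> verts T'. \<forall>q\<in>verts E \<inter> verts T'. p = q)"
      using new_diamond[OF uw(2)] by blast
    have oT: "\<forall>p\<in>verts E \<inter> verts T. \<forall>q\<in>verts E \<inter> verts T. p = q" using once T(1,2) notin(1) by blast
    have oD: "\<forall>p\<in>verts E \<inter> verts D. \<forall>q\<in>verts E \<inter> verts D. p = q" using once D(1-3) notin(2) 3 by metis
    have gE: "is_graph E" using two_tree_graph[OF E0(2)] .
    have uE: "u \<in> verts E" using edge_in_graphD(1)[OF gE E0(4)] .
    have fin: "finite (verts E)" "finite (verts ?U)" using finite_verts gE gU by auto
    have single: "card S \<le> 1" if "\<forall>p\<in>S. \<forall>q\<in>S. p = q" for S :: "nat set"
      using that by (metis card_le_Suc0_iff_eq card.infinite One_nat_def zero_le)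
    have EU: "verts E \<inter> verts ?U = (verts E \<inter> verts T) \<union> (verts E \<inter> verts D)" by (auto simp: graph_union_def)
    \<comment> \<open>The third 2-tree could meet the first two in different vertices; then the union on 9 vertices
      would have too many edges for a minimal graph.\<close>
    have two: "card (verts E \<inter> verts ?U) \<le> 2"
      unfolding EU using card_Un_le[of "verts E \<inter> verts T" "verts E \<inter> verts D"] single[OF oT] single[OF oD] by linarith
    have disjE: "edges E \<inter> edges ?U = {}"
    proof (rule ccontr)
      assume "edges E \<inter> edges ?U \<noteq> {}"
      then obtain e where e: "e \<in> edges E" "e \<in> edges T \<or> e \<in> edges D" by (auto simp: graph_union_def)
      obtain a b where ab: "e = {a, b}" "a \<noteq> b" "a \<in> verts E" "b \<in> verts E" using edge_in_graphE[OF gE e(1)] by metis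
      have "(a \<in> verts T \<and> b \<in> verts T) \<or> (a \<in> verts D \<and> b \<in> verts D)"
        using e(2) ab(1) edge_in_graphD(1,2)[OF gT, of a b] edge_in_graphD(1,2)[OF gD, of a b] by blast
      then show False using oT oD ab by blast
    qed
    let ?W = "graph_union ?U E"
    have cW: "card (edges ?W) = 15"
      using card_Un_disjoint[OF finite_edges[OF gU] finite_edges[OF gE]] disjE cU(2) two_tree_card[OF E0(2)] E0(3)
      by (simp add: graph_union_def Int_commute)
    have "card (verts ?U) + card (verts E) = card (verts ?W) + card (verts E \<inter> verts ?U)"
      using card_Un_Int[OF fin(2,1)] by (simp add: graph_union_def Int_commute)
    then have vW: "card (verts ?W) + card (verts E \<inter> verts ?U) = 11" using cU(1) E0(3) by linarith
    have uU: "u \<in> verts E \<inter> verts ?U" using uE uw(1) by blast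
    have "card (verts E \<inter> verts ?U) \<noteq> 0" using uU fin by (metis card_0_eq empty_iff finite_Int)
    have sW: "subgraph ?W G" using graph_union_subgraph[OF U(2) E0(1)] .
    have gW: "is_graph ?W" using sW by (simp add: subgraph_def)
    have "connected_graph ?W"
    proof -
      have s: "subgraph ?U ?W" "subgraph E ?W" using gU gE by (auto simp: subgraph_def graph_union_def)
      have "connected_set ?W (verts ?U)" "connected_set ?W (verts E)"
        using connected_set_subgraph[OF s(1) gW subset_refl] connected_set_subgraph[OF s(2) gW subset_refl]
          U(3) two_tree_connected[OF E0(2)] connected_set_verts[OF gU] connected_set_verts[OF gE] by blast+
      moreover have "verts ?U \<subseteq> verts ?W" "verts E \<subseteq> verts ?W" using s by (auto simp: subgraph_def)
      ultimately have "connected_set ?W (verts ?U \<union> verts E)"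
        using connected_set_union[OF gW] uU by blast
      moreover have "verts ?U \<union> verts E = verts ?W" by (simp add: graph_union_def)
      ultimately show ?thesis using connected_set_verts[OF gW] by metis
    qed
    moreover have "dense ?W" using vW \<open>card (verts E \<inter> verts ?U) \<noteq> 0\<close> cW unfolding dense_def by linarith
    ultimately have WG: "?W = G" using dense_subgraph_eq[OF minimal sW] by blast
    have "card (verts E \<inter> verts ?U) = 1"
      using edges_nearly_tight[OF minimal] vW cW two \<open>card (verts E \<inter> verts ?U) \<noteq> 0\<close> unfolding WG by linarith
    then obtain z where "verts E \<inter> verts ?U = {z}" by (rule card_1_singletonE)
    then have "verts ?U \<inter> verts E = {u}" using uU by (simp add: Int_commute)
    then have s: "one_sum ?W ?U E u" using graph_union_one_sum[OF gU gE] by blast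
    then have s': "one_sum G ?U E u" unfolding WG .
    have "blocks G = {T} \<union> {D} \<union> {E}" "{T} \<inter> {D} = {}" "({T} \<union> {D}) \<inter> {E} = {}"
      using blocks_one_sum[OF s' con] blocks_one_sum[OF U(1,3)] bl[OF T(1)] bl[OF D(2)] bl[OF E0(2)] by auto
    then have "card (blocks G) = 3" "\<forall>B\<in>blocks G. two_tree B \<and> card (verts B) = 4"
      using T(1) D(2,3) E0(2,3) 3 by auto
    then have "G \<in> \<A>\<^sub>1\<^sub>0" using G con unfolding \<A>\<^sub>1\<^sub>0_def by blast
    moreover have "card (verts G) = 10" using vW \<open>card (verts E \<inter> verts ?U) = 1\<close> unfolding WG by linarith
    ultimately show ?thesis by (simp add: \<A>_def)
  qed
qed

section \<open>Components\<close>

lemma component_facts: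
  assumes G: "is_graph G"
  shows "\<Union>(components G) = verts G"
    and "C \<in> components G \<Longrightarrow> C \<subseteq> verts G \<and> C \<noteq> {}"
    and "C \<in> components G \<Longrightarrow> D \<in> components G \<Longrightarrow> C \<noteq> D \<Longrightarrow> C \<inter> D = {}"
    and "C \<in> components G \<Longrightarrow> connected_set G C"
    and "e \<in> edges G \<Longrightarrow> \<exists>C\<in>components G. e \<subseteq> C"
proof -
  note eq = equiv_reachable[of G]
  show union: "\<Union>(components G) = verts G" unfolding components_def using eq by (rule Union_quotient)
  show sub: "C \<in> components G \<Longrightarrow> C \<subseteq> verts G \<and> C \<noteq> {}" for C
    using union in_quotient_imp_non_empty[OF eq] unfolding components_def by blast
  show "C \<in> components G \<Longrightarrow> D \<in> components G \<Longrightarrow> C \<noteq> D \<Longrightarrow> C \<inter> D = {}" for C D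
    using quotient_disj[OF eq] unfolding components_def by blast
  have cl: "(x, y) \<in> reachable G \<longleftrightarrow> y \<in> C" if "C \<in> components G" "x \<in> C" for C x y
  proof -
    have "C \<in> verts G // reachable G" using that(1) by (simp add: components_def)
    then obtain z where z: "z \<in> verts G" "C = reachable G `` {z}" by (rule quotientE)
    then have "(z, x) \<in> reachable G" using that(2) by simp
    then have "reachable G `` {z} = reachable G `` {x}" by (rule equiv_class_eq[OF eq])
    then show ?thesis using z(2) by simp
  qed
  show "connected_set G C" if C: "C \<in> components G" for C
  proof (rule connected_setI[OF G])
    show "C \<subseteq> verts G" "C \<noteq> {}" using sub[OF C] by auto
    fix S assume S: "S \<subseteq> C" "S \<noteq> {}" "S \<noteq> C"
    obtain a b where ab: "a \<in> S" "b \<in> C - S" using S by blast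
    then have "(a, b) \<in> reachable G" using cl[OF C, of a b] S(1) by blast
    then have path: "(a, b) \<in> {(u, v). {u, v} \<in> edges G}\<^sup>*" by (simp add: reachable_def)
    have "z \<in> S \<or> (\<exists>x\<in>S. \<exists>y\<in>C - S. {x, y} \<in> edges G)" if "(a, z) \<in> {(u, v). {u, v} \<in> edges G}\<^sup>*" for z
      using that
    proof (induction rule: rtrancl_induct)
      case base
      then show ?case using ab(1) by simp
    next
      case (step y z)
      show ?case
      proof (cases "y \<in> S \<and> z \<notin> S")
        case True
        have yz: "{y, z} \<in> edges G" using step(2) by simp
        have yC: "y \<in> C" using True S(1) by blast
        have "(y, z) \<in> reachable G" using yz edge_in_graphD[OF G yz] by (auto simp: reachable_def)
        then have "z \<in> C" using cl[OF C yC] by simp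
        then show ?thesis using True yz by blast
      next
        case False
        then show ?thesis using step.IH by blast
      qed
    qed
    then show "\<exists>x\<in>S. \<exists>y\<in>C - S. {x, y} \<in> edges G" using path ab(2) by blast
  qed
  show "\<exists>C\<in>components G. e \<subseteq> C" if e: "e \<in> edges G" for e
  proof -
    obtain x y where xy: "e = {x, y}" "x \<in> verts G" "y \<in> verts G" using edge_in_graphE[OF G e] by metis
    then obtain C where C: "C \<in> components G" "x \<in> C" using union by blast
    have "(x, y) \<in> reachable G" using xy e by (auto simp: reachable_def)
    then have "y \<in> C" using cl[OF C] by simp
    then show ?thesis using C xy(1) by blast
  qed
qed

lemma component_edges_disjoint:
  assumes G: "is_graph G" and CD: "C \<in> components G" "D \<in> components G" "C \<noteq> D"
  shows "edges (induced G C) \<inter> edges (induced G D) = {}"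
proof -
  have "C \<inter> D = {}" using component_facts(3)[OF G CD] .
  moreover have "e \<noteq> {}" if "e \<in> edges G" for e using that G by (auto simp: is_graph_def)
  ultimately show ?thesis unfolding edges_induced by blast
qed

lemma card_components_sum:
  assumes G: "is_graph G"
  shows "card (verts G) = (\<Sum>C\<in>components G. card C)"
    and "card (edges G) = (\<Sum>C\<in>components G. card (edges (induced G C)))"
proof -
  note fin = finite_components[OF G]
  have "card (\<Union>C\<in>components G. C) = (\<Sum>C\<in>components G. card C)"
  proof (rule card_UN_disjoint[OF fin])
    show "\<forall>C\<in>components G. finite C"
      using component_facts(2)[OF G] finite_subset[OF _ finite_verts[OF G]] by blast
    show "\<forall>C\<in>components G. \<forall>D\<in>components G. C \<noteq> D \<longrightarrow> C \<inter> D = {}"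
      using component_facts(3)[OF G] by blast
  qed
  then show "card (verts G) = (\<Sum>C\<in>components G. card C)" using component_facts(1)[OF G] by simp
  have "edges G = (\<Union>C\<in>components G. edges (induced G C))"
    using component_facts(5)[OF G] unfolding edges_induced by blast
  moreover have "card (\<Union>C\<in>components G. edges (induced G C)) = (\<Sum>C\<in>components G. card (edges (induced G C)))"
    using component_edges_disjoint[OF G] finite_edges[OF is_graph_induced[OF G]]
    by (intro card_UN_disjoint[OF fin]) blast+
  ultimately show "card (edges G) = (\<Sum>C\<in>components G. card (edges (induced G C)))" by simp
qed

section \<open>Limits of edge densities\<close>

lemma minor_closedD:
  assumes "minor_closed \<G>" "G \<in> \<G>"
  shows "is_graph G" "is_graph H \<Longrightarrow> minor H G \<Longrightarrow> H \<in> \<G>"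
  using assms unfolding minor_closed_def by blast+

lemma minor_closed_subgraph: "minor_closed \<G> \<Longrightarrow> G \<in> \<G> \<Longrightarrow> subgraph H G \<Longrightarrow> H \<in> \<G>"
proof -
  assume h: "minor_closed \<G>" "G \<in> \<G>" "subgraph H G"
  have "is_graph H" using h(3) by (simp add: subgraph_def)
  then show ?thesis using minor_closedD(2)[OF h(1,2)] subgraph_minor[OF minor_closedD(1)[OF h(1,2)] h(3)] by blast
qed

lemma subgraph_induced: "is_graph G \<Longrightarrow> subgraph (induced G U) G"
  using is_graph_induced[of G U] by (auto simp: subgraph_def induced_def)

lemma finite_ex_set:
  assumes "\<And>G. G \<in> \<G> \<Longrightarrow> is_graph G"
  shows "finite {card (edges G) | G. G \<in> \<G> \<and> card (verts G) = n}"
proof (rule finite_subset)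
  show "{card (edges G) | G. G \<in> \<G> \<and> card (verts G) = n} \<subseteq> {..n\<^sup>2}"
  proof
    fix m assume "m \<in> {card (edges G) | G. G \<in> \<G> \<and> card (verts G) = n}"
    then obtain G where "m = card (edges G)" "G \<in> \<G>" "card (verts G) = n" by blast
    then show "m \<in> {..n\<^sup>2}" using card_edges_le_square[OF assms, of G] by simp
  qed
qed simp

lemma ex_ge:
  assumes "\<And>G. G \<in> \<G> \<Longrightarrow> is_graph G" "G \<in> \<G>" "card (verts G) = n"
  shows "card (edges G) \<le> ex \<G> n"
  unfolding ex_def using finite_ex_set[OF assms(1)] assms(2,3) by (intro Max_ge) auto

lemma ex_attained:
  assumes "\<And>G. G \<in> \<G> \<Longrightarrow> is_graph G" "G \<in> \<G>" "card (verts G) = n"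
  obtains H where "H \<in> \<G>" "card (verts H) = n" "card (edges H) = ex \<G> n"
proof -
  have "ex \<G> n \<in> {card (edges G) | G. G \<in> \<G> \<and> card (verts G) = n}"
    unfolding ex_def using finite_ex_set[OF assms(1)] assms(2,3) by (intro Max_in) auto
  then show ?thesis using that by auto
qed

lemma isomorphic_sym:
  assumes "G \<cong>\<^sub>g H" "is_graph G"
  shows "H \<cong>\<^sub>g G"
proof -
  obtain f where f: "bij_betw f (verts G) (verts H)" "edges H = (\<lambda>e. f ` e) ` edges G"
    using assms(1) unfolding isomorphic_def by blast
  let ?g = "the_inv_into (verts G) f"
  have "?g ` f ` e = e" if "e \<in> edges G" for e
  proof -
    have "e \<subseteq> verts G" using that assms(2) by (simp add: is_graph_def)
    then show ?thesis using f(1) by (auto simp: bij_betw_def image_image the_inv_into_f_f subset_iff)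
  qed
  then have "(\<lambda>e. ?g ` e) ` edges H = edges G" unfolding f(2) by (simp add: image_image)
  then show ?thesis unfolding isomorphic_def using bij_betw_the_inv_into[OF f(1)] by metis
qed

lemma isomorphic_trans:
  assumes "G \<cong>\<^sub>g H" "H \<cong>\<^sub>g K"
  shows "G \<cong>\<^sub>g K"
proof -
  obtain f where f: "bij_betw f (verts G) (verts H)" "edges H = (\<lambda>e. f ` e) ` edges G"
    using assms(1) unfolding isomorphic_def by blast
  obtain g where g: "bij_betw g (verts H) (verts K)" "edges K = (\<lambda>e. g ` e) ` edges H"
    using assms(2) unfolding isomorphic_def by blast
  have "edges K = (\<lambda>e. (g \<circ> f) ` e) ` edges G" unfolding g(2) f(2) image_image by (simp add: image_comp)
  then show ?thesis unfolding isomorphic_def using bij_betw_trans[OF f(1) g(1)] by blast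
qed

lemma isomorphic_card: "G \<cong>\<^sub>g H \<Longrightarrow> card (verts G) = card (verts H)"
  unfolding isomorphic_def using bij_betw_same_card by blast

lemma bounded_imp_finite_class:
  assumes "\<And>G. G \<in> \<G> \<Longrightarrow> is_graph G \<and> card (verts G) \<le> N"
  shows "finite_class \<G>"
proof -
  let ?R = "{(G :: nat graph, H :: nat graph). is_graph G \<and> is_graph H \<and> G \<cong>\<^sub>g H}"
  let ?S = "{H :: nat graph. verts H \<subseteq> {..<N} \<and> edges H \<subseteq> Pow {..<N}}"
  have "?S \<subseteq> (\<lambda>(V, E). \<lparr>verts = V, edges = E\<rparr>) ` (Pow {..<N} \<times> Pow (Pow {..<N}))"
  proof
    fix H assume "H \<in> ?S"
    then have "(verts H, edges H) \<in> Pow {..<N} \<times> Pow (Pow {..<N})" by auto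
    moreover have "H = (\<lambda>(V, E). \<lparr>verts = V, edges = E\<rparr>) (verts H, edges H)" by simp
    ultimately show "H \<in> (\<lambda>(V, E). \<lparr>verts = V, edges = E\<rparr>) ` (Pow {..<N} \<times> Pow (Pow {..<N}))" by (rule rev_image_eqI)
  qed
  then have fin: "finite ?S" by (rule finite_subset) simp
  have "X \<in> (\<lambda>H. ?R `` {H}) ` ?S" if X: "X \<in> \<G> // ?R" for X
  proof -
    obtain G where G: "G \<in> \<G>" "X = ?R `` {G}" using X by (rule quotientE)
    have g: "is_graph G" "card (verts G) \<le> N" using assms[OF G(1)] by auto
    obtain H :: "nat graph" where H: "is_graph H" "verts H = {..<card (verts G)}" "G \<cong>\<^sub>g H"
      using nat_copy[OF g(1)] by blast
    have "edges H \<subseteq> Pow (verts H)" using H(1) by (auto simp: is_graph_def)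
    moreover have "verts H \<subseteq> {..<N}" using H(2) g(2) by auto
    ultimately have "H \<in> ?S" by blast
    moreover have "?R `` {G} = ?R `` {H}"
      using isomorphic_trans[OF isomorphic_sym[OF H(3) g(1)]] isomorphic_trans[OF H(3)] g(1) H(1) by blast
    ultimately show ?thesis using G(2) by blast
  qed
  then have "\<G> // ?R \<subseteq> (\<lambda>H. ?R `` {H}) ` ?S" by blast
  then have "finite (\<G> // ?R)" by (rule finite_subset) (rule finite_imageI[OF fin])
  then show ?thesis by (simp add: finite_class_def)
qed

lemma unbounded_imp_not_finite_class:
  assumes "\<And>G. G \<in> \<G> \<Longrightarrow> is_graph G" and "\<And>n. \<exists>G\<in>\<G>. n \<le> card (verts G)"
  shows "\<not> finite_class \<G>"
proof
  let ?R = "{(G :: nat graph, H :: nat graph). is_graph G \<and> is_graph H \<and> G \<cong>\<^sub>g H}"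
  let ?f = "\<lambda>X. card (verts (SOME G. G \<in> X))"
  assume "finite_class \<G>"
  then have fin: "finite (?f ` (\<G> // ?R))" unfolding finite_class_def by (rule finite_imageI)
  have val: "card (verts G) \<in> ?f ` (\<G> // ?R)" if G: "G \<in> \<G>" for G
  proof -
    have "G \<cong>\<^sub>g G" unfolding isomorphic_def by (intro exI[of _ id]) simp
    then have "G \<in> ?R `` {G}" using assms(1)[OF G] by simp
    then have "(SOME H. H \<in> ?R `` {G}) \<in> ?R `` {G}" by (rule someI[of "\<lambda>H. H \<in> ?R `` {G}"])
    then have "G \<cong>\<^sub>g (SOME H. H \<in> ?R `` {G})" by blast
    then have "card (verts G) = ?f (?R `` {G})" by (rule isomorphic_card)
    moreover have "?R `` {G} \<in> \<G> // ?R" using G by (rule quotientI)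
    ultimately show ?thesis by blast
  qed
  obtain N where N: "\<forall>n\<in>?f ` (\<G> // ?R). n \<le> N" using fin finite_nat_set_iff_bounded_le by blast
  obtain G where G: "G \<in> \<G>" "N + 1 \<le> card (verts G)" using assms(2) by blast
  have "card (verts G) \<le> N" by (rule bspec[OF N val[OF G(1)]])
  then show False using G(2) by simp
qed

lemma infinite_class_all_orders:
  assumes mc: "minor_closed \<G>" and inf: "\<not> finite_class \<G>"
  obtains G where "G \<in> \<G>" "card (verts G) = n"
proof -
  have "\<exists>G\<in>\<G>. n \<le> card (verts G)"
  proof (rule ccontr)
    assume "\<not> ?thesis"
    then have "is_graph G \<and> card (verts G) \<le> n" if "G \<in> \<G>" for G
      using that minor_closedD(1)[OF mc] by force
    then show False using bounded_imp_finite_class inf by blast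
  qed
  then obtain G where G: "G \<in> \<G>" "n \<le> card (verts G)" by blast
  obtain U where U: "U \<subseteq> verts G" "card U = n" using obtain_subset_with_card_n[OF G(2)] by blast
  have "induced G U \<in> \<G>"
    using minor_closed_subgraph[OF mc G(1) subgraph_induced] minor_closedD(1)[OF mc G(1)] by blast
  then show ?thesis using that U by (simp add: verts_induced)
qed

lemma connected_minor_of_order:
  fixes G :: "'a graph"
  assumes "is_graph G" "connected_graph G" "1 \<le> n" "n \<le> card (verts G)"
  shows "\<exists>H :: 'a graph. is_graph H \<and> connected_graph H \<and> minor H G \<and> card (verts H) = n"
  using assms
proof (induction "card (verts G)" arbitrary: G rule: less_induct)
  case less
  note G = less.prems(1)
  show ?case
  proof (cases "card (verts G) = n")
    case True
    then show ?thesis using less.prems(1,2) minor_refl[OF G] by (intro exI[of _ G]) simp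
  next
    case False
    obtain a where a: "a \<in> verts G" using connected_nonempty[OF less.prems(2)] by blast
    have "{a} \<noteq> verts G"
    proof
      assume "{a} = verts G"
      then have "card (verts G) = card {a}" by simp
      then show False using False less.prems by simp
    qed
    moreover have "{a} \<subseteq> verts G" "{a} \<noteq> {}" using a by auto
    ultimately obtain x y where xy: "{x, y} \<in> edges G"
      using connected_crossing[OF G less.prems(2), of "{a}"] by metis
    have c: "card (verts (contract G x y)) + 1 = card (verts G)" by (rule card_verts_contract[OF G xy])
    then obtain H :: "'a graph" where H: "is_graph H" "connected_graph H" "minor H (contract G x y)" "card (verts H) = n"
      using less.hyps[OF _ is_graph_contract[OF G xy] connected_contract[OF G xy less.prems(2)]] False less.prems by force
    then show ?thesis
      using minor_trans[OF H(3) contract_minor[OF G xy] is_graph_contract[OF G xy] G H(1)] by blast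
  qed
qed

lemma connected_card_edges:
  assumes "is_graph G" "connected_graph G"
  shows "card (verts G) \<le> card (edges G) + 1"
  using assms
proof (induction "card (verts G)" arbitrary: G rule: less_induct)
  case less
  note G = less.prems(1)
  show ?case
  proof (cases "edges G = {}")
    case True
    obtain a where a: "a \<in> verts G" using connected_nonempty[OF less.prems(2)] by blast
    have "{a} = verts G"
    proof (rule ccontr)
      assume "{a} \<noteq> verts G"
      moreover have "{a} \<subseteq> verts G" "{a} \<noteq> {}" using a by auto
      ultimately obtain x y where "{x, y} \<in> edges G"
        using connected_crossing[OF G less.prems(2), of "{a}"] by metis
      then show False using True by blast
    qed
    then have "card (verts G) = card {a}" by simp
    then show ?thesis by simp
  next
    case False
    then obtain x y where xy: "{x, y} \<in> edges G" using edge_in_graphE[OF G] by (metis ex_in_conv)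
    have c: "card (verts (contract G x y)) + 1 = card (verts G)" by (rule card_verts_contract[OF G xy])
    then have "card (verts (contract G x y)) \<le> card (edges (contract G x y)) + 1"
      by (intro less.hyps is_graph_contract[OF G xy] connected_contract[OF G xy less.prems(2)]) simp
    then show ?thesis using c card_edges_contract[OF G xy] by linarith
  qed
qed

text \<open>
  A largest subfamily of total size at most \<open>n\<close> cannot be extended, so it misses \<open>n\<close> by at most \<open>L\<close>.
\<close>

lemma subfamily_of_bounded_sets:
  assumes P: "finite P" "\<And>C. C \<in> P \<Longrightarrow> finite C \<and> C \<noteq> {} \<and> card C \<le> L"
    and disj: "\<And>C D. C \<in> P \<Longrightarrow> D \<in> P \<Longrightarrow> C \<noteq> D \<Longrightarrow> C \<inter> D = {}" and n: "n \<le> card P"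
  obtains Q where "Q \<subseteq> P" "(\<Sum>C\<in>Q. card C) \<le> n" "n \<le> (\<Sum>C\<in>Q. card C) + L"
proof -
  let ?ok = "\<lambda>Q. Q \<subseteq> P \<and> (\<Sum>C\<in>Q. card C) \<le> n"
  have "card Q < card P + 1" if "?ok Q" for Q using that card_mono[OF P(1), of Q] by simp
  then obtain Q where Q: "?ok Q" "\<And>R. ?ok R \<Longrightarrow> card R \<le> card Q"
    using ex_has_greatest_nat[of ?ok "{}" card "card P + 1"] by (metis (no_types, lifting) empty_subsetI less_imp_le sum.empty zero_le)
  have "n \<le> (\<Sum>C\<in>Q. card C) + L"
  proof (cases "Q = P")
    case True
    have "(\<Sum>C\<in>P. 1) \<le> (\<Sum>C\<in>P. card C)"
    proof (rule sum_mono)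
      fix C assume "C \<in> P"
      then show "1 \<le> card C" using P(2)[of C] by (simp add: Suc_le_eq card_gt_0_iff)
    qed
    then show ?thesis using n True by simp
  next
    case False
    then obtain C where C: "C \<in> P" "C \<notin> Q" using Q(1) by blast
    have fQ: "finite Q" using Q(1) P(1) finite_subset by blast
    have "\<not> ?ok (insert C Q)"
    proof
      assume "?ok (insert C Q)"
      then have "card (insert C Q) \<le> card Q" by (rule Q(2))
      then show False using C(2) fQ by simp
    qed
    then have "n < (\<Sum>D\<in>insert C Q. card D)" using Q(1) C(1) by auto
    then show ?thesis using P(2)[OF C(1)] C(2) fQ by simp
  qed
  then show ?thesis using that Q(1) by blast
qed

text \<open>
  Large connected members have density at most \<open>s\<close>, so a density above \<open>d > s\<close> at a huge order
  comes from components of at most \<open>L\<close> vertices that are denser than \<open>s\<close>. There are many of them,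
  since each contributes a bounded amount, and suitably many of them, filled up with
  arbitrary vertices, have \<open>n\<close> vertices.
\<close>

lemma dense_at_all_orders_from_components:
  fixes s d :: real and n L :: nat
  assumes mc: "minor_closed \<G>" and large: "\<And>H. H \<in> \<G> \<Longrightarrow> connected_graph H \<Longrightarrow> L < card (verts H) \<Longrightarrow>
      real (card (edges H)) \<le> s * card (verts H)"
    and d: "0 \<le> s" "s < d" and often: "\<And>m. \<exists>N\<ge>m. d * N < ex \<G> N" and inf: "\<not> finite_class \<G>"
  shows "s * (real n - L) \<le> ex \<G> n"
proof -
  have g: "is_graph G" if "G \<in> \<G>" for G using minor_closedD(1)[OF mc that] .
  obtain N where N: "max n (nat \<lceil>real n * (real L)\<^sup>2 / (d - s)\<rceil>) \<le> N" "d * N < ex \<G> N" using often by blast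
  obtain G0 where "G0 \<in> \<G>" "card (verts G0) = N" using infinite_class_all_orders[OF mc inf] by blast
  then obtain G where G: "G \<in> \<G>" "card (verts G) = N" "card (edges G) = ex \<G> N"
    using ex_attained[of \<G> G0 N] g by blast
  note gG = g[OF G(1)]
  let ?e = "\<lambda>C. card (edges (induced G C))"
  let ?w = "\<lambda>C. real (?e C) - s * card C"
  let ?P = "{C \<in> components G. 0 < ?w C}"
  have fC: "finite (components G)" by (rule finite_components[OF gG])
  have VC: "verts (induced G C) = C" if "C \<in> components G" for C
    using component_facts(2)[OF gG that] by (simp add: verts_induced)
  have small: "card C \<le> L" if C: "C \<in> ?P" for C
  proof (rule ccontr)
    assume "\<not> card C \<le> L"
    then have "real (?e C) \<le> s * card C"
      using large[of "induced G C"] minor_closed_subgraph[OF mc G(1) subgraph_induced[OF gG]]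
        component_facts(4)[OF gG] C VC by force
    then show False using C by simp
  qed
  have wle: "?w C \<le> (real L)\<^sup>2" if C: "C \<in> ?P" for C
  proof -
    have "?e C \<le> (card C)\<^sup>2" using card_edges_le_square[OF is_graph_induced[OF gG, of C]] VC C by simp
    also have "\<dots> \<le> L\<^sup>2" using small[OF C] by (rule power_mono) simp
    finally have "real (?e C) \<le> (real L)\<^sup>2" by (metis of_nat_le_iff of_nat_power)
    moreover have "0 \<le> s * card C" using d(1) by simp
    ultimately show ?thesis by linarith
  qed
  have "(d - s) * N < real (card (edges G)) - s * card (verts G)"
    using N(2) G(2,3) by (simp add: algebra_simps)
  also have "\<dots> = (\<Sum>C\<in>components G. ?w C)"
    unfolding card_components_sum[OF gG] by (simp add: sum_subtractf sum_distrib_left)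
  also have "\<dots> \<le> (\<Sum>C\<in>components G. if 0 < ?w C then ?w C else 0)" by (rule sum_mono) simp
  also have "\<dots> = (\<Sum>C\<in>?P. ?w C)" using fC by (simp add: sum.inter_filter)
  also have "\<dots> \<le> (\<Sum>C\<in>?P. (real L)\<^sup>2)" by (rule sum_mono) (rule wle)
  also have "\<dots> = real (card ?P) * (real L)\<^sup>2" by simp
  finally have lt: "(d - s) * N < real (card ?P) * (real L)\<^sup>2" .
  have "real n * (real L)\<^sup>2 / (d - s) \<le> N" using N(1) by linarith
  then have "real n * (real L)\<^sup>2 \<le> (d - s) * N" using d(2) by (simp add: field_simps)
  then have "real n * (real L)\<^sup>2 < real (card ?P) * (real L)\<^sup>2" using lt by linarith
  then have "real n < real (card ?P)" by (rule mult_right_less_imp_less) simp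
  then have nP: "n \<le> card ?P" by simp
  have fP: "finite ?P" using fC by simp
  obtain Q where Q: "Q \<subseteq> ?P" "(\<Sum>C\<in>Q. card C) \<le> n" "n \<le> (\<Sum>C\<in>Q. card C) + L"
  proof (rule subfamily_of_bounded_sets[OF fP _ _ nP, of L])
    fix C assume C: "C \<in> ?P"
    then have "C \<subseteq> verts G" "C \<noteq> {}" using component_facts(2)[OF gG] by auto
    then show "finite C \<and> C \<noteq> {} \<and> card C \<le> L" using small[OF C] finite_subset finite_verts[OF gG] by blast
  next
    fix C D assume "C \<in> ?P" "D \<in> ?P" "C \<noteq> D"
    then show "C \<inter> D = {}" using component_facts(3)[OF gG] by blast
  qed
  have QC: "C \<in> components G" if "C \<in> Q" for C using Q(1) that by blast
  have fQ: "finite Q" using Q(1) fP finite_subset by blast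
  have cQ: "card (\<Union>Q) = (\<Sum>C\<in>Q. card C)"
  proof -
    have "card (\<Union>C\<in>Q. C) = (\<Sum>C\<in>Q. card C)"
    proof (rule card_UN_disjoint[OF fQ])
      show "\<forall>C\<in>Q. finite C"
        using component_facts(2)[OF gG] QC finite_subset[OF _ finite_verts[OF gG]] by blast
      show "\<forall>C\<in>Q. \<forall>D\<in>Q. C \<noteq> D \<longrightarrow> C \<inter> D = {}"
        using component_facts(3)[OF gG] QC by blast
    qed
    then show ?thesis by simp
  qed
  have "\<Union>Q \<subseteq> verts G" using component_facts(2)[OF gG] QC by blast
  moreover have "n \<le> card (verts G)" using N(1) G(2) by simp
  ultimately obtain U where U: "\<Union>Q \<subseteq> U" "U \<subseteq> verts G" "card U = n"
    using exists_subset_between[of "\<Union>Q" n "verts G"] cQ Q(2) finite_verts[OF gG] by metis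
  have "(\<Sum>C\<in>Q. ?e C) = card (\<Union>C\<in>Q. edges (induced G C))"
    using component_edges_disjoint[OF gG] QC finite_edges[OF is_graph_induced[OF gG]]
    by (intro card_UN_disjoint[OF fQ, symmetric]) blast+
  also have "\<dots> \<le> card (edges (induced G U))"
  proof (rule card_mono)
    show "finite (edges (induced G U))" by (rule finite_edges[OF is_graph_induced[OF gG]])
    show "(\<Union>C\<in>Q. edges (induced G C)) \<subseteq> edges (induced G U)" unfolding edges_induced using U(1) by blast
  qed
  also have "\<dots> \<le> ex \<G> n"
    using ex_ge[of \<G> "induced G U" n] g minor_closed_subgraph[OF mc G(1) subgraph_induced[OF gG]] U(2,3)
    by (simp add: verts_induced)
  finally have "real (\<Sum>C\<in>Q. ?e C) \<le> ex \<G> n" by (simp only: of_nat_le_iff)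
  moreover have "s * (\<Sum>C\<in>Q. real (card C)) \<le> (\<Sum>C\<in>Q. real (?e C))"
    unfolding sum_distrib_left using Q(1) by (intro sum_mono) auto
  moreover have "s * (real n - L) \<le> s * (\<Sum>C\<in>Q. real (card C))"
    using Q(3) d(1) by (intro mult_left_mono) (simp_all flip: of_nat_sum)
  ultimately show ?thesis by simp
qed

text \<open>
  For an intermediate density \<open>s\<close> there are three cases. If \<open>s > 1\<close>, then large connected members have
  density at most \<open>s\<close>, by the assumption on their edges. If the connected members have bounded order,
  there are no large ones. Otherwise \<open>s \<le> 1\<close> and there are connected members of every order, and these
  have at least the edges of a tree.
\<close>

lemma density_lower_bound_persists:
  fixes t d :: real and c :: nat
  assumes mc: "minor_closed \<G>" and inf: "\<not> finite_class \<G>"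
    and c: "\<And>G. G \<in> \<G> \<Longrightarrow> connected_graph G \<Longrightarrow> card (edges G) \<le> card (verts G) + c"
    and d: "0 \<le> t" "t < d" and often: "\<And>m. \<exists>N\<ge>m. d * N < ex \<G> N"
  shows "eventually (\<lambda>n. t \<le> real (ex \<G> n) / n) sequentially"
proof -
  have g: "is_graph G" if "G \<in> \<G>" for G using minor_closedD(1)[OF mc that] .
  define s where "s = (t + d) / 2"
  have s: "0 < s" "t < s" "s < d" using d by (auto simp: s_def)
  have tree_or_small: "(\<forall>n\<ge>1. n \<le> ex \<G> n + 1) \<and> s \<le> 1 \<or>
    (\<exists>L. \<forall>H\<in>\<G>. connected_graph H \<longrightarrow> L < card (verts H) \<longrightarrow> real (card (edges H)) \<le> s * card (verts H))"
  proof (cases "s \<le> 1")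
    case True
    show ?thesis
    proof (cases "\<exists>L. \<forall>H\<in>\<G>. connected_graph H \<longrightarrow> card (verts H) \<le> L")
      case True
      then show ?thesis by (metis leD)
    next
      case unbounded: False
      have "n \<le> ex \<G> n + 1" if n: "1 \<le> n" for n
      proof -
        obtain G where G: "G \<in> \<G>" "connected_graph G" "n \<le> card (verts G)" using unbounded by (metis nat_le_linear)
        obtain H :: "nat graph" where H: "is_graph H" "connected_graph H" "minor H G" "card (verts H) = n"
          using connected_minor_of_order[OF g[OF G(1)] G(2) n G(3)] by blast
        have "card (edges H) \<le> ex \<G> n" using ex_ge[of \<G> H n] g minor_closedD(2)[OF mc G(1) H(1,3)] H(4) by blast
        then show ?thesis using connected_card_edges[OF H(1,2)] H(4) by linarith
      qed
      then show ?thesis using True by blast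
    qed
  next
    case False
    have "real (card (edges H)) \<le> s * card (verts H)"
      if H: "H \<in> \<G>" "connected_graph H" "nat \<lceil>c / (s - 1)\<rceil> < card (verts H)" for H
    proof -
      have "c / (s - 1) \<le> card (verts H)" using H(3) by linarith
      then have "c \<le> (s - 1) * card (verts H)" using False by (simp add: field_simps)
      moreover have "real (card (edges H)) \<le> card (verts H) + c" using c[OF H(1,2)] by simp
      ultimately show ?thesis by (simp add: algebra_simps)
    qed
    then show ?thesis by blast
  qed
  then show ?thesis
  proof
    assume h: "(\<forall>n\<ge>1. n \<le> ex \<G> n + 1) \<and> s \<le> 1"
    show ?thesis
    proof (rule eventually_sequentiallyI[of "max 1 (nat \<lceil>1 / (1 - t)\<rceil>)"])
      fix n assume n: "max 1 (nat \<lceil>1 / (1 - t)\<rceil>) \<le> n"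
      have t1: "t < 1" using s h by linarith
      have "1 / (1 - t) \<le> n" using n by linarith
      then have "1 \<le> (1 - t) * n" using t1 by (simp add: field_simps)
      then have "t * n \<le> real n - 1" by (simp add: algebra_simps)
      also have "\<dots> \<le> ex \<G> n" using h n by (metis add.commute diff_le_eq max.boundedE of_nat_1 of_nat_add of_nat_le_iff)
      finally show "t \<le> real (ex \<G> n) / n" using n by (simp add: field_simps)
    qed
  next
    assume "\<exists>L. \<forall>H\<in>\<G>. connected_graph H \<longrightarrow> L < card (verts H) \<longrightarrow> real (card (edges H)) \<le> s * card (verts H)"
    then obtain L where L: "\<And>H. H \<in> \<G> \<Longrightarrow> connected_graph H \<Longrightarrow> L < card (verts H) \<Longrightarrow> real (card (edges H)) \<le> s * card (verts H)"
      by blast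
    show ?thesis
    proof (rule eventually_sequentiallyI[of "max 1 (nat \<lceil>s * L / (s - t)\<rceil>)"])
      fix n assume n: "max 1 (nat \<lceil>s * L / (s - t)\<rceil>) \<le> n"
      have "s * L / (s - t) \<le> n" using n by linarith
      then have "s * L \<le> (s - t) * n" using s by (simp add: field_simps)
      then have "t * n \<le> s * (real n - L)" by (simp add: algebra_simps)
      also have "\<dots> \<le> ex \<G> n"
        by (rule dense_at_all_orders_from_components[OF mc L less_imp_le[OF s(1)] s(3) often inf])
      finally show "t \<le> real (ex \<G> n) / n" using n by (simp add: field_simps)
    qed
  qed
qed

text \<open>
  A density that is exceeded infinitely often is, up to an arbitrarily small loss, reached at all large
  orders, so the lower limit is not smaller than the upper limit.
\<close>

lemma limiting_density_converges:
  assumes mc: "minor_closed \<G>" and inf: "\<not> finite_class \<G>"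
    and c: "\<And>G. G \<in> \<G> \<Longrightarrow> connected_graph G \<Longrightarrow> card (edges G) \<le> card (verts G) + c"
  shows "(\<lambda>n. ereal (real (ex \<G> n) / real n)) \<longlonglongrightarrow> limiting_density \<G>"
proof -
  let ?a = "\<lambda>n. real (ex \<G> n) / real n"
  let ?f = "\<lambda>n. ereal (?a n)"
  have "limsup ?f \<le> liminf ?f"
  proof (rule ccontr)
    assume "\<not> ?thesis"
    then have lt: "liminf ?f < limsup ?f" by simp
    obtain t where t: "liminf ?f < ereal t" "ereal t < limsup ?f" using ereal_dense2[OF lt] by blast
    obtain d where d: "ereal t < ereal d" "ereal d < limsup ?f" using ereal_dense2[OF t(2)] by blast
    have "0 \<le> liminf ?f" by (intro Liminf_bounded always_eventually) simp
    then have t0: "0 \<le> t" using t(1) by (metis ereal_less_eq(5) less_imp_le order_trans)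
    have often: "\<exists>N\<ge>m. d * N < ex \<G> N" for m
    proof (rule ccontr)
      assume no: "\<not> ?thesis"
      have "eventually (\<lambda>n. ?f n \<le> ereal d) sequentially"
      proof (rule eventually_sequentiallyI[of "max 1 m"])
        fix n assume n: "max 1 m \<le> n"
        then have "real (ex \<G> n) \<le> d * n" using no by (metis max.boundedE not_le)
        then show "?f n \<le> ereal d" using n by (simp add: field_simps)
      qed
      then have "limsup ?f \<le> ereal d" by (rule Limsup_bounded)
      then show False using d(2) by simp
    qed
    have "eventually (\<lambda>n. t \<le> ?a n) sequentially"
      by (rule density_lower_bound_persists[OF mc inf c t0 _ often]) (use d(1) in simp_all)
    then have "ereal t \<le> liminf ?f" by (intro Liminf_bounded) simp
    then show False using t(1) by simp
  qed
  then have "liminf ?f = limsup ?f" using Liminf_le_Limsup[of sequentially ?f] by (simp add: antisym)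
  then have conv: "?f \<longlonglongrightarrow> limsup ?f" by (simp add: tendsto_iff_Liminf_eq_Limsup)
  then have "lim ?f = limsup ?f" by (rule limI)
  then have "limiting_density \<G> = limsup ?f" using inf by (simp add: limiting_density_def)
  then show ?thesis using conv by simp
qed

lemma limiting_density_le:
  fixes \<theta> b :: real
  assumes mc: "minor_closed \<G>" and inf: "\<not> finite_class \<G>"
    and c: "\<And>G. G \<in> \<G> \<Longrightarrow> connected_graph G \<Longrightarrow> card (edges G) \<le> card (verts G) + c"
    and le: "\<And>G. G \<in> \<G> \<Longrightarrow> real (card (edges G)) \<le> \<theta> * card (verts G) + b"
  shows "limiting_density \<G> \<le> ereal \<theta>"
proof (rule LIMSEQ_le[OF limiting_density_converges[OF mc inf c]])
  have "(\<lambda>n. \<theta> + b / real n) \<longlonglongrightarrow> \<theta> + 0"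
    by (intro tendsto_add tendsto_const lim_const_over_n)
  then show "(\<lambda>n. ereal (\<theta> + b / real n)) \<longlonglongrightarrow> ereal \<theta>" by simp
  show "\<exists>N. \<forall>n\<ge>N. ereal (real (ex \<G> n) / real n) \<le> ereal (\<theta> + b / real n)"
  proof (intro exI[of _ 1] allI impI)
    fix n :: nat assume n: "1 \<le> n"
    obtain G0 where G0: "G0 \<in> \<G>" "card (verts G0) = n" using infinite_class_all_orders[OF mc inf] by blast
    obtain G where "G \<in> \<G>" "card (verts G) = n" "card (edges G) = ex \<G> n"
      using ex_attained[OF minor_closedD(1)[OF mc] G0] by blast
    then have "real (ex \<G> n) \<le> \<theta> * n + b" using le by metis
    then show "ereal (real (ex \<G> n) / real n) \<le> ereal (\<theta> + b / real n)" using n by (simp add: field_simps)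
  qed
qed

lemma limiting_density_eq:
  fixes r b :: real
  assumes gr: "\<And>G. G \<in> \<G> \<Longrightarrow> is_graph G"
    and le: "\<And>G. G \<in> \<G> \<Longrightarrow> real (card (edges G)) \<le> r * card (verts G)"
    and ge: "\<And>n. \<exists>G\<in>\<G>. card (verts G) = n \<and> r * n - b \<le> real (card (edges G))"
  shows "limiting_density \<G> = ereal r"
proof -
  have inf: "\<not> finite_class \<G>"
    by (rule unbounded_imp_not_finite_class[OF gr]) (use ge in \<open>auto, metis order_refl\<close>)
  have bounds: "r * n - b \<le> ex \<G> n \<and> ex \<G> n \<le> r * n" for n
  proof -
    obtain G0 where G0: "G0 \<in> \<G>" "card (verts G0) = n" "r * n - b \<le> real (card (edges G0))" using ge by blast
    obtain G where G: "G \<in> \<G>" "card (verts G) = n" "card (edges G) = ex \<G> n"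
      using ex_attained[OF gr G0(1,2)] by blast
    have "real (ex \<G> n) \<le> r * n" using le[OF G(1)] G(2,3) by simp
    moreover have "card (edges G0) \<le> ex \<G> n" using ex_ge[OF gr G0(1,2)] .
    ultimately show ?thesis using G0(3) by linarith
  qed
  have "(\<lambda>n. real (ex \<G> n) / real n) \<longlonglongrightarrow> r"
  proof (rule tendsto_sandwich)
    show "eventually (\<lambda>n. r - b / real n \<le> real (ex \<G> n) / real n) sequentially"
      "eventually (\<lambda>n. real (ex \<G> n) / real n \<le> r) sequentially"
      using bounds by (auto intro!: eventually_sequentiallyI[of 1] simp: field_simps)
    have "(\<lambda>n. r - b / real n) \<longlonglongrightarrow> r - 0"
      by (intro tendsto_diff tendsto_const lim_const_over_n)
    then show "(\<lambda>n. r - b / real n) \<longlonglongrightarrow> r" by simp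
  qed simp
  then have "(\<lambda>n. ereal (real (ex \<G> n) / real n)) \<longlonglongrightarrow> ereal r" by simp
  then have "lim (\<lambda>n. ereal (real (ex \<G> n) / real n)) = ereal r" by (rule limI)
  then show ?thesis using inf by (simp add: limiting_density_def)
qed

section \<open>Classes with boundedly many dense components\<close>

lemma copies_minorI:
  fixes A :: "'b graph"
  assumes G: "is_graph G" and A: "\<And>i. i < k \<Longrightarrow> minor A (induced G (f i))" and f: "\<And>i. i < k \<Longrightarrow> f i \<subseteq> verts G"
    and disj: "\<And>i j. i < k \<Longrightarrow> j < k \<Longrightarrow> i \<noteq> j \<Longrightarrow> f i \<inter> f j = {}"
  shows "minor (copies k A) G"
proof -
  have "\<exists>\<mu>. model A (induced G (f i)) \<mu>" if "i < k" for i using A[OF that] unfolding minor_iff_model .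
  then obtain M where M: "\<And>i. i < k \<Longrightarrow> model A (induced G (f i)) (M i)" by metis
  have sub: "M i u \<subseteq> f i" if "i < k" "u \<in> verts A" for i u
    using modelD(1)[OF M[OF that(1)] that(2)] verts_induced[OF f[OF that(1)]] by simp
  have "model (copies k A) G (\<lambda>p. M (fst p) (snd p))"
  proof (rule modelI)
    fix p assume "p \<in> verts (copies k A)"
    then have p: "fst p < k" "snd p \<in> verts A" by (auto simp: copies_def)
    show "M (fst p) (snd p) \<subseteq> verts G" using sub[OF p] f[OF p(1)] by blast
    show "connected_set G (M (fst p) (snd p))"
      using modelD(2)[OF M[OF p(1)] p(2)] induced_induced[OF sub[OF p], of G] by simp
  next
    fix p q assume "p \<in> verts (copies k A)" "q \<in> verts (copies k A)" and ne: "p \<noteq> q"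
    then have p: "fst p < k" "snd p \<in> verts A" and q: "fst q < k" "snd q \<in> verts A" by (auto simp: copies_def)
    show "M (fst p) (snd p) \<inter> M (fst q) (snd q) = {}"
    proof (cases "fst p = fst q")
      case True
      then have "snd p \<noteq> snd q" using ne by (simp add: prod_eq_iff)
      then show ?thesis using modelD(4)[OF M[OF p(1)] p(2) q(2)] True by simp
    next
      case False
      then show ?thesis using disj[OF p(1) q(1)] sub[OF p] sub[OF q] by blast
    qed
  next
    fix p q assume "{p, q} \<in> edges (copies k A)"
    then obtain i e where ie: "{p, q} = {i} \<times> e" "i < k" "e \<in> edges A" by (auto simp: copies_def)
    have "fst p = i" "fst q = i" using ie(1) by (metis insertI1 mem_Sigma_iff prod.collapse singletonD insertI2)+
    moreover have "{snd p, snd q} = e"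
    proof -
      have "snd ` {p, q} = e" unfolding ie(1) by force
      then show ?thesis by simp
    qed
    ultimately show "\<exists>x\<in>M (fst p) (snd p). \<exists>y\<in>M (fst q) (snd q). {x, y} \<in> edges G"
      using modelD(5)[OF M[OF ie(2)], of "snd p" "snd q"] ie(3) by (auto simp: edges_induced)
  qed
  then show ?thesis unfolding minor_iff_model by blast
qed

text \<open>
  A component that is not dense has at most \<open>(3n - 1)/2\<close> edges if it is small, and not much more than
  \<open>n\<close> edges if it is large, so its density stays below 3/2 by a constant; the dense components are
  bounded in number and exceed this bound by a constant each.
\<close>

lemma density_bounded_away:
  fixes k :: "'b graph \<Rightarrow> nat" and \<S> :: "'b graph set"
  assumes mc: "minor_closed \<G>"
    and c: "\<And>G. G \<in> \<G> \<Longrightarrow> connected_graph G \<Longrightarrow> card (edges G) \<le> card (verts G) + c"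
    and S: "finite \<S>" "\<And>A G. A \<in> \<S> \<Longrightarrow> G \<in> \<G> \<Longrightarrow> \<not> minor (copies (k A) A) G"
    and dense: "\<And>H. H \<in> \<G> \<Longrightarrow> connected_graph H \<Longrightarrow> dense H \<Longrightarrow> \<exists>A\<in>\<S>. minor A H"
    and G: "G \<in> \<G>"
  shows "real (card (edges G)) \<le> (3/2 - 1 / (8 * real c + 8)) * card (verts G) + real c * (\<Sum>A\<in>\<S>. k A)"
proof -
  note gG = minor_closedD(1)[OF mc G]
  let ?e = "\<lambda>C. card (edges (induced G C))" and ?\<theta> = "3/2 - 1 / (8 * real c + 8)"
  let ?B = "{C \<in> components G. dense (induced G C)}"
  have fC: "finite (components G)" by (rule finite_components[OF gG])
  have comp: "induced G C \<in> \<G> \<and> connected_graph (induced G C) \<and> verts (induced G C) = C"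
    if "C \<in> components G" for C
    using component_facts(2,4)[OF gG that] minor_closed_subgraph[OF mc G subgraph_induced[OF gG]]
    by (auto simp: verts_induced)
  have \<theta>: "11/8 \<le> ?\<theta>" by (simp add: field_simps)
  have e_le: "real (?e C) \<le> card C + c" if "C \<in> components G" for C
    using c[of "induced G C"] comp[OF that] by (metis of_nat_add of_nat_le_iff)
  have good: "real (?e C) \<le> ?\<theta> * card C" if C: "C \<in> components G" "\<not> dense (induced G C)" for C
  proof (cases "card C \<le> 4 * (c + 1)")
    case True
    have "2 * ?e C + 1 \<le> 3 * card C" using C(2) comp[OF C(1)] unfolding dense_def by simp
    then have "2 * real (?e C) + 1 \<le> 3 * real (card C)" by linarith
    moreover have "real (card C) / (8 * real c + 8) \<le> 1 / 2"
    proof -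
      have "real (card C) \<le> real (4 * (c + 1))" using True by (simp only: of_nat_le_iff)
      then show ?thesis by (simp add: field_simps)
    qed
    moreover have "?\<theta> * card C = 3/2 * real (card C) - real (card C) / (8 * real c + 8)"
      by (simp add: left_diff_distrib)
    ultimately show ?thesis by linarith
  next
    case False
    then have "4 * c \<le> card C" by simp
    then have "real (4 * c) \<le> real (card C)" by (simp only: of_nat_le_iff)
    then have "real c \<le> real (card C) / 4" by simp
    then have "real (?e C) \<le> 5/4 * card C" using e_le[OF C(1)] by linarith
    also have "\<dots> \<le> ?\<theta> * card C" using \<theta> by (intro mult_right_mono) linarith+
    finally show ?thesis .
  qed
  have bad: "real (?e C) \<le> ?\<theta> * card C + c" if C: "C \<in> components G" for C
  proof -
    have "1 * real (card C) \<le> ?\<theta> * card C" using \<theta> by (intro mult_right_mono) linarith+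
    then show ?thesis using e_le[OF C] by linarith
  qed
  have few: "card {C \<in> components G. minor A (induced G C)} \<le> k A" if A: "A \<in> \<S>" for A
  proof (rule ccontr)
    assume "\<not> ?thesis"
    then have "k A \<le> card {C \<in> components G. minor A (induced G C)}" by simp
    then obtain Q where Q: "Q \<subseteq> {C \<in> components G. minor A (induced G C)}" "card Q = k A" "finite Q"
      by (rule obtain_subset_with_card_n)
    obtain f where "bij_betw f {0..<k A} Q" using ex_bij_betw_nat_finite[OF Q(3)] Q(2) by auto
    then have f: "inj_on f {..<k A}" "f ` {..<k A} = Q" by (auto simp: bij_betw_def atLeast0LessThan)
    have fi: "f i \<in> components G \<and> minor A (induced G (f i))" if "i < k A" for i
      using f(2) Q(1) that by auto
    have "minor (copies (k A) A) G"
    proof (rule copies_minorI[OF gG])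
      fix i j assume "i < k A" "j < k A" "i \<noteq> j"
      moreover from this have "f i \<noteq> f j" using f(1) by (auto simp: inj_on_def)
      ultimately show "f i \<inter> f j = {}" using component_facts(3)[OF gG] fi by blast
    qed (use fi component_facts(2)[OF gG] in blast)+
    then show False using S(2)[OF A G] by blast
  qed
  have "?B \<subseteq> (\<Union>A\<in>\<S>. {C \<in> components G. minor A (induced G C)})" using dense comp by blast
  then have "card ?B \<le> card (\<Union>A\<in>\<S>. {C \<in> components G. minor A (induced G C)})"
    using S(1) fC by (intro card_mono) auto
  also have "\<dots> \<le> (\<Sum>A\<in>\<S>. card {C \<in> components G. minor A (induced G C)})" by (rule card_UN_le[OF S(1)])
  also have "\<dots> \<le> (\<Sum>A\<in>\<S>. k A)" by (rule sum_mono) (rule few)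
  finally have cB: "card ?B \<le> (\<Sum>A\<in>\<S>. k A)" .
  have "real (card (edges G)) = (\<Sum>C\<in>components G. real (?e C))" using card_components_sum(2)[OF gG] by simp
  also have "\<dots> \<le> (\<Sum>C\<in>components G. ?\<theta> * card C + (if C \<in> ?B then real c else 0))"
    using good bad by (intro sum_mono) auto
  also have "\<dots> = ?\<theta> * card (verts G) + (\<Sum>C\<in>components G. if C \<in> ?B then real c else 0)"
    using card_components_sum(1)[OF gG] by (simp add: sum.distrib sum_distrib_left)
  also have "(\<Sum>C\<in>components G. if C \<in> ?B then real c else 0) = (\<Sum>C\<in>?B. real c)"
    using fC by (intro sum.mono_neutral_cong_right) auto
  also have "\<dots> = real c * card ?B" by simp
  also have "?\<theta> * card (verts G) + real c * card ?B \<le> ?\<theta> * card (verts G) + real c * (\<Sum>A\<in>\<S>. k A)"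
    using cB by (intro add_left_mono mult_left_mono) (simp_all flip: of_nat_sum)
  finally show ?thesis by simp
qed

section \<open>Classes generated by a family of graphs\<close>

lemma minors_of_family_minor_closed:
  assumes "\<And>k. is_graph (F k)"
  shows "minor_closed (minors_of_family F)"
  unfolding minor_closed_def minors_of_family_def using minor_trans[OF _ _ _ assms] by blast

lemma minors_of_family_not_subset:
  assumes F: "\<And>k. is_graph (F k)" and mc: "minor_closed \<G>" and "\<not> minors_of_family F \<subseteq> \<G>"
  obtains k where "1 \<le> k" "\<forall>G\<in>\<G>. \<not> minor (F k) G"
proof -
  obtain H k where H: "is_graph H" "1 \<le> k" "minor H (F k)" "H \<notin> \<G>"
    using assms(3) unfolding minors_of_family_def by blast
  have "\<not> minor (F k) G" if G: "G \<in> \<G>" for G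
  proof
    assume "minor (F k) G"
    then have "minor H G" using minor_trans[OF H(3) _ F minor_closedD(1)[OF mc G] H(1)] by blast
    then show False using minor_closedD(2)[OF mc G H(1)] H(4) by blast
  qed
  then show ?thesis using that H(2) by blast
qed

lemma minors_of_family_subsetD:
  assumes F: "\<And>k. is_graph (F k)" and F': "\<And>k. is_graph (F' k)"
    and sub: "minors_of_family F \<subseteq> minors_of_family F'" and j: "1 \<le> j"
  obtains k where "minor (F j) (F' k)"
proof -
  obtain H :: "nat graph" where H: "is_graph H" "minor H (F j)" "minor (F j) H" using nat_copy[OF F] by metis
  then have "H \<in> minors_of_family F" using j unfolding minors_of_family_def by blast
  then obtain k where "minor H (F' k)" using sub unfolding minors_of_family_def by blast
  then show ?thesis using that minor_trans[OF H(3) _ H(1) F' F] by blast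
qed

lemma minors_of_family_subsetI:
  assumes F: "\<And>k. is_graph (F k)" and F': "\<And>k. is_graph (F' k)"
    and m: "\<And>k. 1 \<le> k \<Longrightarrow> minor (F k) (F' k)"
  shows "minors_of_family F \<subseteq> minors_of_family F'"
  unfolding minors_of_family_def using minor_trans[OF _ m F F'] by blast

lemma excess_bounded_minor:
  fixes H :: "'b graph"
  assumes b: "excess_bounded G c" and H: "is_graph H" "connected_graph H" "minor H G" and G: "is_graph G"
  shows "excess H \<le> c"
proof -
  obtain K :: "nat graph" where K: "is_graph K" "minor K H" "verts K = {..<card (verts H)}"
    "card (edges K) = card (edges H)" "H \<cong>\<^sub>g K" using nat_copy[OF H(1)] by metis
  have "excess K \<le> c"
    using b K(1) isomorphic_connected[OF K(5) H(1) K(1) H(2)] minor_trans[OF K(2) H(3) H(1) G K(1)]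
    unfolding excess_bounded_def by blast
  then show ?thesis using K(3,4) by (simp add: excess_def)
qed

text \<open>Summing over the components, an excess of at most 3 of every connected minor bounds the density by 3/2.\<close>

lemma minors_of_family_edges:
  assumes F: "\<And>k. is_graph (F k)" and b: "\<And>k. excess_bounded (F k) 3" and G: "G \<in> minors_of_family F"
  shows "2 * card (edges G) \<le> 3 * card (verts G)"
proof -
  obtain k where gG: "is_graph G" and k: "minor G (F k)" using G unfolding minors_of_family_def by blast
  have "2 * card (edges (induced G C)) \<le> 3 * card C" if C: "C \<in> components G" for C
  proof -
    have sub: "subgraph (induced G C) G" by (rule subgraph_induced[OF gG])
    then have "minor (induced G C) (F k)"
      using minor_trans[OF subgraph_minor[OF gG sub] k gG F] by (simp add: subgraph_def)
    then have "excess (induced G C) \<le> 3"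
      using excess_bounded_minor[OF b is_graph_induced[OF gG] component_facts(4)[OF gG C] _ F] by blast
    then show ?thesis using component_facts(2)[OF gG C] by (simp add: excess_def verts_induced)
  qed
  then have "(\<Sum>C\<in>components G. 2 * card (edges (induced G C))) \<le> (\<Sum>C\<in>components G. 3 * card C)"
    by (rule sum_mono)
  then show ?thesis
    using card_components_sum[OF gG] by (simp flip: sum_distrib_left)
qed

lemma minors_of_family_member:
  assumes F: "is_graph (F K)" "1 \<le> K" and H: "subgraph H (F K)" and n: "card (verts H) \<le> n" "n \<le> card (verts (F K))"
  shows "\<exists>G\<in>minors_of_family F. card (verts G) = n \<and> card (edges H) \<le> card (edges G)"
proof -
  have VH: "verts H \<subseteq> verts (F K)" using H by (simp add: subgraph_def)
  obtain U where U: "verts H \<subseteq> U" "U \<subseteq> verts (F K)" "card U = n"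
    using exists_subset_between[OF n VH finite_verts[OF F(1)]] by blast
  let ?I = "induced (F K) U"
  have I: "is_graph ?I" by (rule is_graph_induced[OF F(1)])
  obtain G :: "nat graph" where G: "is_graph G" "minor G ?I" "verts G = {..<card (verts ?I)}"
    "card (edges G) = card (edges ?I)" using nat_copy[OF I] by metis
  have "minor G (F K)"
    using minor_trans[OF G(2) subgraph_minor[OF F(1) subgraph_induced[OF F(1)]] I F(1) G(1)] .
  then have "G \<in> minors_of_family F" using G(1) F(2) unfolding minors_of_family_def by blast
  moreover have "card (edges H) \<le> card (edges G)" unfolding G(4)
  proof (rule card_mono[OF finite_edges[OF I]])
    show "edges H \<subseteq> edges ?I" using H U(1) by (auto simp: subgraph_def edges_induced is_graph_def)
  qed
  moreover have "card (verts G) = n" using G(3) U by (simp add: verts_induced)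
  ultimately show ?thesis by blast
qed

lemma empty_subgraph: "subgraph \<lparr>verts = {}, edges = {}\<rparr> G"
  by (simp add: subgraph_def is_graph_def)

text \<open>
  The complete graph on six vertices has 15 edges.
\<close>

lemma proper_of_few_edges:
  assumes "\<And>G. G \<in> \<G> \<Longrightarrow> card (edges G) \<le> 2 * card (verts G)"
  shows "proper_class \<G>"
proof -
  have K: "is_graph (complete_graph 6)" by (auto simp: is_graph_def complete_graph_def)
  have "card (edges (complete_graph 6)) = 15"
    using n_subsets[of "{..<6::nat}" 2] by (simp add: complete_graph_def choose_two)
  then have "complete_graph 6 \<notin> \<G>" using assms[of "complete_graph 6"] by (auto simp: verts_complete)
  then show ?thesis using K unfolding proper_class_def by blast
qed

lemma not_density_below:
  assumes "limiting_density \<G> = ereal r" "c \<le> r"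
  shows "\<G> \<notin> density_below c"
  using assms by (auto simp: density_below_def)

section \<open>Disjoint copies\<close>

lemma is_graph_copies:
  assumes "is_graph A"
  shows "is_graph (copies k A)"
proof -
  have "card ({i} \<times> e) = 2" "{i} \<times> e \<subseteq> {..<k} \<times> verts A" if "e \<in> edges A" "i < k" for i e
    using that assms by (auto simp: is_graph_def card_cartesian_product)
  then show ?thesis using assms by (auto simp: is_graph_def copies_def)
qed

lemma copies_edgeD:
  assumes "{p, q} \<in> edges (copies k A)"
  shows "fst p = fst q" "{snd p, snd q} \<in> edges A"
proof -
  obtain i e where ie: "{p, q} = {i} \<times> e" "e \<in> edges A" using assms by (auto simp: copies_def)
  have "p \<in> {i} \<times> e" "q \<in> {i} \<times> e" using ie(1) by blast+
  then show "fst p = fst q" by auto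
  have "snd ` {p, q} = e" unfolding ie(1) by force
  then show "{snd p, snd q} \<in> edges A" using ie(2) by simp
qed

lemma card_copies:
  assumes "is_graph A"
  shows "card (verts (copies k A)) = k * card (verts A)" "card (edges (copies k A)) = k * card (edges A)"
proof -
  show "card (verts (copies k A)) = k * card (verts A)" by (simp add: copies_def card_cartesian_product)
  have "edges (copies k A) = (\<lambda>(i, e). {i} \<times> e) ` ({..<k} \<times> edges A)" by (auto simp: copies_def)
  moreover have "inj_on (\<lambda>(i, e). {i} \<times> e) ({..<k} \<times> edges A)"
  proof (rule inj_onI, clarify)
    fix i e j d assume h: "e \<in> edges A" "d \<in> edges A" "{i} \<times> e = {j} \<times> d"
    have "e \<noteq> {}" using h(1) assms by (auto simp: is_graph_def)
    then show "i = j \<and> e = d" using h(3) by (metis times_eq_iff singleton_inject insert_not_empty)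
  qed
  ultimately show "card (edges (copies k A)) = k * card (edges A)"
    by (simp add: card_image card_cartesian_product)
qed

lemma copies_mono: "is_graph A \<Longrightarrow> j \<le> k \<Longrightarrow> subgraph (copies j A) (copies k A)"
proof -
  assume h: "is_graph A" "j \<le> k"
  have "edges (copies j A) \<subseteq> edges (copies k A)"
  proof
    fix d assume "d \<in> edges (copies j A)"
    then obtain i e where "d = {i} \<times> e" "i < j" "e \<in> edges A" unfolding copies_def by auto
    moreover from this have "i < k" using h(2) by simp
    ultimately show "d \<in> edges (copies k A)" unfolding copies_def graph.select_convs by blast
  qed
  moreover have "verts (copies j A) \<subseteq> verts (copies k A)" using h(2) by (auto simp: copies_def)
  ultimately show ?thesis using is_graph_copies[OF h(1)] by (simp add: subgraph_def)
qed

lemma copy_minor: 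
  assumes A: "is_graph A" and i: "i < k"
  shows "minor A (induced (copies k A) ({i} \<times> verts A))" "minor (induced (copies k A) ({i} \<times> verts A)) A"
proof -
  let ?I = "induced (copies k A) ({i} \<times> verts A)"
  have V: "verts ?I = {i} \<times> verts A" using i by (intro verts_induced) (auto simp: copies_def)
  show "minor A ?I"
  proof (rule embedding_minor_image[of _ "Pair i"])
    show "is_graph ?I" by (rule is_graph_induced[OF is_graph_copies[OF A]])
    show "Pair i ` e \<in> edges ?I" if e: "e \<in> edges A" for e
    proof -
      have "Pair i ` e = {i} \<times> e" by auto
      moreover have "{i} \<times> e \<in> edges (copies k A)" using e i by (auto simp: copies_def)
      moreover have "e \<subseteq> verts A" using A e by (simp add: is_graph_def)
      ultimately show ?thesis by (auto simp: edges_induced)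
    qed
  qed (auto simp: V inj_on_def)
  show "minor ?I A"
  proof (rule embedding_minor[OF A, of snd])
    show "{snd p, snd q} \<in> edges A" if "{p, q} \<in> edges ?I" for p q
      using that copies_edgeD(2)[of p q k A] by (simp add: edges_induced)
  qed (auto simp: V inj_on_def)
qed

lemma minor_copies:
  assumes A: "is_graph A" and k: "1 \<le> k"
  shows "minor A (copies k A)"
proof -
  note C = is_graph_copies[OF A, of k]
  have "minor A (induced (copies k A) ({0} \<times> verts A))" by (rule copy_minor(1)[OF A]) (use k in simp)
  then show ?thesis
    by (rule minor_trans[OF _ subgraph_minor[OF C subgraph_induced[OF C]] is_graph_induced[OF C] C A])
qed

lemma connected_set_copies:
  assumes A: "is_graph A" and U: "U \<subseteq> verts (copies k A)" "connected_set (copies k A) U" and p: "p \<in> U" "q \<in> U"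
  shows "fst p = fst q"
proof (rule ccontr)
  assume ne: "fst p \<noteq> fst q"
  let ?S = "{r \<in> U. fst r = fst p}"
  have "p \<in> ?S" "q \<notin> ?S" using p ne by auto
  then have "?S \<subseteq> U" "?S \<noteq> {}" "?S \<noteq> U" using p by blast+
  then obtain x y where xy: "x \<in> ?S" "y \<in> U - ?S" "{x, y} \<in> edges (copies k A)"
    by (rule connected_set_crossing[OF is_graph_copies[OF A] U(2,1)])
  then show False using copies_edgeD(1)[OF xy(3)] by auto
qed

text \<open>
  Connected branch sets stay within one copy, and edges join branch sets in the same copy.
\<close>

lemma connected_minor_of_copies:
  fixes H :: "'b graph"
  assumes A: "is_graph A" and H: "is_graph H" "connected_graph H" "minor H (copies k A)"
  shows "minor H A"
proof -
  note gC = is_graph_copies[OF A, of k]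
  obtain \<mu> where \<mu>: "model H (copies k A) \<mu>" using H(3) unfolding minor_iff_model by blast
  obtain u0 where u0: "u0 \<in> verts H" using connected_nonempty[OF H(2)] by blast
  obtain p0 where p0: "p0 \<in> \<mu> u0" using modelD(3)[OF \<mu> u0] by blast
  let ?i = "fst p0"
  let ?S = "{u \<in> verts H. \<exists>p\<in>\<mu> u. fst p = ?i}"
  have one: "fst p = ?i" if h: "u \<in> ?S" "p \<in> \<mu> u" for u p
  proof -
    obtain q where q: "q \<in> \<mu> u" "fst q = ?i" using h(1) by blast
    have "u \<in> verts H" using h(1) by blast
    then show ?thesis using connected_set_copies[OF A modelD(1)[OF \<mu>] modelD(2)[OF \<mu>] h(2) q(1)] q(2) by simp
  qed
  have "?S = verts H"
  proof (rule ccontr)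
    assume ne: "?S \<noteq> verts H"
    have s: "?S \<subseteq> verts H" "?S \<noteq> {}" using u0 p0 by auto
    obtain u w where uw: "u \<in> ?S" "w \<in> verts H - ?S" "{u, w} \<in> edges H"
      by (rule connected_crossing[OF H(1,2) s ne])
    obtain x y where xy: "x \<in> \<mu> u" "y \<in> \<mu> w" "{x, y} \<in> edges (copies k A)" using modelD(5)[OF \<mu> uw(3)] by blast
    have "fst y = ?i" using one[OF uw(1) xy(1)] copies_edgeD(1)[OF xy(3)] by simp
    then show False using uw(2) xy(2) by blast
  qed
  then have all: "fst p = ?i" if "u \<in> verts H" "p \<in> \<mu> u" for u p using one that by metis
  let ?V = "{?i} \<times> verts A"
  have i: "?i < k" using modelD(1)[OF \<mu> u0] p0 by (auto simp: copies_def)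
  have V: "?V \<subseteq> verts (copies k A)" using i by (auto simp: copies_def)
  have sub: "\<mu> u \<subseteq> ?V" if u: "u \<in> verts H" for u
  proof
    fix p assume p: "p \<in> \<mu> u"
    then have "p \<in> {..<k} \<times> verts A" using modelD(1)[OF \<mu> u] by (auto simp: copies_def)
    then show "p \<in> ?V" using all[OF u p] by (auto simp: mem_Times_iff)
  qed
  have "model H (induced (copies k A) ?V) \<mu>"
  proof (rule modelI)
    fix u assume u: "u \<in> verts H"
    show "\<mu> u \<subseteq> verts (induced (copies k A) ?V)" using sub[OF u] verts_induced[OF V] by simp
    show "connected_set (induced (copies k A) ?V) (\<mu> u)"
      using modelD(2)[OF \<mu> u] induced_induced[OF sub[OF u], of "copies k A"] by simp
  next
    fix u w assume e: "{u, w} \<in> edges H"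
    obtain x y where xy: "x \<in> \<mu> u" "y \<in> \<mu> w" "{x, y} \<in> edges (copies k A)" using modelD(5)[OF \<mu> e] by blast
    then have "{x, y} \<subseteq> ?V" using sub edge_in_graphD[OF H(1) e] by blast
    then have "{x, y} \<in> edges (induced (copies k A) ?V)" using xy(3) by (simp add: edges_induced)
    then show "\<exists>x\<in>\<mu> u. \<exists>y\<in>\<mu> w. {x, y} \<in> edges (induced (copies k A) ?V)" using xy(1,2) by blast
  qed (rule modelD(4)[OF \<mu>])
  then have "minor H (induced (copies k A) ?V)" unfolding minor_iff_model by blast
  then show ?thesis using minor_trans[OF _ copy_minor(2)[OF A i] is_graph_induced[OF gC] A H(1)] by blast
qed

lemma copies_minor_mono:
  assumes A: "is_graph A" and B: "is_graph B" and AB: "minor A B"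
  shows "minor (copies k A) (copies k B)"
proof (rule copies_minorI[where f = "\<lambda>i. {i} \<times> verts B", OF is_graph_copies[OF B]])
  fix i assume i: "i < k"
  show "minor A (induced (copies k B) ({i} \<times> verts B))"
    using minor_trans[OF AB copy_minor(1)[OF B i] B is_graph_induced[OF is_graph_copies[OF B]] A] .
  show "{i} \<times> verts B \<subseteq> verts (copies k B)" using i by (auto simp: copies_def)
qed auto

lemma excess_bounded_copies:
  assumes "tight A"
  shows "excess_bounded (copies k A) 3"
  unfolding excess_bounded_def
proof (intro allI impI)
  fix H :: "nat graph" assume H: "is_graph H \<and> connected_graph H \<and> minor H (copies k A)"
  have A: "is_graph A" "rigid A 3" using assms by (auto simp: tight_def)
  have "minor H A" using connected_minor_of_copies[OF A(1)] H by blast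
  then show "excess H \<le> 3" using A(2) H unfolding rigid_def by blast
qed

section \<open>Daisies, chains and diamonds\<close>

lemma one_sum_triangle_step:
  assumes G: "is_graph G" and a: "a \<in> verts G" and b: "b \<notin> verts G" "c \<notin> verts G" "b \<noteq> c"
    and V: "verts G' = verts G \<union> {b, c}" and E: "edges G' = edges G \<union> {{a, b}, {a, c}, {b, c}}"
  shows "one_sum G' G \<lparr>verts = {a, b, c}, edges = {{a, b}, {a, c}, {b, c}}\<rparr> a"
  unfolding one_sum_def
proof (intro conjI G)
  let ?T = "\<lparr>verts = {a, b, c}, edges = {{a, b}, {a, c}, {b, c}}\<rparr>"
  have "a \<noteq> b" "a \<noteq> c" using a b by auto
  then show "is_graph ?T" using b(3) by (simp add: is_graph_def)
  show "verts G' = verts G \<union> verts ?T" using V a by auto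
  show "edges G' = edges G \<union> edges ?T" using E by simp
  show "verts G \<inter> verts ?T = {a}" using a b by auto
qed

lemma triangle_facts:
  assumes "a \<noteq> b" "a \<noteq> c" "b \<noteq> c"
  defines "T \<equiv> \<lparr>verts = {a, b, c}, edges = {{a, b}, {a, c}, {b, c}}\<rparr>"
  shows "connected_graph T" "excess_bounded T 0" "card (verts T) = 3" "card (edges T) = 3"
proof -
  have tt: "two_tree T" unfolding T_def by (rule two_tree_triangleI[OF assms(1-3)])
  show "connected_graph T" by (rule two_tree_connected[OF tt])
  show n: "card (verts T) = 3" using assms(1-3) by (simp add: T_def)
  show "card (edges T) = 3" using two_tree_card[OF tt] n by linarith
  show "excess_bounded T 0" by (rule excess_bounded_three_vertices[OF two_tree_graph[OF tt]]) (simp add: n)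
qed

text \<open>Daisies and chains are built from triangles by gluing at a vertex.\<close>

lemma triangle_cactus:
  fixes F :: "nat \<Rightarrow> 'a graph"
  assumes F: "\<And>k. is_graph (F k)" and start: "verts (F 0) = {r}" "edges (F 0) = {}"
    and step: "\<And>k. \<exists>a b c. a \<in> verts (F k) \<and> b \<notin> verts (F k) \<and> c \<notin> verts (F k) \<and> b \<noteq> c \<and>
      verts (F (Suc k)) = verts (F k) \<union> {b, c} \<and> edges (F (Suc k)) = edges (F k) \<union> {{a, b}, {a, c}, {b, c}}"
  shows "connected_graph (F k) \<and> excess_bounded (F k) 0 \<and> card (verts (F k)) = 2 * k + 1 \<and> card (edges (F k)) = 3 * k"
proof (induction k)
  case 0
  have "connected_set (F 0) (verts (F 0))"
    using connected_set_singleton[OF F, of r 0] start by simp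
  then show ?case
    using connected_set_verts[OF F, of 0] excess_bounded_three_vertices[OF F, of 0] start by simp
next
  case (Suc k)
  obtain a b c where s: "a \<in> verts (F k)" "b \<notin> verts (F k)" "c \<notin> verts (F k)" "b \<noteq> c"
    "verts (F (Suc k)) = verts (F k) \<union> {b, c}" "edges (F (Suc k)) = edges (F k) \<union> {{a, b}, {a, c}, {b, c}}"
    using step[of k] by (elim exE conjE) (rule that)
  let ?T = "\<lparr>verts = {a, b, c}, edges = {{a, b}, {a, c}, {b, c}}\<rparr>"
  have d: "a \<noteq> b" "a \<noteq> c" using s by auto
  have os: "one_sum (F (Suc k)) (F k) ?T a" by (rule one_sum_triangle_step[OF F s])
  note T = triangle_facts[OF d s(4)]
  have "excess_bounded (F (Suc k)) (0 + 0)"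
    using excess_bounded_one_sum[OF os _ T(2)] Suc by simp
  then show ?case
    using one_sum_connected[OF os _ T(1)] card_one_sum[OF os] T(3,4) Suc by simp
qed

lemma daisy_facts:
  "connected_graph (daisy k) \<and> excess_bounded (daisy k) 0 \<and> card (verts (daisy k)) = 2 * k + 1 \<and>
    card (edges (daisy k)) = 3 * k"
proof (rule triangle_cactus[where r = None, OF is_graph_daisy])
  show "verts (daisy 0) = {None}" "edges (daisy 0) = {}" by (auto simp: verts_daisy edges_daisy)
  fix k
  show "\<exists>a b c. a \<in> verts (daisy k) \<and> b \<notin> verts (daisy k) \<and> c \<notin> verts (daisy k) \<and> b \<noteq> c \<and>
      verts (daisy (Suc k)) = verts (daisy k) \<union> {b, c} \<and>
      edges (daisy (Suc k)) = edges (daisy k) \<union> {{a, b}, {a, c}, {b, c}}"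
    by (intro exI[of _ None] exI[of _ "Some (k, 0)"] exI[of _ "Some (k, 1)"])
      (auto simp: verts_daisy edges_daisy lessThan_Suc)
qed

lemma chain_facts:
  "connected_graph (chain k) \<and> excess_bounded (chain k) 0 \<and> card (verts (chain k)) = 2 * k + 1 \<and>
    card (edges (chain k)) = 3 * k"
proof (rule triangle_cactus[where r = "Inl 0", OF is_graph_chain])
  show "verts (chain 0) = {Inl 0}" "edges (chain 0) = {}" by (auto simp: chain_def)
  fix k
  have I: "{0..Suc k} = insert (Suc k) {0..k}" "{1..Suc k} = insert (Suc k) {1..k}" by auto
  have "verts (chain (Suc k)) = verts (chain k) \<union> {Inl (Suc k), Inr (Suc k)}"
    unfolding chain_def I by auto
  moreover have "edges (chain (Suc k)) =
      edges (chain k) \<union> {{Inl k, Inl (Suc k)}, {Inl k, Inr (Suc k)}, {Inl (Suc k), Inr (Suc k)}}"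
    unfolding chain_def I graph.select_convs UN_insert diff_Suc_1 by (rule Un_commute)
  moreover have "Inl k \<in> verts (chain k)" "Inl (Suc k) \<notin> verts (chain k)" "Inr (Suc k) \<notin> verts (chain k)"
    by (auto simp: chain_def)
  ultimately show "\<exists>a b c. a \<in> verts (chain k) \<and> b \<notin> verts (chain k) \<and> c \<notin> verts (chain k) \<and> b \<noteq> c \<and>
      verts (chain (Suc k)) = verts (chain k) \<union> {b, c} \<and>
      edges (chain (Suc k)) = edges (chain k) \<union> {{a, b}, {a, c}, {b, c}}"
    by (intro exI[of _ "Inl k"] exI[of _ "Inl (Suc k)"] exI[of _ "Inr (Suc k)"] conjI) simp_all
qed

lemma diamond_facts:
  "connected_graph (diamond k)" "card (verts (diamond k)) = k + 2" "card (edges (diamond k)) = 2 * k + 1"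
proof -
  have hubs: "range Inl = {Inl False, Inl True}" by (auto simp: UNIV_bool)
  have V: "verts (diamond k) = {Inl False, Inl True} \<union> Inr ` {..<k}" unfolding diamond_def hubs by simp
  show "card (verts (diamond k)) = k + 2"
    unfolding V by (subst card_Un_disjoint) (auto simp: card_image)
  have E: "edges (diamond k) = insert {Inl False, Inl True} ((\<lambda>(b, i). {Inl b, Inr i}) ` (UNIV \<times> {..<k}))"
    by (auto simp: diamond_def)
  have "card ((\<lambda>(b, i). {Inl b, Inr i :: bool + nat}) ` (UNIV \<times> {..<k})) = card ((UNIV :: bool set) \<times> {..<k})"
    by (rule card_image) (auto simp: inj_on_def doubleton_eq_iff)
  moreover have "{Inl False, Inl True} \<notin> (\<lambda>(b, i). {Inl b, Inr i :: bool + nat}) ` (UNIV \<times> {..<k})"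
    by (auto simp: doubleton_eq_iff)
  ultimately show "card (edges (diamond k)) = 2 * k + 1"
    unfolding E by (simp add: card_cartesian_product)
  have con: "connected_set (diamond k) ({Inl False, Inl True} \<union> Inr ` {..<j})" if "j \<le> k" for j
    using that
  proof (induction j)
    case 0
    have "{Inl False, Inl True} \<in> edges (diamond k)" by (simp add: E)
    then show ?case using connected_set_edge[OF is_graph_diamond] by simp
  next
    case (Suc j)
    let ?U = "{Inl False, Inl True} \<union> Inr ` {..<j}"
    have U: "connected_set (diamond k) ?U" "?U \<subseteq> verts (diamond k)" using Suc by (auto simp: V)
    have j: "Inr j \<in> verts (diamond k)" "{Inr j} \<subseteq> verts (diamond k)" using Suc by (auto simp: V)
    have "{Inl False, Inr j} \<in> edges (diamond k)"
      unfolding E by (intro insertI2 rev_image_eqI[of "(False, j)"]) (use Suc in auto)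
    then have "connected_set (diamond k) (?U \<union> {Inr j})"
      using connected_set_union[OF is_graph_diamond U connected_set_singleton[OF is_graph_diamond j(1)] j(2)] by blast
    moreover have "?U \<union> {Inr j} = {Inl False, Inl True} \<union> Inr ` {..<Suc j}" by (auto simp: lessThan_Suc)
    ultimately show ?case by simp
  qed
  show "connected_graph (diamond k)"
    using con[of k] connected_set_verts[OF is_graph_diamond, of k] unfolding V by simp
qed

text \<open>
  Every edge of a diamond contains a hub, so the at most two branch sets containing hubs cover the
  edges of the minor.
\<close>

lemma diamond_minor_cover:
  assumes H: "is_graph H" and m: "minor H (diamond k)"
  obtains S where "S \<subseteq> verts H" "card S \<le> 2" "\<And>e. e \<in> edges H \<Longrightarrow> e \<inter> S \<noteq> {}"
proof -
  obtain \<mu> where \<mu>: "model H (diamond k) \<mu>" using m unfolding minor_iff_model by blast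
  let ?S = "\<lambda>b. {u \<in> verts H. Inl b \<in> \<mu> u}"
  have single: "card (?S b) \<le> 1" for b
  proof -
    have "u = w" if "u \<in> ?S b" "w \<in> ?S b" for u w using that modelD(4)[OF \<mu>, of u w] by blast
    moreover have "finite (?S b)" using finite_verts[OF H] by simp
    ultimately show ?thesis using card_le_Suc0_iff_eq[of "?S b"] by (metis (no_types, lifting) One_nat_def)
  qed
  have "card (?S False \<union> ?S True) \<le> 2"
    using card_Un_le[of "?S False" "?S True"] single[of False] single[of True] by linarith
  moreover have "e \<inter> (?S False \<union> ?S True) \<noteq> {}" if e: "e \<in> edges H" for e
  proof -
    obtain u w where uw: "e = {u, w}" "u \<in> verts H" "w \<in> verts H" using edge_in_graphE[OF H e] by metis
    have "{u, w} \<in> edges H" using e uw(1) by simp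
    from modelD(5)[OF \<mu> this] obtain x y where xy: "x \<in> \<mu> u" "y \<in> \<mu> w" "{x, y} \<in> edges (diamond k)" by blast
    have "\<exists>b. Inl b \<in> {x, y}" using xy(3) by (auto simp: diamond_def)
    then obtain b where "Inl b \<in> \<mu> u \<or> Inl b \<in> \<mu> w" using xy(1,2) by blast
    then show ?thesis using uw by (cases b) auto
  qed
  moreover have "?S False \<union> ?S True \<subseteq> verts H" by blast
  ultimately show ?thesis using that by blast
qed

lemma diamond_minor_edges:
  assumes H: "is_graph H" and m: "minor H (diamond k)"
  shows "card (edges H) \<le> 2 * card (verts H)"
proof -
  obtain S where S: "S \<subseteq> verts H" "card S \<le> 2" "\<And>e. e \<in> edges H \<Longrightarrow> e \<inter> S \<noteq> {}"
    using diamond_minor_cover[OF H m] by blast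
  have fS: "finite S" using S(1) finite_verts[OF H] finite_subset by blast
  have "edges H \<subseteq> (\<Union>s\<in>S. {e \<in> edges H. s \<in> e})" using S(3) by blast
  then have "card (edges H) \<le> card (\<Union>s\<in>S. {e \<in> edges H. s \<in> e})"
    using fS finite_edges[OF H] by (intro card_mono) auto
  also have "\<dots> \<le> (\<Sum>s\<in>S. card {e \<in> edges H. s \<in> e})" by (rule card_UN_le[OF fS])
  also have "\<dots> \<le> (\<Sum>s\<in>S. card (verts H))"
  proof (rule sum_mono)
    fix s
    show "card {e \<in> edges H. s \<in> e} \<le> card (verts H)"
      unfolding card_incident_edges[OF H] by (rule card_mono[OF finite_verts[OF H] nbrs_subset[OF H]])
  qed
  also have "\<dots> \<le> 2 * card (verts H)" using S(2) by simp
  finally show ?thesis .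
qed

lemma three_disjoint_edges_not_in_diamond:
  assumes H: "is_graph H" and e: "e\<^sub>1 \<in> edges H" "e\<^sub>2 \<in> edges H" "e\<^sub>3 \<in> edges H"
    and d: "e\<^sub>1 \<inter> e\<^sub>2 = {}" "e\<^sub>1 \<inter> e\<^sub>3 = {}" "e\<^sub>2 \<inter> e\<^sub>3 = {}"
  shows "\<not> minor H (diamond k)"
proof
  assume "minor H (diamond k)"
  then obtain S where S: "S \<subseteq> verts H" "card S \<le> 2" "\<And>e. e \<in> edges H \<Longrightarrow> e \<inter> S \<noteq> {}"
    using diamond_minor_cover[OF H] by blast
  obtain x y z where xyz: "x \<in> e\<^sub>1 \<inter> S" "y \<in> e\<^sub>2 \<inter> S" "z \<in> e\<^sub>3 \<inter> S" using S(3)[OF e(1)] S(3)[OF e(2)] S(3)[OF e(3)] by blast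
  then have "x \<noteq> y" "x \<noteq> z" "y \<noteq> z" using d by blast+
  then have "card {x, y, z} = 3" by simp
  moreover have "{x, y, z} \<subseteq> S" using xyz by blast
  moreover have "finite S" using S(1) finite_verts[OF H] finite_subset by blast
  ultimately have "3 \<le> card S" using card_mono by metis
  then show False using S(2) by simp
qed

text \<open>
  Along a chain, order the vertices as \<open>p\<^sub>0, q\<^sub>1, p\<^sub>1, q\<^sub>2, \<dots>\<close>. Edges join positions at distance at most
  2, and only even positions at distance 2. A branch set adjacent to the centre of a daisy
  cannot have a vertex between the first and the last position of the centre, because there it
  would be surrounded by the centre. So it contains one of the four positions next to the centre,
  but six branch sets are adjacent to the centre of \<open>daisy 3\<close>.
\<close>

definition position :: "nat + nat \<Rightarrow> int" where
  "position x = (case x of Inl i \<Rightarrow> 2 * int i | Inr i \<Rightarrow> 2 * int i - 1)"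

lemma position_inj: "position x = position y \<Longrightarrow> x = y"
  by (cases x; cases y) (auto simp: position_def, presburger+)

lemma chain_edge_position:
  assumes "{x, y} \<in> edges (chain k)"
  shows "\<bar>position x - position y\<bar> = 1 \<or> (\<bar>position x - position y\<bar> = 2 \<and> even (position x))"
proof -
  obtain i where i: "1 \<le> i" "{x, y} = {Inl (i - 1), Inl i} \<or> {x, y} = {Inl (i - 1), Inr i} \<or> {x, y} = {Inl i, Inr i}"
    using assms unfolding edges_chain_iff by blast
  obtain j where j: "i = Suc j" using i(1) by (cases i) auto
  show ?thesis using i(2) unfolding j diff_Suc_1 by (auto simp: doubleton_eq_iff position_def)
qed

lemma daisy_not_minor_of_chain: "\<not> minor (daisy 3) (chain k)"
proof
  assume "minor (daisy 3) (chain k)"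
  then obtain \<mu> where \<mu>: "model (daisy 3) (chain k) \<mu>" unfolding minor_iff_model by blast
  note gC = is_graph_chain[of k]
  let ?L = "{..<3 :: nat} \<times> {0, 1 :: nat}"
  let ?B = "\<mu> None"
  have V: "None \<in> verts (daisy 3)" "\<And>v. v \<in> ?L \<Longrightarrow> Some v \<in> verts (daisy 3)" by (auto simp: verts_daisy)
  have fB: "finite ?B" using modelD(1)[OF \<mu> V(1)] finite_verts[OF gC] finite_subset by blast
  define a where "a = Min (position ` ?B)"
  define b where "b = Max (position ` ?B)"
  have ne: "?B \<noteq> {}" by (rule modelD(3)[OF \<mu> V(1)])
  have ab: "a \<le> position x" "position x \<le> b" if "x \<in> ?B" for x
    using that fB unfolding a_def b_def by auto
  have "a \<in> position ` ?B" "b \<in> position ` ?B" unfolding a_def b_def using fB ne by (auto intro: Min_in Max_in)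
  then obtain xa xb where xab: "xa \<in> ?B" "position xa = a" "xb \<in> ?B" "position xb = b" by blast
  have gap: "y \<in> ?B" if c: "x \<notin> ?B" "a \<le> position x" "position x \<le> b" and xy: "{x, y} \<in> edges (chain k)" for x y
  proof -
    have "a \<noteq> position x" "b \<noteq> position x" using c(1) xab position_inj by metis+
    then have strict: "a < position x" "position x < b" using c(2,3) by auto
    let ?S = "{u \<in> ?B. position u < position x}"
    have "xa \<in> ?S" "xb \<notin> ?S" using xab strict by auto
    then have s: "?S \<subseteq> ?B" "?S \<noteq> {}" "?S \<noteq> ?B" using xab by blast+
    obtain u w where uw: "u \<in> ?S" "w \<in> ?B - ?S" "{u, w} \<in> edges (chain k)"
      by (rule connected_set_crossing[OF gC modelD(2)[OF \<mu> V(1)] modelD(1)[OF \<mu> V(1)] s])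
    have "position w \<noteq> position x" using position_inj[of w x] uw(2) c(1) by blast
    then have w: "position u < position x" "position x < position w" using uw by auto
    then have p: "position u = position x - 1" "position w = position x + 1" "even (position u)"
      using chain_edge_position[OF uw(3)] by presburger+
    then have "odd (position x)" by presburger
    then have "position y = position x - 1 \<or> position y = position x + 1"
      using chain_edge_position[OF xy] by presburger
    then have "y = u \<or> y = w" using p position_inj by metis
    then show "y \<in> ?B" using uw by blast
  qed
  have out: "position x < a \<or> b < position x" if v: "v \<in> ?L" and x: "x \<in> \<mu> (Some v)" for v x
  proof (rule ccontr)
    assume h: "\<not> ?thesis"
    obtain i j where ij: "v = (i, j)" "i < 3" "j = 0 \<or> j = 1" using v by auto
    let ?v = "(i, 1 - j)"
    have v': "?v \<in> ?L" "?v \<noteq> v" using ij by auto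
    have e: "{Some v, Some ?v} \<in> edges (daisy 3)"
    proof -
      have "{Some v, Some ?v} = {Some (i, 0), Some (i, 1)}" using ij by auto
      then show ?thesis using ij(2) unfolding edges_daisy by blast
    qed
    have disj: "\<mu> (Some v) \<inter> ?B = {}" "\<mu> (Some ?v) \<inter> ?B = {}"
      using modelD(4)[OF \<mu> V(2)[OF v] V(1)] modelD(4)[OF \<mu> V(2)[OF v'(1)] V(1)] by auto
    have xB: "x \<notin> ?B" using x disj(1) by blast
    have only: "\<mu> (Some v) = {x}"
    proof (rule ccontr)
      assume n: "\<mu> (Some v) \<noteq> {x}"
      have s: "{x} \<subseteq> \<mu> (Some v)" "{x} \<noteq> {}" "{x} \<noteq> \<mu> (Some v)" using x n by auto
      obtain s t where "s \<in> {x}" "t \<in> \<mu> (Some v) - {x}" "{s, t} \<in> edges (chain k)"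
        by (rule connected_set_crossing[OF gC modelD(2)[OF \<mu> V(2)[OF v]] modelD(1)[OF \<mu> V(2)[OF v]] s])
      then have "t \<in> ?B" "t \<in> \<mu> (Some v)" using gap[OF xB, of t] h by auto
      then show False using disj(1) by blast
    qed
    obtain s t where "s \<in> \<mu> (Some v)" "t \<in> \<mu> (Some ?v)" "{s, t} \<in> edges (chain k)" using modelD(5)[OF \<mu> e] by blast
    then have "t \<in> ?B" "t \<in> \<mu> (Some ?v)" using gap[OF xB, of t] h only by auto
    then show False using disj(2) by blast
  qed
  have "\<exists>x\<in>\<mu> (Some v). position x \<in> {a - 2, a - 1, b + 1, b + 2}" if v: "v \<in> ?L" for v
  proof -
    have "{None, Some v} \<in> edges (daisy 3)" using v unfolding edges_daisy by blast
    from modelD(5)[OF \<mu> this] obtain y x where yx: "y \<in> ?B" "x \<in> \<mu> (Some v)" "{y, x} \<in> edges (chain k)" by blast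
    have "position x < a \<or> b < position x" by (rule out[OF v yx(2)])
    moreover have "\<bar>position y - position x\<bar> \<le> 2" using chain_edge_position[OF yx(3)] by linarith
    ultimately have "position x \<in> {a - 2, a - 1, b + 1, b + 2}" using ab[OF yx(1)] by auto
    then show ?thesis using yx(2) by blast
  qed
  then obtain f where f: "\<And>v. v \<in> ?L \<Longrightarrow> f v \<in> \<mu> (Some v) \<and> position (f v) \<in> {a - 2, a - 1, b + 1, b + 2}" by metis
  have "inj_on (\<lambda>v. position (f v)) ?L"
  proof (rule inj_onI)
    fix v w assume vw: "v \<in> ?L" "w \<in> ?L" "position (f v) = position (f w)"
    then have "f v = f w" using position_inj by blast
    then have "f v \<in> \<mu> (Some v) \<inter> \<mu> (Some w)" using f[OF vw(1)] f[OF vw(2)] by simp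
    then show "v = w" using modelD(4)[OF \<mu> V(2)[OF vw(1)] V(2)[OF vw(2)]] by blast
  qed
  moreover have "(\<lambda>v. position (f v)) ` ?L \<subseteq> {a - 2, a - 1, b + 1, b + 2}" using f by blast
  ultimately have "card ?L \<le> card {a - 2, a - 1, b + 1, b + 2}" by (rule card_inj_on_le) simp
  moreover have "card ?L = 6" by (simp add: card_cartesian_product)
  moreover have "card {a - 2, a - 1, b + 1, b + 2} \<le> 4" by (simp add: card_insert_if)
  ultimately show False by linarith
qed

text \<open>
  Without its centre a daisy falls apart into single edges, whereas one of two disjoint triangles
  of a chain avoids the branch set of the centre.
\<close>

lemma daisy_edge_outside_centre:
  assumes "{x, y} \<in> edges (daisy k)" "x \<noteq> None" "y \<noteq> None"
  shows "\<exists>i. {x, y} = {Some (i, 0), Some (i, 1)}"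
proof -
  have "(\<exists>i. {x, y} = {Some (i, 0), Some (i, 1)}) \<or> (\<exists>v. {x, y} = {None, Some v})"
    using assms(1) unfolding edges_daisy by blast
  moreover have "{x, y} \<noteq> {None, Some v}" for v using assms(2,3) by (auto simp: doubleton_eq_iff)
  ultimately show ?thesis by blast
qed

lemma daisy_connected_outside_centre:
  assumes U: "U \<subseteq> verts (daisy k)" "connected_set (daisy k) U" "None \<notin> U" "Some (i, j) \<in> U"
  shows "U \<subseteq> {Some (i, 0), Some (i, 1)}"
proof (rule ccontr)
  assume n: "\<not> ?thesis"
  let ?P = "{Some (i, 0 :: nat), Some (i, 1)}"
  have "j = 0 \<or> j = 1" using U(1,4) by (auto simp: verts_daisy)
  then have "U \<inter> ?P \<subseteq> U" "U \<inter> ?P \<noteq> {}" "U \<inter> ?P \<noteq> U" using U(4) n by auto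
  then obtain x y where xy: "x \<in> U \<inter> ?P" "y \<in> U - (U \<inter> ?P)" "{x, y} \<in> edges (daisy k)"
    by (rule connected_set_crossing[OF is_graph_daisy U(2,1)])
  have "x \<in> U" "y \<in> U" using xy by auto
  then have "x \<noteq> None" "y \<noteq> None" using U(3) by metis+
  then obtain i' where i': "{x, y} = {Some (i', 0), Some (i', 1)}" using daisy_edge_outside_centre[OF xy(3)] by blast
  have "x = Some (i, 0) \<or> x = Some (i, 1)" using xy(1) by blast
  then have "i' = i" using i' by (auto simp: doubleton_eq_iff)
  then have "y \<in> ?P" using i' by blast
  then show False using xy(2) by blast
qed

lemma daisy_no_triangle_outside_centre:
  assumes H: "is_graph H" and \<mu>: "model H (daisy k) \<mu>"
    and e: "{u, v} \<in> edges H" "{u, w} \<in> edges H" "{v, w} \<in> edges H"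
  shows "None \<in> \<mu> u \<union> \<mu> v \<union> \<mu> w"
proof (rule ccontr)
  assume n: "None \<notin> \<mu> u \<union> \<mu> v \<union> \<mu> w"
  have V: "u \<in> verts H" "v \<in> verts H" "w \<in> verts H" "u \<noteq> v" "u \<noteq> w" "v \<noteq> w"
    using edge_in_graphD[OF H e(1)] edge_in_graphD[OF H e(2)] edge_in_graphD[OF H e(3)] by auto
  have nn: "None \<notin> \<mu> u" "None \<notin> \<mu> v" "None \<notin> \<mu> w" using n by auto
  obtain x where x: "x \<in> \<mu> u" using modelD(3)[OF \<mu> V(1)] by blast
  obtain i j where ij: "x = Some (i, j)" using x n by (cases x) auto
  let ?P = "{Some (i, 0 :: nat), Some (i, 1)}"
  have inP: "\<mu> s \<subseteq> ?P" if "s \<in> verts H" "None \<notin> \<mu> s" "p \<in> \<mu> s" "p \<in> ?P" for s p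
    using daisy_connected_outside_centre[OF modelD(1)[OF \<mu> that(1)] modelD(2)[OF \<mu> that(1)] that(2)] that(3,4) by auto
  have j: "j = 0 \<or> j = 1" using modelD(1)[OF \<mu> V(1)] x ij by (auto simp: verts_daisy)
  have u: "\<mu> u \<subseteq> ?P" using inP[OF V(1) _ x] n ij j by auto
  have link: "\<mu> s \<subseteq> ?P" if s: "s \<in> verts H" "None \<notin> \<mu> s" "{u, s} \<in> edges H" for s
  proof -
    from modelD(5)[OF \<mu> s(3)] obtain y z where yz: "y \<in> \<mu> u" "z \<in> \<mu> s" "{y, z} \<in> edges (daisy k)" by blast
    have "y \<noteq> None" "z \<noteq> None" using yz(1,2) nn(1) s(2) by metis+
    then obtain i' where i': "{y, z} = {Some (i', 0), Some (i', 1)}" using daisy_edge_outside_centre[OF yz(3)] by blast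
    have "y = Some (i, 0) \<or> y = Some (i, 1)" using u yz(1) by blast
    then have "i' = i" using i' by (auto simp: doubleton_eq_iff)
    then have "z \<in> ?P" using i' by blast
    then show ?thesis using inP[OF s(1,2) yz(2)] by blast
  qed
  have vw: "\<mu> v \<subseteq> ?P" "\<mu> w \<subseteq> ?P" using link[OF V(2) nn(2) e(1)] link[OF V(3) nn(3) e(2)] by auto
  obtain y z where yz: "y \<in> \<mu> v" "z \<in> \<mu> w" using modelD(3)[OF \<mu> V(2)] modelD(3)[OF \<mu> V(3)] by blast
  have "x \<noteq> y" "x \<noteq> z" "y \<noteq> z" using modelD(4)[OF \<mu> V(1,2,4)] modelD(4)[OF \<mu> V(1,3,5)] modelD(4)[OF \<mu> V(2,3,6)] x yz by blast+
  then have "card {x, y, z} = 3" by simp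
  moreover have "{x, y, z} \<subseteq> ?P" using x yz u vw by blast
  then have "card {x, y, z} \<le> card ?P" by (rule card_mono[rotated]) simp
  ultimately show False by simp
qed

lemma chain_not_minor_of_daisy: "\<not> minor (chain 3) (daisy k)"
proof
  assume "minor (chain 3) (daisy k)"
  then obtain \<mu> where \<mu>: "model (chain 3) (daisy k) \<mu>" unfolding minor_iff_model by blast
  have e: "{Inl (i - 1), Inl i} \<in> edges (chain 3) \<and> {Inl (i - 1), Inr i} \<in> edges (chain 3) \<and> {Inl i, Inr i} \<in> edges (chain 3)"
    if "1 \<le> i" "i \<le> 3" for i using that unfolding edges_chain_iff by blast
  have "None \<in> \<mu> (Inl 0) \<union> \<mu> (Inl 1) \<union> \<mu> (Inr 1)"
    using daisy_no_triangle_outside_centre[OF is_graph_chain \<mu>, of "Inl 0" "Inl 1" "Inr 1"] e[of 1] by simp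
  then obtain u where u: "u \<in> {Inl 0, Inl 1, Inr 1}" "None \<in> \<mu> u" by blast
  have "None \<in> \<mu> (Inl 2) \<union> \<mu> (Inl 3) \<union> \<mu> (Inr 3)"
    using daisy_no_triangle_outside_centre[OF is_graph_chain \<mu>, of "Inl 2" "Inl 3" "Inr 3"] e[of 3] by simp
  then obtain w where w: "w \<in> {Inl 2, Inl 3, Inr 3}" "None \<in> \<mu> w" by blast
  have "u \<in> verts (chain 3)" "w \<in> verts (chain 3)" "u \<noteq> w" using u(1) w(1) by (auto simp: chain_def)
  then show False using modelD(4)[OF \<mu>, of u w] u(2) w(2) by blast
qed

section \<open>The obstructions have density at least 3/2\<close>

lemma excess_bounded_mono: "excess_bounded G c \<Longrightarrow> c \<le> d \<Longrightarrow> excess_bounded G d"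
  unfolding excess_bounded_def by fastforce

text \<open>
  The edge bound gives density at most 3/2 and the subgraphs \<open>H\<close> of prescribed order give at least 3/2, so
  the limit exists and equals 3/2.
\<close>

lemma dense_family_obstruction:
  fixes F :: "nat \<Rightarrow> 'a graph" and d :: real
  assumes F: "\<And>k. is_graph (F k)" and b: "\<And>k. excess_bounded (F k) 3"
    and size: "\<And>n. \<exists>k H. 1 \<le> k \<and> subgraph H (F k) \<and> card (verts H) \<le> n \<and> n \<le> card (verts (F k)) \<and>
      3/2 * real n - d \<le> card (edges H)"
  shows "graph_class (minors_of_family F) \<and> minors_of_family F \<notin> density_below (3/2)"
proof -
  have le: "2 * card (edges G) \<le> 3 * card (verts G)" if "G \<in> minors_of_family F" for G
    by (rule minors_of_family_edges[OF F b that])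
  have "limiting_density (minors_of_family F) = ereal (3/2)"
  proof (rule limiting_density_eq)
    fix G assume G: "G \<in> minors_of_family F"
    then show "is_graph G" by (simp add: minors_of_family_def)
    have "real (2 * card (edges G)) \<le> real (3 * card (verts G))" using le[OF G] by (simp only: of_nat_le_iff)
    then show "real (card (edges G)) \<le> 3/2 * real (card (verts G))" by simp
  next
    fix n
    obtain k H where kj: "1 \<le> k" "subgraph H (F k)" "card (verts H) \<le> n" "n \<le> card (verts (F k))"
      "3/2 * real n - d \<le> card (edges H)" using size by blast
    obtain G where "G \<in> minors_of_family F" "card (verts G) = n" "card (edges H) \<le> card (edges G)"
      using minors_of_family_member[where F = F and K = k, OF F kj(1-4)] by blast
    moreover from this have "3/2 * real n - d \<le> real (card (edges G))" using kj(5) by linarith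
    ultimately show "\<exists>G\<in>minors_of_family F. card (verts G) = n \<and> 3/2 * real n - d \<le> real (card (edges G))" by blast
  qed
  then have "minors_of_family F \<notin> density_below (3/2)" by (rule not_density_below) simp
  moreover have "proper_class (minors_of_family F)"
  proof (rule proper_of_few_edges)
    fix G assume "G \<in> minors_of_family F"
    then show "card (edges G) \<le> 2 * card (verts G)" using le[of G] by linarith
  qed
  ultimately show ?thesis using minors_of_family_minor_closed[OF F] by (simp add: graph_class_def)
qed

text \<open>Members of every order: the empty graph at order 0, otherwise the largest cactus that fits.\<close>

lemma cactus_sizes:
  fixes F :: "nat \<Rightarrow> 'a graph"
  assumes F: "\<And>k. is_graph (F k)" and mono: "\<And>j k. j \<le> k \<Longrightarrow> subgraph (F j) (F k)"
    and size: "\<And>k. card (verts (F k)) = 2 * k + 1 \<and> card (edges (F k)) = 3 * k"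
  shows "\<exists>k H. 1 \<le> k \<and> subgraph H (F k) \<and> card (verts H) \<le> n \<and> n \<le> card (verts (F k)) \<and>
      3/2 * real n - 3 \<le> card (edges H)"
proof (cases n)
  case 0
  have "card (verts \<lparr>verts = {}, edges = {}\<rparr>) \<le> n" by simp
  then show ?thesis using 0 empty_subgraph[of "F 1"] by (intro exI[of _ 1] exI[of _ "\<lparr>verts = {}, edges = {}\<rparr>"]) auto
next
  case (Suc m)
  let ?j = "m div 2"
  have "3/2 * real n - 3 \<le> real (3 * ?j)"
  proof -
    have "m \<le> 2 * ?j + 1" by presburger
    then have "real m \<le> real (2 * ?j + 1)" by (simp only: of_nat_le_iff)
    then show ?thesis using Suc by simp
  qed
  moreover have "2 * ?j + 1 \<le> n" "n \<le> 2 * Suc m + 1" "?j \<le> Suc m" "1 \<le> Suc m" using Suc by presburger+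
  ultimately show ?thesis using mono[of ?j "Suc m"] size by (intro exI[of _ "Suc m"] exI[of _ "F ?j"]) simp
qed

lemma daisy_mono: "j \<le> k \<Longrightarrow> subgraph (daisy j) (daisy k)"
proof -
  assume h: "j \<le> k"
  then have L: "{..<j} \<subseteq> {..<k}" by auto
  then have "{..<j} \<times> {0, 1 :: nat} \<subseteq> {..<k} \<times> {0, 1}" by (rule Sigma_mono) (rule subset_refl)
  note P = this
  have "verts (daisy j) \<subseteq> verts (daisy k)"
    unfolding verts_daisy by (intro insert_mono image_mono P)
  moreover have "edges (daisy j) \<subseteq> edges (daisy k)"
    unfolding edges_daisy by (intro Un_mono image_mono P L)
  ultimately show ?thesis using is_graph_daisy by (simp add: subgraph_def)
qed

lemma chain_mono: "j \<le> k \<Longrightarrow> subgraph (chain j) (chain k)"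
proof -
  assume h: "j \<le> k"
  have "edges (chain j) \<subseteq> edges (chain k)"
  proof
    fix e assume "e \<in> edges (chain j)"
    then obtain i where i: "1 \<le> i" "i \<le> j"
      "e = {Inl (i - 1), Inl i} \<or> e = {Inl (i - 1), Inr i} \<or> e = {Inl i, Inr i}"
      unfolding edges_chain_iff by blast
    have "i \<le> k" using i(2) h by simp
    then show "e \<in> edges (chain k)" unfolding edges_chain_iff using i(1,3) by blast
  qed
  moreover have "verts (chain j) \<subseteq> verts (chain k)" using h by (auto simp: chain_def)
  ultimately show ?thesis using is_graph_chain by (simp add: subgraph_def)
qed

lemma daisy_class_obstruction: "graph_class daisy_class \<and> daisy_class \<notin> density_below (3/2)"
  unfolding daisy_class_def
proof (rule dense_family_obstruction[OF is_graph_daisy])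
  show "excess_bounded (daisy k) 3" for k using daisy_facts[of k] excess_bounded_mono[of "daisy k" 0 3] by simp
  show "\<exists>k H. 1 \<le> k \<and> subgraph H (daisy k) \<and> card (verts H) \<le> n \<and> n \<le> card (verts (daisy k)) \<and>
      3/2 * real n - 3 \<le> card (edges H)" for n
    using cactus_sizes[of daisy n, OF is_graph_daisy daisy_mono] daisy_facts by simp
qed

lemma chain_class_obstruction: "graph_class chain_class \<and> chain_class \<notin> density_below (3/2)"
  unfolding chain_class_def
proof (rule dense_family_obstruction[OF is_graph_chain])
  show "excess_bounded (chain k) 3" for k using chain_facts[of k] excess_bounded_mono[of "chain k" 0 3] by simp
  show "\<exists>k H. 1 \<le> k \<and> subgraph H (chain k) \<and> card (verts H) \<le> n \<and> n \<le> card (verts (chain k)) \<and>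
      3/2 * real n - 3 \<le> card (edges H)" for n
    using cactus_sizes[of chain n, OF is_graph_chain chain_mono] chain_facts by simp
qed

lemma tight_sizes:
  assumes "tight A"
  shows "is_graph A" "connected_graph A" "1 \<le> card (verts A)" "2 * card (edges A) = 3 * card (verts A)"
proof -
  show A: "is_graph A" "connected_graph A" using assms by (auto simp: tight_def)
  show "1 \<le> card (verts A)"
    using connected_nonempty[OF A(2)] finite_verts[OF A(1)] by (simp add: Suc_le_eq card_gt_0_iff)
  show "2 * card (edges A) = 3 * card (verts A)" using assms unfolding tight_def excess_def by linarith
qed

lemma class_of_copies_obstruction:
  assumes A: "tight A"
  shows "graph_class (class_of_copies A) \<and> class_of_copies A \<notin> density_below (3/2)"
  unfolding class_of_copies_def
proof (rule dense_family_obstruction[OF is_graph_copies[OF tight_sizes(1)[OF A]]])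
  note s = tight_sizes[OF A]
  show "excess_bounded (copies k A) 3" for k by (rule excess_bounded_copies[OF A])
  fix n
  let ?m = "card (verts A)" and ?j = "n div card (verts A)"
  have j: "?j * ?m \<le> n" "n \<le> ?j * ?m + ?m" "?j \<le> Suc n" "n \<le> Suc n * ?m"
  proof -
    have "n = ?j * ?m + n mod ?m" by simp
    moreover have "n mod ?m < ?m" using s(3) by simp
    ultimately show "?j * ?m \<le> n" "n \<le> ?j * ?m + ?m" by linarith+
    show "?j \<le> Suc n" by (meson div_le_dividend le_SucI)
    have "n * 1 \<le> Suc n * ?m" using s(3) by (intro mult_le_mono) auto
    then show "n \<le> Suc n * ?m" by simp
  qed
  have "3/2 * real n - 3/2 * real ?m \<le> real (?j * card (edges A))"
  proof -
    have "real n \<le> real (?j * ?m) + real ?m" using j(2) by (metis of_nat_add of_nat_le_iff)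
    moreover have "2 * (?j * card (edges A)) = 3 * (?j * ?m)" using s(4) by (metis mult.left_commute)
    then have "2 * real (?j * card (edges A)) = 3 * real (?j * ?m)" by (metis of_nat_mult of_nat_numeral)
    ultimately show ?thesis by linarith
  qed
  then show "\<exists>k H. 1 \<le> k \<and> subgraph H (copies k A) \<and> card (verts H) \<le> n \<and> n \<le> card (verts (copies k A)) \<and>
      3/2 * real n - 3/2 * real ?m \<le> card (edges H)"
    using j copies_mono[OF s(1) j(3)] card_copies[OF s(1)]
    by (intro exI[of _ "Suc n"] exI[of _ "copies ?j A"]) simp
qed

lemma diamond_mono: "j \<le> k \<Longrightarrow> subgraph (diamond j) (diamond k)"
proof -
  assume h: "j \<le> k"
  have "edges (diamond j) \<subseteq> edges (diamond k)"
  proof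
    fix e assume "e \<in> edges (diamond j)"
    then have "e = {Inl False, Inl True} \<or> (\<exists>b i. e = {Inl b, Inr i} \<and> i < j)" unfolding diamond_def by auto
    then show "e \<in> edges (diamond k)"
    proof (elim disjE exE conjE)
      fix b i assume e: "e = {Inl b, Inr i}" and "i < j"
      then have "i < k" using h by simp
      then show ?thesis using e unfolding diamond_def by auto
    qed (simp add: diamond_def)
  qed
  moreover have "verts (diamond j) \<subseteq> verts (diamond k)" using h by (auto simp: diamond_def)
  ultimately show ?thesis using is_graph_diamond by (simp add: subgraph_def)
qed

lemma diamond_class_obstruction: "graph_class diamond_class \<and> diamond_class \<notin> density_below (3/2)"
proof -
  have gr: "is_graph G" and le: "card (edges G) \<le> 2 * card (verts G)" if "G \<in> diamond_class" for G
    using that diamond_minor_edges unfolding diamond_class_def minors_of_family_def by auto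
  have "limiting_density diamond_class = ereal 2"
  proof (rule limiting_density_eq[where b = 3])
    fix G assume G: "G \<in> diamond_class"
    then show "is_graph G" by (rule gr)
    have "real (card (edges G)) \<le> real (2 * card (verts G))" using le[OF G] by (simp only: of_nat_le_iff)
    then show "real (card (edges G)) \<le> 2 * real (card (verts G))" by simp
  next
    fix n :: nat
    have "\<exists>H. subgraph H (diamond (Suc n)) \<and> card (verts H) \<le> n \<and> 2 * real n - 3 \<le> card (edges H)"
    proof (cases "2 \<le> n")
      case True
      then have "real (n - 2) = real n - 2" by simp
      then show ?thesis using True diamond_facts[of "n - 2"] diamond_mono[of "n - 2" "Suc n"]
        by (intro exI[of _ "diamond (n - 2)"]) simp
    next
      case False
      then have "n = 0 \<or> n = 1" by linarith
      then show ?thesis using empty_subgraph[of "diamond (Suc n)"]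
        by (intro exI[of _ "\<lparr>verts = {}, edges = {}\<rparr>"]) auto
    qed
    then obtain H where H: "subgraph H (diamond (Suc n))" "card (verts H) \<le> n" "2 * real n - 3 \<le> card (edges H)" by blast
    have n: "n \<le> card (verts (diamond (Suc n)))" using diamond_facts(2) by simp
    obtain G where "G \<in> diamond_class" "card (verts G) = n" "card (edges H) \<le> card (edges G)"
      using minors_of_family_member[where F = diamond and K = "Suc n", OF is_graph_diamond _ H(1,2) n]
      unfolding diamond_class_def by auto
    moreover from this have "2 * real n - 3 \<le> real (card (edges G))" using H(3) by linarith
    ultimately show "\<exists>G\<in>diamond_class. card (verts G) = n \<and> 2 * real n - 3 \<le> real (card (edges G))" by blast
  qed
  then have "diamond_class \<notin> density_below (3/2)" by (rule not_density_below) simp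
  moreover have "minor_closed diamond_class"
    unfolding diamond_class_def by (rule minors_of_family_minor_closed[OF is_graph_diamond])
  ultimately show ?thesis using proper_of_few_edges[OF le] by (simp add: graph_class_def)
qed

section \<open>The obstructions are pairwise incomparable\<close>

definition obstructions :: "nat graph set set" where
  "obstructions = \<AA> \<union> {daisy_class, chain_class, diamond_class}"

lemma three_copies_not_in_diamond:
  assumes "tight A"
  shows "\<not> minor (copies 3 A) (diamond k)"
proof -
  note s = tight_sizes[OF assms]
  have "edges A \<noteq> {}" using s(3,4) by auto
  then obtain e where e: "e \<in> edges A" by blast
  have c: "{i} \<times> e \<in> edges (copies 3 A)" if "i < 3" for i using e that by (auto simp: copies_def)
  show ?thesis
    by (rule three_disjoint_edges_not_in_diamond[OF is_graph_copies[OF s(1)] c[of 0] c[of 1] c[of 2]]) auto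
qed

lemma daisy_3_not_in_diamond: "\<not> minor (daisy 3) (diamond k)"
proof -
  have e: "{Some (i, 0), Some (i, 1)} \<in> edges (daisy 3)" if "i < 3" for i using that unfolding edges_daisy by blast
  show ?thesis
    by (rule three_disjoint_edges_not_in_diamond[OF is_graph_daisy e[of 0] e[of 1] e[of 2]]) auto
qed

lemma chain_3_not_in_diamond: "\<not> minor (chain 3) (diamond k)"
proof -
  have e: "{Inl (i - 1), Inr i} \<in> edges (chain 3)" if "1 \<le> i" "i \<le> 3" for i
    using that unfolding edges_chain_iff by blast
  show ?thesis
    by (rule three_disjoint_edges_not_in_diamond[OF is_graph_chain e[of 1] e[of 2] e[of 3]]) auto
qed

text \<open>
  Connected members of the class of copies are minors of a single copy and have bounded order.
\<close>

lemma connected_family_not_in_copies: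
  fixes F :: "nat \<Rightarrow> 'a graph"
  assumes F: "\<And>k. is_graph (F k)" "\<And>k. connected_graph (F k)" "\<And>k. k < card (verts (F k))" and A: "is_graph A"
  shows "\<not> minors_of_family F \<subseteq> class_of_copies A"
proof
  assume "minors_of_family F \<subseteq> class_of_copies A"
  then obtain k where "minor (F (Suc (card (verts A)))) (copies k A)"
    using minors_of_family_subsetD[where F = F and F' = "\<lambda>k. copies k A" and j = "Suc (card (verts A))",
        OF F(1) is_graph_copies[OF A]]
    unfolding class_of_copies_def by auto
  then have "minor (F (Suc (card (verts A)))) A" by (rule connected_minor_of_copies[OF A F(1,2)])
  then show False using minor_card_le(1)[OF _ F(1) A] F(3)[of "Suc (card (verts A))"] by fastforce
qed

text \<open>
  By tightness \<open>A\<close> is a minor of \<open>B\<close> of the same order and, both having excess 3, with as many edges.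
\<close>

lemma class_of_copies_in_copies:
  assumes A: "tight A" and B: "tight B" and sub: "class_of_copies A \<subseteq> class_of_copies B"
  shows "class_of_copies A = class_of_copies B"
proof -
  note a = tight_sizes[OF A] and b = tight_sizes[OF B]
  obtain k where k: "minor (copies 1 A) (copies k B)"
    using minors_of_family_subsetD[where F = "\<lambda>k. copies k A" and F' = "\<lambda>k. copies k B" and j = 1,
        OF is_graph_copies[OF a(1)] is_graph_copies[OF b(1)]] sub
    unfolding class_of_copies_def by auto
  have "minor A (copies k B)"
    using minor_trans[OF minor_copies[OF a(1)] k is_graph_copies[OF a(1)] is_graph_copies[OF b(1)] a(1)] by simp
  then have AB: "minor A B" by (rule connected_minor_of_copies[OF b(1) a(1,2)])
  obtain A' :: "nat graph" where A': "is_graph A'" "minor A' A" "verts A' = {..<card (verts A)}"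
    "card (edges A') = card (edges A)" "A \<cong>\<^sub>g A'" using nat_copy[OF a(1)] by metis
  have "minor A' B" by (rule minor_trans[OF A'(2) AB a(1) b(1) A'(1)])
  moreover have "connected_graph A'" by (rule isomorphic_connected[OF A'(5) a(1) A'(1) a(2)])
  moreover have "excess A' = 3" using A A'(3,4) by (simp add: tight_def excess_def)
  ultimately have "card (verts A') = card (verts B)" using B A'(1) unfolding tight_def rigid_def by blast
  then have n: "card (verts A) = card (verts B)" using A'(3) by simp
  then have "card (edges A) = card (edges B)" using a(4) b(4) by simp
  then have "minor B A" using minor_same_size_sym[OF AB a(1) b(1)] n by simp
  then have "class_of_copies B \<subseteq> class_of_copies A"
    unfolding class_of_copies_def
    by (intro minors_of_family_subsetI is_graph_copies a(1) b(1) copies_minor_mono)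
  then show ?thesis using sub by blast
qed

lemma copies_not_in_bounded_excess:
  fixes F :: "nat \<Rightarrow> 'a graph"
  assumes A: "tight A" and F: "\<And>k. is_graph (F k)" "\<And>k. excess_bounded (F k) 0"
  shows "\<not> class_of_copies A \<subseteq> minors_of_family F"
proof
  note a = tight_sizes[OF A]
  assume "class_of_copies A \<subseteq> minors_of_family F"
  then obtain k where k: "minor (copies 1 A) (F k)"
    using minors_of_family_subsetD[where F = "\<lambda>k. copies k A" and F' = F and j = 1,
        OF is_graph_copies[OF a(1)] F(1)]
    unfolding class_of_copies_def by auto
  have "minor A (F k)"
    using minor_trans[OF minor_copies[OF a(1)] k is_graph_copies[OF a(1)] F(1) a(1)] by simp
  then have "excess A \<le> 0" by (rule excess_bounded_minor[OF F(2) a(1,2) _ F(1)])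
  then show False using A by (simp add: tight_def)
qed

lemma diamond_not_in_bounded_excess:
  fixes F :: "nat \<Rightarrow> 'a graph"
  assumes F: "\<And>k. is_graph (F k)" "\<And>k. excess_bounded (F k) 0"
  shows "\<not> minors_of_family diamond \<subseteq> minors_of_family F"
proof
  assume "minors_of_family diamond \<subseteq> minors_of_family F"
  then obtain k where "minor (diamond 4) (F k)"
    using minors_of_family_subsetD[where F = diamond and F' = F and j = 4, OF is_graph_diamond F(1)] by auto
  then have "excess (diamond 4) \<le> 0"
    by (rule excess_bounded_minor[OF F(2) is_graph_diamond diamond_facts(1) _ F(1)])
  then show False using diamond_facts(2,3)[of 4] by (simp add: excess_def)
qed

text \<open>
  The classes are told apart as follows. Classes of copies have connected members of bounded
  order only, unlike the other three. Members of the daisy and chain classes have no connected minor of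
  positive excess, unlike the others. Comparable classes of copies are equal by tightness. The edges
  of a member of the diamond class are covered by two vertices, unlike three disjoint edges. Finally
  \<open>daisy 3\<close> and \<open>chain 3\<close> separate daisies and chains.
\<close>

lemma obstructions_antichain:
  assumes X: "X \<in> obstructions" and Y: "Y \<in> obstructions" and sub: "X \<subseteq> Y"
  shows "X = Y"
proof -
  have cases: "(\<exists>A :: nat graph. Z = class_of_copies A \<and> tight A) \<or> Z = daisy_class \<or> Z = chain_class \<or> Z = diamond_class"
    if "Z \<in> obstructions" for Z
    using that tight_\<A> unfolding obstructions_def \<AA>_def by blast
  have dD: "connected_graph (daisy k)" "excess_bounded (daisy k) 0" "k < card (verts (daisy k))" for k
    using daisy_facts[of k] by auto
  have dC: "connected_graph (chain k)" "excess_bounded (chain k) 0" "k < card (verts (chain k))" for k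
    using chain_facts[of k] by auto
  have dM: "connected_graph (diamond k)" "k < card (verts (diamond k))" for k using diamond_facts[of k] by auto
  note copies = is_graph_copies[OF tight_sizes(1)]
  from cases[OF X] consider A :: "nat graph" where "X = class_of_copies A" "tight A" | "X = daisy_class" | "X = chain_class" | "X = diamond_class"
    by blast
  then show ?thesis
  proof cases
    case (1 A)
    from cases[OF Y] consider B :: "nat graph" where "Y = class_of_copies B" "tight B" | "Y = daisy_class" | "Y = chain_class" | "Y = diamond_class"
      by blast
    then show ?thesis
    proof cases
      case (1 B)
      then show ?thesis using class_of_copies_in_copies[OF \<open>tight A\<close>] \<open>X = class_of_copies A\<close> sub by simp
    next
      case 2
      then show ?thesis using copies_not_in_bounded_excess[where F = daisy, OF 1(2) is_graph_daisy dD(2)] 1(1) sub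
        unfolding daisy_class_def by blast
    next
      case 3
      then show ?thesis using copies_not_in_bounded_excess[where F = chain, OF 1(2) is_graph_chain dC(2)] 1(1) sub
        unfolding chain_class_def by blast
    next
      case 4
      have "minors_of_family (\<lambda>k. copies k A) \<subseteq> minors_of_family diamond"
        using sub 1(1) 4 unfolding class_of_copies_def diamond_class_def by simp
      then obtain k where "minor (copies 3 A) (diamond k)"
        using minors_of_family_subsetD[where F = "\<lambda>k. copies k A" and F' = diamond and j = 3,
            OF copies[OF 1(2)] is_graph_diamond] by auto
      then show ?thesis using three_copies_not_in_diamond[OF 1(2)] by blast
    qed
  next
    case 2
    from cases[OF Y] consider B :: "nat graph" where "Y = class_of_copies B" "tight B" | "Y = daisy_class" | "Y = chain_class" | "Y = diamond_class"
      by blast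
    then show ?thesis
    proof cases
      case (1 B)
      then show ?thesis
        using connected_family_not_in_copies[where F = daisy, OF is_graph_daisy dD(1,3) tight_sizes(1)[OF 1(2)]] 2 sub
        unfolding daisy_class_def by blast
    next
      case 3
      have "minors_of_family daisy \<subseteq> minors_of_family chain"
        using sub 2 3 unfolding daisy_class_def chain_class_def by simp
      then obtain k where "minor (daisy 3) (chain k)"
        using minors_of_family_subsetD[where F = daisy and F' = chain and j = 3, OF is_graph_daisy is_graph_chain] by auto
      then show ?thesis using daisy_not_minor_of_chain by blast
    next
      case 4
      have "minors_of_family daisy \<subseteq> minors_of_family diamond"
        using sub 2 4 unfolding daisy_class_def diamond_class_def by simp
      then obtain k where "minor (daisy 3) (diamond k)"
        using minors_of_family_subsetD[where F = daisy and F' = diamond and j = 3, OF is_graph_daisy is_graph_diamond] by auto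
      then show ?thesis using daisy_3_not_in_diamond by blast
    qed (use 2 in simp)
  next
    case 3
    from cases[OF Y] consider B :: "nat graph" where "Y = class_of_copies B" "tight B" | "Y = daisy_class" | "Y = chain_class" | "Y = diamond_class"
      by blast
    then show ?thesis
    proof cases
      case (1 B)
      then show ?thesis
        using connected_family_not_in_copies[where F = chain, OF is_graph_chain dC(1,3) tight_sizes(1)[OF 1(2)]] 3 sub
        unfolding chain_class_def by blast
    next
      case 2
      have "minors_of_family chain \<subseteq> minors_of_family daisy"
        using sub 2 3 unfolding daisy_class_def chain_class_def by simp
      then obtain k where "minor (chain 3) (daisy k)"
        using minors_of_family_subsetD[where F = chain and F' = daisy and j = 3, OF is_graph_chain is_graph_daisy] by auto
      then show ?thesis using chain_not_minor_of_daisy by blast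
    next
      case 4
      have "minors_of_family chain \<subseteq> minors_of_family diamond"
        using sub 3 4 unfolding chain_class_def diamond_class_def by simp
      then obtain k where "minor (chain 3) (diamond k)"
        using minors_of_family_subsetD[where F = chain and F' = diamond and j = 3, OF is_graph_chain is_graph_diamond] by auto
      then show ?thesis using chain_3_not_in_diamond by blast
    qed (use 3 in simp)
  next
    case 4
    from cases[OF Y] consider B :: "nat graph" where "Y = class_of_copies B" "tight B" | "Y = daisy_class" | "Y = chain_class" | "Y = diamond_class"
      by blast
    then show ?thesis
    proof cases
      case (1 B)
      then show ?thesis
        using connected_family_not_in_copies[where F = diamond, OF is_graph_diamond dM tight_sizes(1)[OF 1(2)]] 4 sub
        unfolding diamond_class_def by blast
    next
      case 2
      then show ?thesis using diamond_not_in_bounded_excess[where F = daisy, OF is_graph_daisy dD(2)] 4 sub unfolding daisy_class_def diamond_class_def by blast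
    next
      case 3
      then show ?thesis using diamond_not_in_bounded_excess[where F = chain, OF is_graph_chain dC(2)] 4 sub unfolding chain_class_def diamond_class_def by blast
    qed (use 4 in simp)
  qed
qed

section \<open>Classes without obstructions have density below 3/2\<close>

text \<open>
  Each excluded obstruction excludes one of its generating graphs as a minor of all members. Up to
  isomorphism \<open>\<A>\<close> is finite; copies on at most ten natural numbers represent all minimal dense graphs,
  which makes the number of excluded copies uniform.
\<close>

lemma contains_obstruction:
  assumes gc: "graph_class \<G>" and dens: "\<G> \<notin> density_below (3/2)"
  shows "\<exists>X\<in>obstructions. X \<subseteq> \<G>"
proof (rule ccontr)
  assume no: "\<not> ?thesis"
  have mc: "minor_closed \<G>" using gc by (simp add: graph_class_def)
  have out: "\<not> daisy_class \<subseteq> \<G>" "\<not> chain_class \<subseteq> \<G>" "\<not> diamond_class \<subseteq> \<G>"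
    "\<And>A. A \<in> \<A> \<Longrightarrow> \<not> class_of_copies A \<subseteq> \<G>"
    using no unfolding obstructions_def \<AA>_def by blast+
  obtain k where "1 \<le> k" and k: "\<forall>G\<in>\<G>. \<not> minor (daisy k) G"
    by (rule minors_of_family_not_subset[OF is_graph_daisy mc out(1)[unfolded daisy_class_def]])
  obtain l where "1 \<le> l" and l: "\<forall>G\<in>\<G>. \<not> minor (chain l) G"
    by (rule minors_of_family_not_subset[OF is_graph_chain mc out(2)[unfolded chain_class_def]])
  obtain m where "1 \<le> m" and m: "\<forall>G\<in>\<G>. \<not> minor (diamond m) G"
    by (rule minors_of_family_not_subset[OF is_graph_diamond mc out(3)[unfolded diamond_class_def]])
  have "\<exists>j. \<forall>G\<in>\<G>. \<not> minor (copies j A) G" if A: "A \<in> \<A>" for A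
    by (rule minors_of_family_not_subset[OF is_graph_copies[OF tight_sizes(1)[OF tight_\<A>[OF A]]] mc
          out(4)[OF A, unfolded class_of_copies_def]]) blast
  then obtain f where f: "\<And>A G. A \<in> \<A> \<Longrightarrow> G \<in> \<G> \<Longrightarrow> \<not> minor (copies (f A) A) G" by metis
  let ?c = "((2 * k * (m + 1) + 1) ^ (2 * l))\<^sup>2"
  let ?S = "{A \<in> \<A>. verts A \<subseteq> {..<10}}"
  have c: "card (edges G) \<le> card (verts G) + ?c" if G: "G \<in> \<G>" "connected_graph G" for G
  proof (rule ccontr)
    assume "\<not> ?thesis"
    then have "card (verts G) + ?c \<le> card (edges G)" by simp
    then show False
      using large_excess_forces_minor[OF minor_closedD(1)[OF mc G(1)] G(2)] k l m G(1) by blast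
  qed
  have fin: "finite ?S"
  proof (rule finite_subset)
    show "?S \<subseteq> (\<lambda>(V, E). \<lparr>verts = V, edges = E\<rparr>) ` (Pow {..<10} \<times> Pow (Pow {..<10}))"
    proof
      fix A assume A: "A \<in> ?S"
      then have "is_graph A" using tight_sizes(1)[OF tight_\<A>] by blast
      then have "edges A \<subseteq> Pow {..<10}" using A by (auto simp: is_graph_def)
      then have "(verts A, edges A) \<in> Pow {..<10} \<times> Pow (Pow {..<10})" using A by auto
      moreover have "A = (\<lambda>(V, E). \<lparr>verts = V, edges = E\<rparr>) (verts A, edges A)" by simp
      ultimately show "A \<in> (\<lambda>(V, E). \<lparr>verts = V, edges = E\<rparr>) ` (Pow {..<10} \<times> Pow (Pow {..<10}))"
        by (rule rev_image_eqI)
    qed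
  qed simp
  have dense: "\<exists>A\<in>?S. minor A H" if H: "H \<in> \<G>" "connected_graph H" "dense H" for H
  proof -
    obtain A where A: "minimal_dense A" "minor A H" "verts A = {..<card (verts A)}"
      using minimal_dense_minor[OF minor_closedD(1)[OF mc H(1)] H(2,3)] by blast
    have "A \<in> \<A> \<and> card (verts A) \<le> 10" by (rule minimal_dense_in_\<A>[OF A(1)])
    moreover have "verts A \<subseteq> {..<10}" by (subst A(3)) (use calculation in auto)
    ultimately have "A \<in> ?S" by blast
    then show ?thesis using A(2) by blast
  qed
  have few: "\<not> minor (copies (f A) A) G" if "A \<in> ?S" "G \<in> \<G>" for A G
    by (rule f[OF _ that(2)]) (use that(1) in simp)
  let ?\<theta> = "3/2 - 1 / (8 * real ?c + 8)" and ?b = "real ?c * (\<Sum>A\<in>?S. f A)"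
  have bound: "real (card (edges G)) \<le> ?\<theta> * card (verts G) + ?b" if G: "G \<in> \<G>" for G
    by (rule density_bounded_away[OF mc c fin few dense G])
  have "limiting_density \<G> < ereal (3/2)"
  proof (cases "finite_class \<G>")
    case True
    then show ?thesis by (simp add: limiting_density_def)
  next
    case False
    have le: "limiting_density \<G> \<le> ereal ?\<theta>" by (rule limiting_density_le[OF mc False c bound])
    have "?\<theta> < 3/2"
    proof -
      have "0 < 8 * real ?c + 8" using of_nat_0_le_iff[where ?'a = real, of ?c] by linarith
      then have "0 < 1 / (8 * real ?c + 8)" by (rule divide_pos_pos[OF zero_less_one])
      then show ?thesis by linarith
    qed
    then have "ereal ?\<theta> < ereal (3/2)" by (simp only: less_ereal.simps)
    then show ?thesis by (rule le_less_trans[OF le])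
  qed
  then show False using gc dens by (simp add: density_below_def)
qed

theorem theorem3p14:
  "cobs (density_below (3/2)) = \<AA> \<union> {daisy_class, chain_class, diamond_class}"
proof -
  have obs: "graph_class X \<and> X \<notin> density_below (3/2)" if "X \<in> obstructions" for X
    using that daisy_class_obstruction chain_class_obstruction diamond_class_obstruction
      class_of_copies_obstruction[OF tight_\<A>]
    unfolding obstructions_def \<AA>_def by blast
  have "cobs (density_below (3/2)) = obstructions"
  proof (intro equalityI subsetI)
    fix X assume X: "X \<in> cobs (density_below (3/2))"
    then obtain Y where Y: "Y \<in> obstructions" "Y \<subseteq> X" using contains_obstruction unfolding cobs_def by blast
    then have "Y = X" using X obs unfolding cobs_def by blast
    then show "X \<in> obstructions" using Y by simp
  next
    fix X assume X: "X \<in> obstructions"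
    have "H = X" if H: "graph_class H" "H \<notin> density_below (3/2)" "H \<subseteq> X" for H
    proof -
      obtain Y where Y: "Y \<in> obstructions" "Y \<subseteq> H" using contains_obstruction[OF H(1,2)] by blast
      then have "Y = X" using obstructions_antichain[OF Y(1) X] H(3) by blast
      then show ?thesis using Y(2) H(3) by blast
    qed
    then show "X \<in> cobs (density_below (3/2))" using obs[OF X] unfolding cobs_def by blast
  qed
  then show ?thesis by (simp add: obstructions_def)
qed

end
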